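(* Consider the saturated-observation model and the TSQN algorithm described in the context, and suppose Assumptions (A1), (A2), (A3) of the context hold. Define the adaptive predictor $\hat y_{k+1}=G_k(\phi_k^T\hat\theta_k)$ and the regret $R_k=(\mathbb E_k\{y_{k+1}\}-\hat y_{k+1})^2$. Let $\lambda_0>\|P_0^{-1}\|$ and let $\lambda_{\max}(k)$ be the maximum eigenvalue of $\sum_{i=0}^{k}\phi_i\phi_i^T+\lambda_0I$. Then, as $k\to\infty$, $$\sum_{i=1}^{k}R_i=O(\log\lambda_{\max}(k))\quad\text{a.s.}$$
   Context: Model: on a probability space with a non-decreasing sequence of $\sigma$-algebras $\{\mathcal F_k,k\ge0\}$ (write $\mathbb E_k\{\cdot\}=\mathbb E\{\cdot\mid\mathcal F_k\}$), observations are $y_{k+1}=S_k(\phi_k^T\theta+e_{k+1})$, $k=0,1,\dots$, where $\theta\in\mathbb R^m$ is unknown, $\phi_k\in\mathbb R^m$ is the regressor, $e_{k+1}\in\mathbb R$ the noise, and $S_k(x)=L_k$ if $x<l_k$, $S_k(x)=x$ if $l_k\le x\le u_k$, $S_k(x)=U_k$ if $x>u_k$. (A1) $\{\phi_k,\mathcal F_k\}$ is a bounded adapted sequence; $\theta$ is an interior point of a known convex compact set $D\subseteq\mathbb R^m$. $\{M_k\}$ is an a.s. bounded sequence with $\sup_{x\in D}|\phi_k^Tx|\le M_k$ a.s. (A2) The thresholds $\{l_k\},\{u_k\},\{L_k\},\{U_k\}$ are known sequences adapted to $\{\mathcal F_k\}$ with $l_k-c\le L_k\le l_k\le u_k\le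 U_k\le u_k+c$ a.s. for all $k$, and $\sup_k\max(l_k,0)\le l$, $\sup_k\max(-u_k,0)\le u$ a.s., where $c,l,u$ are non-negative random variables with finite second moments. (A3) $\{e_k,\mathcal F_k\}$ is a square-integrable martingale difference sequence and for some constant $\eta>0$: $\inf_k\mathbb E_k\{|e_{k+1}|^2\}>0$ and $\sup_k\mathbb E_k\{|e_{k+1}|^{2+\eta}\}<\infty$ a.s. The function $G_k(x)=\mathbb E_k\{S_k(x+e_{k+1})\}$ is known and differentiable with derivative $G_k'$, and there is a random variable $M>\sup_kM_k$ with $0<\inf_{|x|\le M,k\ge0}G_k'(x)<\sup_{|x|\le M,k\ge0}G_k'(x)<\infty$ a.s. and $|G_k'(x)-G_k'(y)|\le\rho|x-y|$ a.s. for all $|x|,|y|\le M$, for some non-negative random variable $\rho$. Notation: $\underline g_k=\inf_{|x|\le M_k}G_k'(x)$, $\overline g_k=\sup_{|x|\le M_k}G_k'(x)$. For positive definite $Q$, $\|x\|_Q^2=x^TQx$ and $\Pi_Q(x)=\arg\min_{y\in D}\|x-y\|_Q$. TSQN algorithm. Step 1: with $\bar\theta_0\in D$, $\bar P_0>0$ arbitrary, $\bar\theta_{k+1}=\Pi_{\bar P_{k+1}^{-1}}\{\bar\theta_k+\bar a_k\bar\beta_k\bar P_k\phi_k[y_{k+1}-G_k(\phi_k^T\bar\theta_k)]\}$, $\bar P_{k+1}=\bar P_k-\bar a_k\bar\beta_k^2\bar P_k\phi_k\phi_k^T\bar P_k$, $\bar\beta_k=\min\{\underline g_k,\frac{1}{2\overline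 g_k\phi_k^T\bar P_k\phi_k+1}\}$, $\bar a_k=\frac{1}{1+\bar\beta_k^2\phi_k^T\bar P_k\phi_k}$. Step 2: with $\hat\theta_0\in D$, $P_0>0$ arbitrary, $\hat\theta_{k+1}=\Pi_{P_{k+1}^{-1}}\{\hat\theta_k+a_k\beta_kP_k\phi_k[y_{k+1}-G_k(\phi_k^T\hat\theta_k)]\}$, $P_{k+1}=P_k-a_k\beta_k^2P_k\phi_k\phi_k^TP_k$, $\beta_k=\frac{G_k(\phi_k^T\bar\theta_k)-G_k(\phi_k^T\hat\theta_k)}{\phi_k^T\bar\theta_k-\phi_k^T\hat\theta_k}$ if $\phi_k^T\hat\theta_k\neq\phi_k^T\bar\theta_k$ and $\beta_k=G_k'(\phi_k^T\hat\theta_k)$ otherwise, $a_k=\frac{1}{\mu_k+\beta_k^2\phi_k^TP_k\phi_k}$, where $\{\mu_k\}$ is any positive process adapted to $\{\mathcal F_k\}$ with $0<\inf_k\mu_k\le\sup_k\mu_k<\infty$.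
   Formalization: The bound is proved as O(max{1, log λ_max(k)}), since O(log λ_max(k)) fails when λ_max(k) tends to 1 (possible if λ_0<1); and the bounds M_k are assumed adapted to F_k, as the recursion needs. *)

theory Defs
  imports "HOL-Analysis.Analysis" "HOL-Probability.Probability" "HOL-Library.Landau_Symbols"
begin

definition sat :: "real \<Rightarrow> real \<Rightarrow> real \<Rightarrow> real \<Rightarrow> real \<Rightarrow> real" where
  "sat L l u U x = (if x < l then L else if x \<le> u then x else U)"

definition outer :: "real^'n \<Rightarrow> real^'n \<Rightarrow> real^'n^'n" where
  "outer u v = (\<chi> i j. u $ i * v $ j)"

definition pos_def :: "real^'n^'n \<Rightarrow> bool" where
  "pos_def Q \<longleftrightarrow> transpose Q = Q \<and> (\<forall>x. x \<noteq> 0 \<longrightarrow> x \<bullet> (Q *v x) > 0)"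

definition qnorm :: "real^'n^'n \<Rightarrow> real^'n \<Rightarrow> real" where
  "qnorm Q x = sqrt (x \<bullet> (Q *v x))"

definition projQ :: "real^'n^'n \<Rightarrow> (real^'n) set \<Rightarrow> real^'n \<Rightarrow> real^'n" where
  "projQ Q D x = (SOME y. y \<in> D \<and> (\<forall>z\<in>D. qnorm Q (x - y) \<le> qnorm Q (x - z)))"

definition max_eig :: "real^'n^'n \<Rightarrow> real" where
  "max_eig A = Max {lam. \<exists>v. v \<noteq> 0 \<and> A *v v = lam *\<^sub>R v}"

text \<open>Step 1 of TSQN (pathwise). Arguments: regressors phi k, observations y k (= y_{k+1}),
  functions G k, lower/upper derivative bounds gl k, gu k, the set D, and the initial values.
  Returns (bar theta_k, bar P_k).\<close>
fun tsqn1 :: "(nat \<Rightarrow> real^'m) \<Rightarrow> (nat \<Rightarrow> real) \<Rightarrow> (nat \<Rightarrow> real \<Rightarrow> real) \<Rightarrow>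
    (nat \<Rightarrow> real) \<Rightarrow> (nat \<Rightarrow> real) \<Rightarrow> (real^'m) set \<Rightarrow> real^'m \<Rightarrow> real^'m^'m \<Rightarrow> nat
    \<Rightarrow> (real^'m) \<times> (real^'m^'m)" where
  "tsqn1 phi y G gl gu D th0 P0 0 = (th0, P0)"
| "tsqn1 phi y G gl gu D th0 P0 (Suc k) =
    (let (th, P) = tsqn1 phi y G gl gu D th0 P0 k;
         ph = phi k;
         b = min (gl k) (1 / (2 * gu k * (ph \<bullet> (P *v ph)) + 1));
         a = 1 / (1 + b\<^sup>2 * (ph \<bullet> (P *v ph)));
         P' = P - (a * b\<^sup>2) *\<^sub>R (P ** outer ph ph ** P);
         th' = projQ (matrix_inv P') D (th + (a * b * (y k - G k (ph \<bullet> th))) *\<^sub>R (P *v ph))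
     in (th', P'))"

text \<open>Step 2 of TSQN (pathwise). thb k is the first-step estimate bar theta_k, G' the derivative,
  mu the weights. Returns (hat theta_k, P_k).\<close>
fun tsqn2 :: "(nat \<Rightarrow> real^'m) \<Rightarrow> (nat \<Rightarrow> real) \<Rightarrow> (nat \<Rightarrow> real \<Rightarrow> real) \<Rightarrow>
    (nat \<Rightarrow> real \<Rightarrow> real) \<Rightarrow> (nat \<Rightarrow> real) \<Rightarrow> (nat \<Rightarrow> real^'m) \<Rightarrow> (real^'m) set \<Rightarrow>
    real^'m \<Rightarrow> real^'m^'m \<Rightarrow> nat \<Rightarrow> (real^'m) \<times> (real^'m^'m)" where
  "tsqn2 phi y G G' mu thb D th0 P0 0 = (th0, P0)"
| "tsqn2 phi y G G' mu thb D th0 P0 (Suc k) =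
    (let (th, P) = tsqn2 phi y G G' mu thb D th0 P0 k;
         ph = phi k;
         b = (if ph \<bullet> th \<noteq> ph \<bullet> thb k
              then (G k (ph \<bullet> thb k) - G k (ph \<bullet> th)) / (ph \<bullet> thb k - ph \<bullet> th)
              else G' k (ph \<bullet> th));
         a = 1 / (mu k + b\<^sup>2 * (ph \<bullet> (P *v ph)));
         P' = P - (a * b\<^sup>2) *\<^sub>R (P ** outer ph ph ** P);
         th' = projQ (matrix_inv P') D (th + (a * b * (y k - G k (ph \<bullet> th))) *\<^sub>R (P *v ph))
     in (th', P'))"

definition tsqn_est :: "(nat \<Rightarrow> real^'m) \<Rightarrow> (nat \<Rightarrow> real) \<Rightarrow> (nat \<Rightarrow> real \<Rightarrow> real) \<Rightarrow>
    (nat \<Rightarrow> real \<Rightarrow> real) \<Rightarrow> (nat \<Rightarrow> real) \<Rightarrow> (nat \<Rightarrow> real) \<Rightarrow> (real^'m) set \<Rightarrow>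
    real^'m \<Rightarrow> real^'m^'m \<Rightarrow> real^'m \<Rightarrow> real^'m^'m \<Rightarrow> nat \<Rightarrow> real^'m" where
  "tsqn_est phi y G G' Mk mu D thb0 Pb0 th0 P0 k =
    (let gl = (\<lambda>j. Inf (G' j ` {- Mk j .. Mk j}));
         gu = (\<lambda>j. Sup (G' j ` {- Mk j .. Mk j}));
         thb = (\<lambda>j. fst (tsqn1 phi y G gl gu D thb0 Pb0 j))
     in fst (tsqn2 phi y G G' mu thb D th0 P0 k))"

end

theory Submission
  imports Defs
begin

text \<open>
  Both steps are instances of one projected quasi-Newton recursion. The inverse covariance \<open>R\<close> grows
  by rank-one terms and the projection does not increase the \<open>R\<close>-weighted distance to \<open>theta\<close>, so
  the weighted squared error \<open>V\<close> satisfies a drift inequality: it decreases by a multiple of the squared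
  prediction error, up to a martingale term \<open>f * w\<close> and a term \<open>h * w\<^sup>2\<close> in the noise
  \<open>w\<close>. Here \<open>h\<close> is at most the increment of \<open>ln \<bar>det R\<bar>\<close>, so its sum is of the order of the
  logarithm of the largest eigenvalue, and a weighted martingale maximal inequality shows that \<open>\<Sum> h * w\<^sup>2\<close> is
  of the same order, while \<open>\<Sum> f * w\<close> is at most of the order of \<open>(1 + \<Sum> f\<^sup>2) powr (3/4)\<close>, which the
  drift absorbs. In the first step this bounds \<open>\<Sum> (phi \<bullet> (theta - thb))\<^sup>2\<close>. In the second step the
  slope \<open>b\<close> differs from the true slope of \<open>G\<close> by at most a multiple of
  \<open>\<bar>phi \<bullet> (theta - thb)\<bar>\<close>, so the linearisation error is summable to the same order and the
  drift bounds the regret.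

  All bounds in the assumptions are random. The noise is therefore localised on events of the past on
  which they are at most \<open>N\<close>, and these events exhaust the space almost surely.
\<close>

section \<open>Positive definite matrices, weighted projections and determinants\<close>

text \<open>The assumptions fix \<open>G k\<close> only for each constant argument, with an
  exceptional null set depending on that argument, whereas the regret needs the conditional mean of
  the observation at the random argument \<open>phi \<bullet> theta\<close>. Monotonicity of the
  saturation and continuity of \<open>G k\<close> allow comparison with rational arguments, so the
  noise may depend on the past.

  The two gains need different arguments. In the first step \<open>b\<close> stays below the true
  slope, and the signs of the drift terms decide. In the second step \<open>b\<close> may lie on
  either side of the true slope, so the drift is written as a squared linearisation error minus a
  multiple of the squared prediction error.

  The exponent 3/4 is one choice from the open interval between 1/2 and 1: above 1/2 the normalised
  squares of the coefficients have a bounded sum, below 1 the martingale term is sublinear and can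
  be absorbed. The moments of order above two make the excess of the squared noise over the running
  weight summable.\<close>

lemma outer_mult_vec: "outer u v *v x = (v \<bullet> x) *\<^sub>R u"
  by (simp add: vec_eq_iff outer_def matrix_vector_mult_def inner_vec_def sum_distrib_left mult_ac)

lemma scaleR_matrix_vec: "((c::real) *\<^sub>R (A::real^'n^'m)) *v x = c *\<^sub>R (A *v x)"
  by (simp add: vec_eq_iff matrix_vector_mult_def sum_distrib_left mult_ac)

lemma rank_one_update_vec:
  "(P - c *\<^sub>R (P ** outer u u ** P)) *v x = P *v x - (c * (u \<bullet> (P *v x))) *\<^sub>R (P *v u)"
  by (simp add: matrix_vector_mult_diff_rdistrib scaleR_matrix_vec matrix_vector_mul_assoc[symmetric]
      outer_mult_vec matrix_vector_mult_scaleR)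

lemma symmetric_inner:
  assumes "transpose (Q::real^'n^'n) = Q"
  shows "x \<bullet> (Q *v y) = y \<bullet> (Q *v x)"
  using assms by (metis dot_lmul_matrix inner_commute vector_transpose_matrix)

lemma symmetric_iff_inner:
  assumes "\<And>x y. x \<bullet> ((Q::real^'n^'n) *v y) = y \<bullet> (Q *v x)"
  shows "transpose Q = Q"
proof -
  have "transpose Q *v y = Q *v y" for y
  proof -
    have "x \<bullet> (transpose Q *v y) = x \<bullet> (Q *v y)" for x
      by (metis assms dot_lmul_matrix inner_commute transpose_matrix_vector)
    then show ?thesis by (metis vector_eq_ldot)
  qed
  then show ?thesis by (simp add: matrix_eq)
qed

lemma pos_def_nonneg: "pos_def Q \<Longrightarrow> 0 \<le> x \<bullet> (Q *v x)"
  unfolding pos_def_def by (cases "x = 0") (auto intro: less_imp_le)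

lemma pos_def_eq_0: "pos_def Q \<Longrightarrow> x \<bullet> (Q *v x) \<le> 0 \<Longrightarrow> x = 0"
  unfolding pos_def_def by (meson not_le)

text \<open>\<open>matrix_inv\<close> is a choice; for square matrices a one-sided inverse is
  two-sided, which leaves a single candidate.\<close>

lemma matrix_inv_unique_left:
  fixes P R :: "real^'n^'n"
  assumes "P ** R = mat 1"
  shows "matrix_inv P = R"
proof -
  have RP: "R ** P = mat 1" using assms matrix_left_right_inverse by blast
  have "\<exists>A'. P ** A' = mat 1 \<and> A' ** P = mat 1" using assms RP by blast
  then have *: "P ** matrix_inv P = mat 1 \<and> matrix_inv P ** P = mat 1"
    unfolding matrix_inv_def by (rule someI_ex)
  have "matrix_inv P = (matrix_inv P ** P) ** R"
    by (simp add: matrix_mul_assoc[symmetric] assms)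
  then show ?thesis using * by simp
qed

text \<open>Evaluating the form of \<open>R\<close> at \<open>P *v x\<close> gives the form of
  \<open>P\<close> at \<open>x\<close>.\<close>

lemma pos_def_inverse_pair:
  assumes "pos_def R" "P ** R = mat 1"
  shows "pos_def P"
proof -
  have RP: "R *v (P *v x) = x" for x
    using assms(2) matrix_left_right_inverse matrix_vector_mul_assoc matrix_vector_mul_lid by metis
  have "x \<bullet> (P *v y) = y \<bullet> (P *v x)" for x y
    using symmetric_inner[of R "P *v x" "P *v y"] assms(1)
    by (simp add: RP pos_def_def inner_commute)
  then have sym: "transpose P = P" by (rule symmetric_iff_inner)
  have "0 < x \<bullet> (P *v x)" if "x \<noteq> 0" for x
  proof -
    have "P *v x \<noteq> 0" using RP[of x] that by auto
    then have "0 < (P *v x) \<bullet> (R *v (P *v x))" using assms(1) by (simp add: pos_def_def)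
    then show ?thesis by (simp add: RP inner_commute)
  qed
  then show ?thesis using sym by (simp add: pos_def_def)
qed

lemma pos_def_invertible:
  assumes "pos_def (P::real^'n^'n)"
  shows "P ** matrix_inv P = mat 1"
proof -
  have "\<forall>x. P *v x = 0 \<longrightarrow> x = 0"
    using assms pos_def_eq_0[OF assms] by (metis inner_zero_right order_refl)
  then obtain R where "R ** P = mat 1"
    using matrix_left_invertible_ker by blast
  then have "P ** R = mat 1" using matrix_left_right_inverse by blast
  then show ?thesis using matrix_inv_unique_left by metis
qed

lemma pos_def_matrix_inv:
  assumes "pos_def (P::real^'n^'n)" shows "pos_def (matrix_inv P)"
  using assms pos_def_invertible matrix_left_right_inverse pos_def_inverse_pair by metis

text \<open>Sherman--Morrison with weight \<open>mu\<close>. Applied to a vector, every correction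
  is a multiple of \<open>P *v f\<close>, so the matrix identity reduces to a scalar one. It allows
  the analysis to follow the inverse covariance, which grows by plain summation.\<close>

lemma covariance_update_inverse:
  fixes P R :: "real^'n^'n"
  assumes inv: "P ** R = mat 1" and mu: "mu > 0" and s: "0 \<le> f \<bullet> (P *v f)"
    and a: "a = 1 / (mu + b\<^sup>2 * (f \<bullet> (P *v f)))"
  shows "(P - (a * b\<^sup>2) *\<^sub>R (P ** outer f f ** P)) ** (R + (b\<^sup>2 / mu) *\<^sub>R outer f f) = mat 1"
proof -
  have PR: "P *v (R *v x) = x" for x using inv by (simp add: matrix_vector_mul_assoc)
  define s' where "s' = f \<bullet> (P *v f)"
  have pos: "mu + b\<^sup>2 * s' > 0" using mu s by (simp add: s'_def add_pos_nonneg)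
  \<comment> \<open>The purpose of the gain \<open>a\<close>: with this identity the coefficients of
    \<open>P *v f\<close> cancel below.\<close>
  have c1: "a * b\<^sup>2 * (1 + b\<^sup>2 / mu * s') = b\<^sup>2 / mu"
    using pos mu unfolding a s'_def[symmetric] by (simp add: divide_simps)
  have c: "a * b\<^sup>2 * (t + b\<^sup>2 * t * s' / mu) = b\<^sup>2 * t / mu" for t
  proof -
    have "a * b\<^sup>2 * (t + b\<^sup>2 * t * s' / mu) = a * b\<^sup>2 * (1 + b\<^sup>2 / mu * s') * t"
      by (simp add: algebra_simps)
    also have "\<dots> = b\<^sup>2 / mu * t" by (simp only: c1)
    finally show ?thesis by simp
  qed
  have "((P - (a * b\<^sup>2) *\<^sub>R (P ** outer f f ** P)) ** (R + (b\<^sup>2 / mu) *\<^sub>R outer f f)) *v x = x" for x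
  proof -
    define t where "t = f \<bullet> x"
    have "(R + (b\<^sup>2 / mu) *\<^sub>R outer f f) *v x = R *v x + (b\<^sup>2 / mu * t) *\<^sub>R f"
      by (simp add: matrix_vector_mult_add_rdistrib scaleR_matrix_vec outer_mult_vec t_def)
    then have "P *v ((R + (b\<^sup>2 / mu) *\<^sub>R outer f f) *v x) = x + (b\<^sup>2 / mu * t) *\<^sub>R (P *v f)"
      by (simp add: matrix_vector_right_distrib matrix_vector_mult_scaleR PR)
    then show ?thesis
      unfolding matrix_vector_mul_assoc[symmetric] rank_one_update_vec
      by (simp add: inner_add_right c t_def[symmetric] s'_def[symmetric])
  qed
  then show ?thesis by (simp add: matrix_eq)
qed

lemma pos_def_add_outer:
  assumes "pos_def R" "0 \<le> c"
  shows "pos_def (R + c *\<^sub>R outer f f)"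
proof -
  have v: "x \<bullet> ((R + c *\<^sub>R outer f f) *v y) = x \<bullet> (R *v y) + c * (f \<bullet> x) * (f \<bullet> y)" for x y
    by (simp add: matrix_vector_mult_add_rdistrib scaleR_matrix_vec outer_mult_vec inner_add_right inner_commute mult_ac)
  have "transpose (R + c *\<^sub>R outer f f) = R + c *\<^sub>R outer f f"
    by (rule symmetric_iff_inner) (use assms symmetric_inner[of R] in \<open>simp add: v pos_def_def mult_ac\<close>)
  moreover have "0 < x \<bullet> ((R + c *\<^sub>R outer f f) *v x)" if "x \<noteq> 0" for x
    using assms that unfolding v pos_def_def by (auto simp: add_pos_nonneg mult.assoc)
  ultimately show ?thesis by (simp add: pos_def_def)
qed

section \<open>Projection onto a convex compact set in a weighted norm\<close>

lemma qnorm_le_iff: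
  "pos_def Q \<Longrightarrow> qnorm Q x \<le> qnorm Q y \<longleftrightarrow> x \<bullet> (Q *v x) \<le> y \<bullet> (Q *v y)"
  by (simp add: qnorm_def)

lemma projQ_exists:
  assumes "compact D" "D \<noteq> {}"
  shows "\<exists>y. y \<in> D \<and> (\<forall>z\<in>D. qnorm Q (x - y) \<le> qnorm Q (x - z))"
proof -
  have "continuous_on D (\<lambda>y. qnorm Q (x - y))"
    unfolding qnorm_def by (intro continuous_intros linear_continuous_on_compose[OF _ matrix_vector_mul_linear])
  then show ?thesis using continuous_attains_inf[OF assms] by blast
qed

lemma projQ:
  assumes "compact D" "D \<noteq> {}"
  shows projQ_in: "projQ Q D x \<in> D"
    and projQ_min: "z \<in> D \<Longrightarrow> qnorm Q (x - projQ Q D x) \<le> qnorm Q (x - z)"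
  using someI_ex[OF projQ_exists[OF assms, of Q x]] unfolding projQ_def by blast+

lemma quadratic_form_diff:
  assumes "transpose (Q::real^'n^'n) = Q"
  shows "(u - v) \<bullet> (Q *v (u - v)) = u \<bullet> (Q *v u) - 2 * (u \<bullet> (Q *v v)) + v \<bullet> (Q *v v)"
  using symmetric_inner[OF assms, of v u]
  by (simp add: matrix_vector_mult_diff_distrib inner_diff_left inner_diff_right)

text \<open>A minimiser cannot be improved by a small move towards \<open>t\<close>: along the
  segment the possible improvement is linear in the step size, the loss only quadratic.\<close>

lemma projection_variational:
  assumes Q: "pos_def Q" and D: "convex D" and p: "p \<in> D"
    and min: "\<And>z. z \<in> D \<Longrightarrow> qnorm Q (x - p) \<le> qnorm Q (x - z)" and t: "t \<in> D"
  shows "(x - p) \<bullet> (Q *v (t - p)) \<le> 0"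
proof (rule ccontr)
  define B where "B = (x - p) \<bullet> (Q *v (t - p))"
  define C where "C = (t - p) \<bullet> (Q *v (t - p))"
  assume "\<not> ?thesis"
  then have B: "B > 0" by (simp add: B_def)
  have sym: "transpose Q = Q" using Q by (simp add: pos_def_def)
  have C: "C \<ge> 0" unfolding C_def by (rule pos_def_nonneg[OF Q])
  \<comment> \<open>The bound 1 keeps the moved point in \<open>D\<close>; the other entry makes
    \<open>s * C\<close> smaller than \<open>B\<close>. The summand 1 in the denominator covers
    \<open>C = 0\<close>.\<close>
  define s where "s = min 1 (B / (C + 1))"
  have s: "0 < s" "s \<le> 1" "s * (C + 1) \<le> B"
    using B C by (auto simp: s_def min_def)
  have "p + s *\<^sub>R (t - p) \<in> D"
    using convexD_alt[OF D p t, of s] s by (simp add: algebra_simps)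
  from min[OF this] have "(x - p) \<bullet> (Q *v (x - p)) \<le> ((x - p) - s *\<^sub>R (t - p)) \<bullet> (Q *v ((x - p) - s *\<^sub>R (t - p)))"
    unfolding qnorm_le_iff[OF Q] by (simp add: algebra_simps)
  also have "\<dots> = (x - p) \<bullet> (Q *v (x - p)) - 2 * s * B + s * s * C"
    unfolding quadratic_form_diff[OF sym] by (simp add: matrix_vector_mult_scaleR B_def C_def)
  finally have "2 * s * B \<le> s * s * C" by simp
  then have "2 * B \<le> s * C" using s by (simp add: mult.assoc)
  then show False using s B by (simp add: algebra_simps)
qed

text \<open>The two variational inequalities add up to a nonpositive form of \<open>p' - p\<close>.
  Uniqueness later identifies the graph of the projection with an intersection of closed
  sets.\<close>

lemma projection_unique:
  assumes Q: "pos_def Q" and D: "convex D" and "p \<in> D" "p' \<in> D"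
    and "\<And>z. z \<in> D \<Longrightarrow> qnorm Q (x - p) \<le> qnorm Q (x - z)"
    and "\<And>z. z \<in> D \<Longrightarrow> qnorm Q (x - p') \<le> qnorm Q (x - z)"
  shows "p = p'"
proof -
  have "(x - p) \<bullet> (Q *v (p' - p)) \<le> 0" "(x - p') \<bullet> (Q *v (p - p')) \<le> 0"
    using projection_variational[OF Q D] assms by blast+
  then have "(p' - p) \<bullet> (Q *v (p' - p)) \<le> 0"
    by (simp add: matrix_vector_mult_diff_distrib inner_diff_left inner_diff_right)
  then have "p' - p = 0" using pos_def_eq_0[OF Q] by blast
  then show ?thesis by simp
qed

text \<open>The angle at the projected point is obtuse, so expanding the right side around it adds
  only nonnegative terms to the left side.\<close>

lemma projQ_nonexpansive:
  assumes Q: "pos_def Q" and D: "convex D" "compact D" and t: "t \<in> D"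
  shows "(t - projQ Q D x) \<bullet> (Q *v (t - projQ Q D x)) \<le> (t - x) \<bullet> (Q *v (t - x))"
proof -
  define p where "p = projQ Q D x"
  have ne: "D \<noteq> {}" using t by auto
  have sym: "transpose Q = Q" using Q by (simp add: pos_def_def)
  have "(x - p) \<bullet> (Q *v (t - p)) \<le> 0"
    using projection_variational[OF Q D(1) projQ_in[OF D(2) ne] projQ_min[OF D(2) ne] t] by (simp add: p_def)
  then have "(t - p) \<bullet> (Q *v (x - p)) \<le> 0" using symmetric_inner[OF sym] by metis
  moreover have "(t - x) \<bullet> (Q *v (t - x)) = (t - p) \<bullet> (Q *v (t - p)) - 2 * ((t - p) \<bullet> (Q *v (x - p))) + (x - p) \<bullet> (Q *v (x - p))"
    using quadratic_form_diff[OF sym, of "t - p" "x - p"] by simp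
  ultimately show ?thesis using pos_def_nonneg[OF Q, of "x - p"] by (simp add: p_def)
qed

section \<open>Determinants under rank-one updates\<close>

text \<open>Conjugation by an orthogonal matrix that maps a coordinate vector to the direction of
  \<open>u\<close> turns the matrix into the identity with one row replaced, and Cramer's lemma
  reads off its determinant.\<close>

lemma det_id_plus_outer: "det (mat 1 + outer u v) = 1 + u \<bullet> (v :: real^'n)"
proof (cases "u = 0")
  case True
  then have "outer u v = 0" by (simp add: outer_def vec_eq_iff)
  then show ?thesis using True by simp
next
  case False
  fix k :: 'n
  have "norm (u /\<^sub>R norm u) = 1" using False by simp
  then obtain A where A: "orthogonal_matrix A" "A *v axis k 1 = u /\<^sub>R norm u"
    using orthogonal_matrix_exists_basis by metis
  define w where "w = transpose A *v v"
  have tA: "transpose A ** A = mat 1" "A ** transpose A = mat 1"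
    using A(1) by (auto simp: orthogonal_matrix_def)
  have u: "transpose A *v u = norm u *\<^sub>R axis k 1"
  proof -
    have "u = norm u *\<^sub>R (A *v axis k 1)" using A(2) False by simp
    then have "transpose A *v u = norm u *\<^sub>R (transpose A *v (A *v axis k 1))"
      by (metis matrix_vector_mult_scaleR)
    then show ?thesis by (simp add: matrix_vector_mul_assoc tA)
  qed
  have uv: "norm u * w $ k = u \<bullet> v"
  proof -
    have "norm u * w $ k = (norm u *\<^sub>R axis k 1) \<bullet> w" by (simp add: inner_axis' )
    also have "\<dots> = (transpose A *v u) \<bullet> (transpose A *v v)" by (simp only: u w_def)
    also have "\<dots> = u \<bullet> (A *v (transpose A *v v))"
      by (metis dot_lmul_matrix transpose_matrix_vector inner_commute)
    finally show ?thesis by (simp only: matrix_vector_mul_assoc tA matrix_vector_mul_lid)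
  qed
  \<comment> \<open>The replaced row. Its entry at \<open>k\<close> is
    \<open>1 + u \<bullet> v\<close> by \<open>uv\<close>, the value sought.\<close>
  define x where "x = axis k 1 + norm u *\<^sub>R w"
  have "transpose A ** (mat 1 + outer u v) ** A = (\<chi> i. if i = k then sum (\<lambda>i. x$i *s row i (mat 1)) UNIV else row i (mat 1))"
    (is "?L = ?R")
  proof -
    have 1: "?L *v y = y + (norm u * (w \<bullet> y)) *\<^sub>R axis k 1" for y
    proof -
      have "v \<bullet> (A *v y) = w \<bullet> y" unfolding w_def by (metis dot_lmul_matrix transpose_matrix_vector)
      then show ?thesis
        by (simp add: matrix_vector_mul_assoc[symmetric] matrix_vector_mult_add_rdistrib
            matrix_vector_right_distrib outer_mult_vec matrix_vector_mult_scaleR u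
            del: transpose_matrix_vector)
           (simp add: matrix_vector_mul_assoc tA mult.commute del: transpose_matrix_vector)
    qed
    have row1: "row i (mat 1 :: real^'n^'n) = axis i 1" for i
      by (auto simp: vec_eq_iff row_def mat_def axis_def)
    have rows: "sum (\<lambda>i. x$i *s row i (mat 1)) UNIV = x"
      by (simp add: row1 basis_expansion)
    have 2: "?R *v y = y + (norm u * (w \<bullet> y)) *\<^sub>R axis k 1" for y
    proof -
      have "(?R *v y) $ i = (if i = k then x \<bullet> y else y $ i)" for i
        unfolding rows by (simp add: matrix_vector_mul_component row1 inner_axis')
      moreover have "x \<bullet> y = y $ k + norm u * (w \<bullet> y)"
        by (simp add: x_def inner_add_left inner_axis')
      ultimately show ?thesis
        by (simp add: vec_eq_iff axis_def)
    qed
    show ?thesis using 1 2 by (simp add: matrix_eq)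
  qed
  then have "det (transpose A ** (mat 1 + outer u v) ** A) = x $ k"
    by (simp add: cramer_lemma_transpose)
  moreover have "det (transpose A ** (mat 1 + outer u v) ** A) = det (mat 1 + outer u v) * (det A * det A)"
    by (simp add: det_mul det_transpose)
  moreover have "det A * det A = 1" using tA(1) by (metis det_I det_mul det_transpose)
  ultimately show ?thesis using uv by (simp add: x_def axis_def)
qed

text \<open>Factoring \<open>R\<close> out on the left leaves the identity plus an outer product,
  because \<open>R *v (P *v f) = f\<close>.\<close>

lemma det_add_outer:
  fixes R P :: "real^'n^'n"
  assumes "R ** P = mat 1"
  shows "det (R + c *\<^sub>R outer f f) = det R * (1 + c * (f \<bullet> (P *v f)))"
proof -
  have "R + c *\<^sub>R outer f f = R ** (mat 1 + outer (c *\<^sub>R (P *v f)) f)"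
  proof -
    have "R *v (P *v f) = f" using assms by (simp add: matrix_vector_mul_assoc)
    then show ?thesis
      by (simp add: matrix_eq matrix_vector_mul_assoc[symmetric] matrix_vector_mult_add_rdistrib
          scaleR_matrix_vec outer_mult_vec matrix_vector_right_distrib matrix_vector_mult_scaleR mult.commute)
  qed
  then show ?thesis by (simp add: det_mul det_id_plus_outer inner_commute)
qed

text \<open>The Leibniz formula is crude, but only the logarithm of the determinant matters later,
  where the factorial becomes an additive constant.\<close>

lemma abs_det_le:
  fixes A :: "real^'n^'n"
  assumes "\<And>i j. \<bar>A $ i $ j\<bar> \<le> K"
  shows "\<bar>det A\<bar> \<le> fact CARD('n) * K ^ CARD('n)"
proof -
  have "\<bar>det A\<bar> \<le> (\<Sum>p\<in>{p. p permutes (UNIV::'n set)}. \<bar>of_int (sign p) * (\<Prod>i\<in>UNIV. A$i$p i)\<bar>)"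
    unfolding det_def by (rule sum_abs)
  also have "\<dots> \<le> (\<Sum>p\<in>{p. p permutes (UNIV::'n set)}. K ^ CARD('n))"
  proof (rule sum_mono)
    fix p :: "'n \<Rightarrow> 'n"
    have "(\<Prod>i\<in>UNIV. \<bar>A$i$p i\<bar>) \<le> (\<Prod>i\<in>(UNIV::'n set). K)"
      by (rule prod_mono) (simp add: assms)
    then show "\<bar>of_int (sign p) * (\<Prod>i\<in>UNIV. A$i$p i)\<bar> \<le> K ^ CARD('n)"
      by (simp add: abs_mult abs_prod sign_def)
  qed
  also have "\<dots> = fact CARD('n) * K ^ CARD('n)"
    by (simp add: card_permutations)
  finally show ?thesis .
qed

section \<open>The largest eigenvalue of a symmetric matrix\<close>

text \<open>\<open>Max\<close> is meaningful on finite sets only, so \<open>max_eig\<close> becomes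
  usable through this fact. Eigenvectors of a symmetric matrix for distinct eigenvalues are
  orthogonal, hence independent, and the dimension bounds their number.\<close>

lemma finite_eigenvalues:
  fixes A :: "real^'n^'n"
  assumes sym: "transpose A = A"
  shows "finite {lam. \<exists>v. v \<noteq> 0 \<and> A *v v = lam *\<^sub>R v}"
proof -
  define E where "E = {lam. \<exists>v. v \<noteq> 0 \<and> A *v v = lam *\<^sub>R v}"
  define v where "v lam = (SOME v. v \<noteq> 0 \<and> A *v v = lam *\<^sub>R v)" for lam
  have v: "v lam \<noteq> 0 \<and> A *v v lam = lam *\<^sub>R v lam" if "lam \<in> E" for lam
    unfolding v_def by (rule someI_ex) (use that in \<open>simp add: E_def\<close>)
  have orth: "v a \<bullet> v b = 0" if "a \<in> E" "b \<in> E" "a \<noteq> b" for a b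
  proof -
    have "v a \<bullet> (A *v v b) = v b \<bullet> (A *v v a)" by (rule symmetric_inner[OF sym])
    then have "(a - b) * (v a \<bullet> v b) = 0"
      using v[OF that(1)] v[OF that(2)] by (auto simp: inner_commute[of "v b" "v a"])
    then show ?thesis using that by simp
  qed
  have "inj_on v E"
    by (rule inj_onI) (metis orth v inner_eq_zero_iff)
  moreover have "independent (v ` E)"
    by (rule pairwise_orthogonal_independent)
       (use orth v in \<open>auto simp: pairwise_def orthogonal_def\<close>)
  then have "finite (v ` E)" using independent_bound by blast
  ultimately show ?thesis unfolding E_def[symmetric] by (metis finite_imageD)
qed

text \<open>A maximiser of the quadratic form on the unit sphere is an eigenvector: otherwise a small
  move along the component of its image orthogonal to it would increase the Rayleigh quotient.\<close>

lemma max_eig_ge_quadratic_form: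
  fixes A :: "real^'n^'n"
  assumes sym: "transpose A = A" and x: "norm x = 1"
  shows "x \<bullet> (A *v x) \<le> max_eig A"
proof -
  have "compact (sphere (0::real^'n) 1)" "sphere (0::real^'n) 1 \<noteq> {}"
    using x by (auto simp: dist_norm intro!: exI[of _ x])
  moreover have "continuous_on (sphere 0 1) (\<lambda>x. x \<bullet> (A *v x))"
    by (intro continuous_intros linear_continuous_on_compose[OF _ matrix_vector_mul_linear])
  ultimately obtain v where v: "norm v = 1" and vmax: "\<And>y. norm y = 1 \<Longrightarrow> y \<bullet> (A *v y) \<le> v \<bullet> (A *v v)"
    using continuous_attains_sup[of "sphere (0::real^'n) 1" "\<lambda>x. x \<bullet> (A *v x)"] by (auto simp: dist_norm)
  define lam where "lam = v \<bullet> (A *v v)"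
  have le: "y \<bullet> (A *v y) \<le> lam * (y \<bullet> y)" for y
  proof (cases "y = 0")
    case False
    have "(y /\<^sub>R norm y) \<bullet> (A *v (y /\<^sub>R norm y)) \<le> lam"
      unfolding lam_def by (rule vmax) (use False in simp)
    then have "(y \<bullet> (A *v y)) / (norm y)\<^sup>2 \<le> lam"
      by (simp add: matrix_vector_mult_scaleR power2_eq_square divide_inverse mult_ac)
    then show ?thesis using False by (simp add: field_simps power2_norm_eq_inner)
  qed simp
  \<comment> \<open>The component of \<open>A *v v\<close> orthogonal to \<open>v\<close>; it has to
    vanish.\<close>
  define r where "r = A *v v - lam *\<^sub>R v"
  define C where "C = lam * (r \<bullet> r) - r \<bullet> (A *v r)"
  have C: "C \<ge> 0" using le[of r] by (simp add: C_def)
  have vv: "v \<bullet> v = 1" using v by (simp add: norm_eq_1)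
  \<comment> \<open>Inserting \<open>v + t *\<^sub>R r\<close> into \<open>le\<close> leaves a term
    of first order in \<open>t\<close> on the left and one of second order on the right, which
    contradicts \<open>r \<bullet> r > 0\<close> for small \<open>t\<close>.\<close>
  have q: "2 * t * (r \<bullet> r) \<le> t * t * C" for t
  proof -
    have e1: "(v + t *\<^sub>R r) \<bullet> (A *v (v + t *\<^sub>R r)) = lam + 2 * t * (r \<bullet> (A *v v)) + t * t * (r \<bullet> (A *v r))"
      using symmetric_inner[OF sym, of v r]
      by (simp add: matrix_vector_right_distrib matrix_vector_mult_scaleR inner_add_left inner_add_right lam_def algebra_simps)
    have e2: "(v + t *\<^sub>R r) \<bullet> (v + t *\<^sub>R r) = 1 + 2 * t * (r \<bullet> v) + t * t * (r \<bullet> r)"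
      by (simp add: inner_add_left inner_add_right vv inner_commute algebra_simps)
    have e3: "r \<bullet> (A *v v) - lam * (r \<bullet> v) = r \<bullet> r"
      by (simp add: r_def inner_diff_right inner_diff_left)
    have "2 * t * (r \<bullet> (A *v v) - lam * (r \<bullet> v)) \<le> t * t * C"
      using le[of "v + t *\<^sub>R r", unfolded e1 e2] unfolding C_def by (simp add: algebra_simps)
    then show ?thesis by (simp only: e3)
  qed
  have "r \<bullet> r \<le> 0"
  proof (rule ccontr)
    assume "\<not> ?thesis"
    then have pos: "r \<bullet> r > 0" by linarith
    define t where "t = (r \<bullet> r) / (C + 1)"
    have t: "t > 0" using pos C by (simp add: t_def)
    from q[of t] t have "2 * (r \<bullet> r) \<le> t * C" by (simp add: mult.assoc)
    also have "\<dots> \<le> t * (C + 1)" using t by simp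
    also have "\<dots> = r \<bullet> r" using C by (simp add: t_def)
    finally show False using pos by simp
  qed
  then have "r = 0" by (metis inner_eq_zero_iff inner_ge_zero order_antisym)
  then have "lam \<in> {lam. \<exists>v. v \<noteq> 0 \<and> A *v v = lam *\<^sub>R v}"
    using v by (auto simp: r_def intro!: exI[of _ v])
  then have "lam \<le> max_eig A" unfolding max_eig_def by (rule Max_ge[OF finite_eigenvalues[OF sym]])
  then show ?thesis using vmax[OF x] by (simp add: lam_def)
qed

section \<open>Weighted sums of martingale differences\<close>

lemma powr_neg_diff_ge:
  fixes s t d :: real
  assumes "0 < s" "s \<le> t" "0 < d"
  shows "d * (t - s) / t powr (1 + d) \<le> s powr (- d) - t powr (- d)"
proof (cases "s = t")
  case False
  then have st: "s < t" using assms by simp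
  have "\<exists>z. s < z \<and> z < t \<and> t powr (- d) - s powr (- d) = (t - s) * (- d * z powr (- d - 1))"
    by (rule MVT2[OF st]) (use assms in \<open>auto intro!: derivative_eq_intros simp: powr_diff\<close>)
  then obtain z where z: "s < z" "z < t" "t powr (- d) - s powr (- d) = (t - s) * (- d * z powr (- d - 1))" by blast
  have "t powr (- d - 1) \<le> z powr (- d - 1)"
    by (rule powr_mono2') (use z assms in auto)
  then have "(t - s) * d * t powr (- d - 1) \<le> (t - s) * d * z powr (- d - 1)"
    by (intro mult_left_mono) (use st assms in auto)
  moreover have "t powr (- d - 1) = 1 / t powr (1 + d)"
  proof -
    have "- d - 1 = - (1 + d)" by simp
    then show ?thesis by (simp only: powr_minus_divide)
  qed
  ultimately show ?thesis using z(3) by (simp add: algebra_simps)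
qed simp

text \<open>Abel--Dini: comparison with the integral of \<open>t powr (- 1 - d)\<close> from 1 on.
  The bound does not depend on \<open>f\<close>, so it holds on every path of a random sequence and
  survives integration.\<close>

lemma sum_over_partial_sums_powr_le:
  fixes f :: "nat \<Rightarrow> real"
  assumes f: "\<And>k. 0 \<le> f k" and d: "0 < d"
  shows "(\<Sum>k<n. f k / (1 + (\<Sum>j\<le>k. f j)) powr (1 + d)) \<le> 1 / d"
proof -
  define T where "T n = 1 + (\<Sum>j<n. f j)" for n
  have T1: "1 \<le> T n" for n unfolding T_def using f by (simp add: sum_nonneg)
  have le: "f k / T (Suc k) powr (1 + d) \<le> (T k powr (- d) - T (Suc k) powr (- d)) / d" for k
  proof -
    have "d * (T (Suc k) - T k) / T (Suc k) powr (1 + d) \<le> T k powr (- d) - T (Suc k) powr (- d)"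
      by (rule powr_neg_diff_ge) (use T1[of k] f[of k] d in \<open>auto simp: T_def\<close>)
    then have "d * (f k / T (Suc k) powr (1 + d)) \<le> T k powr (- d) - T (Suc k) powr (- d)"
      by (simp add: T_def)
    then show ?thesis using d by (simp add: pos_le_divide_eq mult.commute)
  qed
  have "(\<Sum>k<n. f k / T (Suc k) powr (1 + d)) \<le> (\<Sum>k<n. (T k powr (- d) - T (Suc k) powr (- d)) / d)"
    by (rule sum_mono) (rule le)
  also have "\<dots> = (T 0 powr (- d) - T n powr (- d)) / d"
    by (simp add: sum_divide_distrib[symmetric] sum_lessThan_telescope'[of "\<lambda>k. T k powr (- d)"])
  also have "\<dots> \<le> 1 / d" using d by (simp add: T_def divide_right_mono)
  finally show ?thesis by (simp add: T_def lessThan_Suc_atMost)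
qed

text \<open>A weak form of an almost sure bound on the conditional expectation. Testing against
  weights in [0, 1] avoids the choice of versions and directly admits factors known at time
  \<open>k\<close>.\<close>

definition cond_exp_le :: "'a measure \<Rightarrow> 'a measure \<Rightarrow> ('a \<Rightarrow> real) \<Rightarrow> real \<Rightarrow> bool" where
  "cond_exp_le M F Z K \<longleftrightarrow> integrable M Z \<and>
    (\<forall>g\<in>borel_measurable F. (\<forall>\<omega>. 0 \<le> g \<omega> \<and> g \<omega> \<le> 1) \<longrightarrow> (\<integral>\<omega>. g \<omega> * Z \<omega> \<partial>M) \<le> K * (\<integral>\<omega>. g \<omega> \<partial>M))"

locale filtered_prob_space = prob_space M for M :: "'a measure" +
  fixes F :: "nat \<Rightarrow> 'a measure"
  assumes filt_sub: "\<And>k. subalgebra M (F k)"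
    and filt_mono: "\<And>i j. i \<le> j \<Longrightarrow> sets (F i) \<subseteq> sets (F j)"
begin

lemma space_F: "space (F k) = space M"
  using filt_sub[of k] by (simp add: subalgebra_def)

lemma measurable_filtration_mono:
  assumes "i \<le> j" "f \<in> measurable (F i) N" shows "f \<in> measurable (F j) N"
  using assms filt_mono[OF assms(1)] unfolding measurable_def by (auto simp: space_F)

lemma measurable_filtration: "f \<in> measurable (F i) N \<Longrightarrow> f \<in> measurable M N"
  using measurable_from_subalg[OF filt_sub] .

lemma integrable_bounded_mult:
  fixes g Z :: "'a \<Rightarrow> real"
  assumes "integrable M Z" "g \<in> borel_measurable M" "\<And>\<omega>. \<bar>g \<omega>\<bar> \<le> C"
  shows "integrable M (\<lambda>\<omega>. g \<omega> * Z \<omega>)"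
proof (rule Bochner_Integration.integrable_bound)
  show "integrable M (\<lambda>\<omega>. C * Z \<omega>)" using assms by simp
  show "(\<lambda>\<omega>. g \<omega> * Z \<omega>) \<in> borel_measurable M"
    using assms by (intro borel_measurable_times) auto
  have "\<bar>g \<omega>\<bar> \<le> \<bar>C\<bar>" for \<omega> using assms(3)[of \<omega>] by linarith
  then show "AE \<omega> in M. norm (g \<omega> * Z \<omega>) \<le> norm (C * Z \<omega>)"
    by (auto simp: abs_mult intro!: mult_right_mono)
qed

lemma integrable_bounded:
  fixes g :: "'a \<Rightarrow> real"
  assumes "g \<in> borel_measurable M" "\<And>\<omega>. \<bar>g \<omega>\<bar> \<le> C"
  shows "integrable M g"
  using integrable_bounded_mult[of "\<lambda>_. 1" g C] assms by simp

text \<open>A weighted maximal inequality: \<open>(max 0 (\<Sum>j<n. S j * x j) / S (n - 1))\<^sup>2\<close> is, up to the summable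
  terms \<open>(x n)\<^sup>2\<close>, a supermartingale, and stopping it when it exceeds \<open>r\<close> shows that this
  happens with probability \<open>O(1 / r)\<close>.\<close>

lemma weighted_supermartingale_bounded:
  fixes S x :: "nat \<Rightarrow> 'a \<Rightarrow> real"
  assumes Sm: "\<And>k. S k \<in> borel_measurable (F k)"
    and S1: "\<And>k \<omega>. 1 \<le> S k \<omega>" and Smono: "\<And>k \<omega>. S k \<omega> \<le> S (Suc k) \<omega>"
    and xm: "\<And>k. x k \<in> borel_measurable (F (Suc k))"
    and x2: "\<And>k. integrable M (\<lambda>\<omega>. (x k \<omega>)\<^sup>2)"
    and neg: "\<And>k g. g \<in> borel_measurable (F k) \<Longrightarrow> (\<And>\<omega>. 0 \<le> g \<omega> \<and> g \<omega> \<le> 1) \<Longrightarrow> (\<integral>\<omega>. g \<omega> * x k \<omega> \<partial>M) \<le> 0"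
    and A: "\<And>n. (\<Sum>k<n. \<integral>\<omega>. (x k \<omega>)\<^sup>2 \<partial>M) \<le> A"
  shows "AE \<omega> in M. \<exists>C. \<forall>n. (\<Sum>k\<le>n. S k \<omega> * x k \<omega>) \<le> C * S n \<omega>"
proof -
  have SM [measurable]: "S k \<in> borel_measurable M" for k by (rule measurable_filtration[OF Sm])
  have xM [measurable]: "x k \<in> borel_measurable M" for k by (rule measurable_filtration[OF xm])
  have xi: "integrable M (x k)" for k
    by (rule square_integrable_imp_integrable[OF xM x2])
  define Y where "Y n \<omega> = (\<Sum>k<n. S k \<omega> * x k \<omega>)" for n \<omega>
  \<comment> \<open>The weight lags by one index, so that \<open>Y (Suc n) / S n\<close> differs
    from \<open>Y n / S n\<close> by exactly \<open>x n\<close>. At \<open>n = 0\<close> the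
    truncated subtraction is harmless because \<open>Y 0 = 0\<close>.\<close>
  define V where "V n \<omega> = (max 0 (Y n \<omega>) / S (n - 1) \<omega>)\<^sup>2" for n \<omega>
  define p where "p n \<omega> = max 0 (Y n \<omega>) / S n \<omega>" for n \<omega>
  have Ym [measurable]: "Y n \<in> borel_measurable (F n)" for n
  proof -
    have "(\<lambda>\<omega>. S k \<omega> * x k \<omega>) \<in> borel_measurable (F n)" if "k < n" for k
      by (intro borel_measurable_times measurable_filtration_mono[OF _ Sm] measurable_filtration_mono[OF _ xm])
         (use that in auto)
    then show ?thesis unfolding Y_def by (intro borel_measurable_sum) auto
  qed
  have S'm [measurable]: "S (n - 1) \<in> borel_measurable (F n)" for n
    by (rule measurable_filtration_mono[OF _ Sm]) simp
  have Vm [measurable]: "V n \<in> borel_measurable (F n)" for n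
    unfolding V_def by measurable
  have pm [measurable]: "p n \<in> borel_measurable (F n)" for n
    using Sm[of n, measurable] unfolding p_def by measurable
  have p0: "0 \<le> p n \<omega>" for n \<omega> unfolding p_def using S1[of n \<omega>] by simp
  have pV: "(p n \<omega>)\<^sup>2 \<le> V n \<omega>" for n \<omega>
  proof (cases n)
    case 0 then show ?thesis by (simp add: p_def V_def)
  next
    case (Suc m)
    then have "p n \<omega> \<le> max 0 (Y n \<omega>) / S (n - 1) \<omega>"
      unfolding p_def using Smono[of m \<omega>] S1[of m \<omega>] by (intro divide_left_mono) auto
    then show ?thesis unfolding V_def by (rule power_mono[OF _ p0])
  qed
  \<comment> \<open>Replacing the lagged weight by \<open>S n\<close> only decreases the quotient
    (\<open>pV\<close>). What remains is an inequality for the squared positive part, in which the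
    factor of the increment is the positive part itself and hence a nonnegative weight known at time
    \<open>n\<close>.\<close>
  have Vstep: "V (Suc n) \<omega> \<le> V n \<omega> + (2 * p n \<omega> * x n \<omega> + (x n \<omega>)\<^sup>2)" for n \<omega>
  proof -
    have Sp: "S n \<omega> > 0" using S1[of n \<omega>] by simp
    have "max 0 (Y (Suc n) \<omega>) / S n \<omega> = max 0 (Y n \<omega> / S n \<omega> + x n \<omega>)"
      using Sp by (simp add: Y_def max_def field_simps)
    moreover have "p n \<omega> = max 0 (Y n \<omega> / S n \<omega>)"
      using Sp by (simp add: p_def max_def field_simps)
    moreover have "(max 0 (y + d))\<^sup>2 \<le> (max 0 y)\<^sup>2 + (2 * max 0 y * d + d\<^sup>2)" for y d :: real
    proof (cases "y \<ge> 0")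
      case True
      have "(max 0 (y + d))\<^sup>2 \<le> (y + d)\<^sup>2" unfolding abs_le_square_iff[symmetric] by auto
      then show ?thesis using True by (simp add: power2_sum)
    next
      case False
      then have "(max 0 (y + d))\<^sup>2 \<le> d\<^sup>2" unfolding abs_le_square_iff[symmetric] by auto
      then show ?thesis using False by simp
    qed
    ultimately have "V (Suc n) \<omega> \<le> (p n \<omega>)\<^sup>2 + (2 * p n \<omega> * x n \<omega> + (x n \<omega>)\<^sup>2)"
      by (simp add: V_def)
    then show ?thesis using pV[of n \<omega>] by linarith
  qed
  have bound: "measure M (\<Union>n. {\<omega>\<in>space M. \<not> (\<forall>j\<le>n. V j \<omega> \<le> r)}) \<le> A / r" if r: "r \<ge> 1" for r :: real
  proof -
    define B where "B n = {\<omega>\<in>space M. \<forall>j\<le>n. V j \<omega> \<le> r}" for n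
    have Bm: "B n \<in> sets (F n)" for n
    proof -
      have "{\<omega>\<in>space (F n). \<forall>j\<in>{..n}. V j \<omega> \<le> r} \<in> sets (F n)"
        by (rule sets.sets_Collect_finite_All)
           (simp_all add: borel_measurable_le[OF measurable_filtration_mono[OF _ Vm] borel_measurable_const])
      moreover have "B n = {\<omega>\<in>space (F n). \<forall>j\<in>{..n}. V j \<omega> \<le> r}"
        unfolding B_def space_F by blast
      ultimately show ?thesis by (simp only:)
    qed
    then have BM [measurable]: "B n \<in> sets M" for n using filt_sub[of n] by (auto simp: subalgebra_def)
    \<comment> \<open>A majorant of \<open>V\<close> stopped at its first value above
      \<open>r\<close>: an increment counts only on \<open>B k\<close>, where no such value has
      occurred up to \<open>k\<close>.\<close>
    define U where "U n \<omega> = (\<Sum>k<n. indicator (B k) \<omega> * (2 * p k \<omega> * x k \<omega>) + indicator (B k) \<omega> * (x k \<omega>)\<^sup>2)" for n \<omega>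
    \<comment> \<open>Divided by \<open>r\<close> this is a weight in [0, 1], as \<open>neg\<close>
      requires. The level has to be at least 1 because the argument passes from \<open>r\<close> to
      \<open>r\<^sup>2\<close>.\<close>
    have ppos: "indicator (B k) \<omega> * p k \<omega> \<le> r" "0 \<le> indicator (B k) \<omega> * p k \<omega>" for k \<omega>
    proof -
      have "p k \<omega> \<le> r" if "\<omega> \<in> B k"
      proof -
        have "(p k \<omega>)\<^sup>2 \<le> r" using that pV[of k \<omega>] by (auto simp: B_def intro: order_trans)
        also have "r \<le> r\<^sup>2" using r by (simp add: power2_eq_square)
        finally show ?thesis by (rule power2_le_imp_le) (use r in simp)
      qed
      then show "indicator (B k) \<omega> * p k \<omega> \<le> r" using r by (auto simp: indicator_def)
      show "0 \<le> indicator (B k) \<omega> * p k \<omega>" using p0 by simp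
    qed
    have gm: "(\<lambda>\<omega>. indicator (B k) \<omega> * p k \<omega> / r) \<in> borel_measurable (F k)" for k
      by (intro borel_measurable_times borel_measurable_divide borel_measurable_indicator Bm pm) auto
    have int1: "integrable M (\<lambda>\<omega>. indicator (B k) \<omega> * p k \<omega> / r * x k \<omega>)" for k
      by (rule integrable_bounded_mult[OF xi, where C=1])
         (use measurable_filtration[OF gm] ppos r in auto)
    have eq1: "indicator (B k) \<omega> * (2 * p k \<omega> * x k \<omega>) = 2 * r * (indicator (B k) \<omega> * p k \<omega> / r * x k \<omega>)" for k \<omega>
      using r by simp
    have int1': "integrable M (\<lambda>\<omega>. indicator (B k) \<omega> * (2 * p k \<omega> * x k \<omega>))" for k
      unfolding eq1 by (rule integrable_mult_right[OF int1])
    have int2: "integrable M (\<lambda>\<omega>. indicator (B k) \<omega> * (x k \<omega>)\<^sup>2)" for k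
      by (rule integrable_bounded_mult[OF x2, where C=1]) (auto simp: indicator_def)
    have Ui: "integrable M (U n)" for n
      unfolding U_def by (intro Bochner_Integration.integrable_sum Bochner_Integration.integrable_add int1' int2)
    have Uint: "(\<integral>\<omega>. U n \<omega> \<partial>M) \<le> (\<Sum>k<n. \<integral>\<omega>. (x k \<omega>)\<^sup>2 \<partial>M)" for n
    proof -
      have "(\<integral>\<omega>. U n \<omega> \<partial>M) = (\<Sum>k<n. (\<integral>\<omega>. indicator (B k) \<omega> * (2 * p k \<omega> * x k \<omega>) \<partial>M) + (\<integral>\<omega>. indicator (B k) \<omega> * (x k \<omega>)\<^sup>2 \<partial>M))"
        unfolding U_def by (subst Bochner_Integration.integral_sum)
          (auto intro!: Bochner_Integration.integrable_add int1' int2 sum.cong Bochner_Integration.integral_add)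
      also have "\<dots> \<le> (\<Sum>k<n. \<integral>\<omega>. (x k \<omega>)\<^sup>2 \<partial>M)"
      proof (rule sum_mono)
        fix k
        have "(\<integral>\<omega>. indicator (B k) \<omega> * p k \<omega> / r * x k \<omega> \<partial>M) \<le> 0"
          by (rule neg[OF gm]) (use ppos r in auto)
        then have "(\<integral>\<omega>. indicator (B k) \<omega> * (2 * p k \<omega> * x k \<omega>) \<partial>M) \<le> 0"
          unfolding eq1 integral_mult_right_zero using r by (intro mult_nonneg_nonpos) auto
        moreover have "(\<integral>\<omega>. indicator (B k) \<omega> * (x k \<omega>)\<^sup>2 \<partial>M) \<le> (\<integral>\<omega>. (x k \<omega>)\<^sup>2 \<partial>M)"
          by (rule integral_mono[OF int2 x2]) (auto simp: indicator_def)
        ultimately show "(\<integral>\<omega>. indicator (B k) \<omega> * (2 * p k \<omega> * x k \<omega>) \<partial>M) + (\<integral>\<omega>. indicator (B k) \<omega> * (x k \<omega>)\<^sup>2 \<partial>M) \<le> (\<integral>\<omega>. (x k \<omega>)\<^sup>2 \<partial>M)" by simp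
      qed
      finally show ?thesis .
    qed
    have UA: "(\<integral>\<omega>. U n \<omega> \<partial>M) \<le> A" for n by (rule order_trans[OF Uint A])
    \<comment> \<open>While the path stays in \<open>B\<close>, \<open>U\<close> dominates
      \<open>V\<close>; on leaving \<open>B\<close> it has exceeded \<open>r\<close>, and from then
      on it is frozen.\<close>
    have Ulow: "(if \<omega> \<in> B n then V n \<omega> else r) \<le> U n \<omega>" if "\<omega> \<in> space M" for n \<omega>
    proof (induction n)
      case 0
      have "V 0 \<omega> = 0" by (simp add: V_def Y_def)
      then show ?case using r that by (simp add: U_def B_def)
    next
      case (Suc n)
      show ?case
      proof (cases "\<omega> \<in> B n")
        case True
        then have "V (Suc n) \<omega> \<le> U (Suc n) \<omega>" using Suc Vstep[of n \<omega>] by (simp add: U_def)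
        moreover have "\<omega> \<in> B (Suc n) \<longleftrightarrow> V (Suc n) \<omega> \<le> r"
          using True by (auto simp: B_def le_Suc_eq)
        ultimately show ?thesis by auto
      next
        case False
        then have "\<omega> \<notin> B (Suc n)" unfolding B_def using le_SucI by blast
        then show ?thesis using Suc False by (simp add: U_def)
      qed
    qed
    have V0: "0 \<le> V n \<omega>" for n \<omega> by (simp add: V_def)
    have each: "measure M (space M - B n) \<le> A / r" for n
    proof -
      have "r * measure M (space M - B n) = (\<integral>\<omega>. r * indicator (space M - B n) \<omega> \<partial>M)"
        by simp
      also have "\<dots> \<le> (\<integral>\<omega>. U n \<omega> \<partial>M)"
      proof (rule integral_mono[OF _ Ui])
        show "integrable M (\<lambda>\<omega>. r * indicator (space M - B n) \<omega>)"
          by (intro integrable_mult_right integrable_real_indicator) (auto simp: emeasure_eq_measure)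
        fix \<omega> assume om: "\<omega> \<in> space M"
        from Ulow[OF om, of n] show "r * indicator (space M - B n) \<omega> \<le> U n \<omega>"
          using V0[of n \<omega>] om by (auto simp: indicator_def split: if_splits)
      qed
      finally have "r * measure M (space M - B n) \<le> A" using UA[of n] by simp
      then show ?thesis using r by (simp add: pos_le_divide_eq mult.commute)
    qed
    have "(\<lambda>n. measure M (space M - B n)) \<longlonglongrightarrow> measure M (\<Union>n. space M - B n)"
    proof (rule finite_Lim_measure_incseq)
      show "range (\<lambda>n. space M - B n) \<subseteq> sets M" using BM by blast
      show "incseq (\<lambda>n. space M - B n)"
        unfolding incseq_def B_def using order_trans by blast
    qed
    then have "measure M (\<Union>n. space M - B n) \<le> A / r"
      by (rule LIMSEQ_le_const2) (use each in auto)
    moreover have "(\<Union>n. space M - B n) = (\<Union>n. {\<omega>\<in>space M. \<not> (\<forall>j\<le>n. V j \<omega> \<le> r)})"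
      unfolding B_def by blast
    ultimately show ?thesis by (simp only:)
  qed
  \<comment> \<open>The paths on which \<open>V\<close> exceeds every integer level; the bound at
    level \<open>m + 1\<close> shows that they have measure at most \<open>A / (m + 1)\<close> for
    every \<open>m\<close>.\<close>
  define Nl where "Nl = (\<Inter>m::nat. \<Union>n. {\<omega>\<in>space M. \<not> (\<forall>j\<le>n. V j \<omega> \<le> real (Suc m))})"
  have VM [measurable]: "V n \<in> borel_measurable M" for n by (rule measurable_filtration[OF Vm])
  have NlM: "Nl \<in> sets M" unfolding Nl_def by measurable
  have "measure M Nl \<le> A / real (Suc m)" for m
  proof -
    have "measure M Nl \<le> measure M (\<Union>n. {\<omega>\<in>space M. \<not> (\<forall>j\<le>n. V j \<omega> \<le> real (Suc m))})"
      by (rule finite_measure_mono) (auto simp: Nl_def)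
    then show ?thesis using bound[of "real (Suc m)"] by linarith
  qed
  moreover have "(\<lambda>m. A / real (Suc m)) \<longlonglongrightarrow> 0"
    by (rule LIMSEQ_Suc[OF lim_const_over_n])
  ultimately have "measure M Nl \<le> 0" by (intro LIMSEQ_le_const) auto
  then have "Nl \<in> null_sets M"
    using NlM by (auto simp: null_sets_def emeasure_eq_measure measure_le_0_iff)
  then have "AE \<omega> in M. \<omega> \<notin> Nl" by (rule AE_not_in)
  with AE_space show ?thesis
  proof eventually_elim
    fix \<omega> assume om: "\<omega> \<in> space M" "\<omega> \<notin> Nl"
    then obtain m :: nat where m: "\<And>n. V n \<omega> \<le> real (Suc m)" by (auto simp: Nl_def)
    show "\<exists>C. \<forall>n. (\<Sum>k\<le>n. S k \<omega> * x k \<omega>) \<le> C * S n \<omega>"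
    proof (intro exI allI)
      fix n
      have "(max 0 (Y (Suc n) \<omega>) / S n \<omega>)\<^sup>2 \<le> real (Suc m)" using m[of "Suc n"] by (simp add: V_def)
      also have "\<dots> \<le> (real (Suc m))\<^sup>2" by (simp add: power2_eq_square)
      finally have "max 0 (Y (Suc n) \<omega>) / S n \<omega> \<le> real (Suc m)" by (rule power2_le_imp_le) simp
      then have "Y (Suc n) \<omega> \<le> real (Suc m) * S n \<omega>"
        using S1[of n \<omega>] by (simp add: pos_divide_le_eq)
      then show "(\<Sum>k\<le>n. S k \<omega> * x k \<omega>) \<le> real (Suc m) * S n \<omega>"
        by (simp add: Y_def lessThan_Suc_atMost)
    qed
  qed
qed

lemma cond_exp_leD:
  assumes "cond_exp_le M (F k) Z K" "g \<in> borel_measurable (F k)" "\<And>\<omega>. 0 \<le> g \<omega> \<and> g \<omega> \<le> 1"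
  shows "integrable M (\<lambda>\<omega>. g \<omega> * Z \<omega>)" "(\<integral>\<omega>. g \<omega> * Z \<omega> \<partial>M) \<le> K * (\<integral>\<omega>. g \<omega> \<partial>M)"
  using assms integrable_bounded_mult[of Z g 1] measurable_filtration
  unfolding cond_exp_le_def by auto

text \<open>Divided by \<open>T powr (3/4)\<close>, the coefficients have squares with a bounded
  sum, whatever \<open>f\<close> is. Together with the variance bound this makes the normalised
  increments summable in mean square, without any integrability of \<open>f\<close>.\<close>

lemma weighted_noise_sum_bound:
  fixes f w :: "nat \<Rightarrow> 'a \<Rightarrow> real"
  assumes fm: "\<And>k. f k \<in> borel_measurable (F k)"
    and wm: "\<And>k. w k \<in> borel_measurable (F (Suc k))"
    and mds: "\<And>k g. g \<in> borel_measurable (F k) \<Longrightarrow> (\<And>\<omega>. \<bar>g \<omega>\<bar> \<le> 1) \<Longrightarrow> (\<integral>\<omega>. g \<omega> * w k \<omega> \<partial>M) = 0"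
    and var: "\<And>k. cond_exp_le M (F k) (\<lambda>\<omega>. (w k \<omega>)\<^sup>2) K" and K: "0 \<le> K"
  shows "AE \<omega> in M. \<exists>C. \<forall>n. (\<Sum>k\<le>n. f k \<omega> * w k \<omega>) \<le> C * (1 + (\<Sum>k\<le>n. (f k \<omega>)\<^sup>2)) powr (3/4)"
proof -
  define T where "T n \<omega> = 1 + (\<Sum>k\<le>n. (f k \<omega>)\<^sup>2)" for n \<omega>
  define S where "S n \<omega> = T n \<omega> powr (3/4)" for n \<omega>
  define q where "q n \<omega> = f n \<omega> / S n \<omega>" for n \<omega>
  have T1: "1 \<le> T n \<omega>" for n \<omega> unfolding T_def by (simp add: sum_nonneg)
  have Tm: "T n \<in> borel_measurable (F n)" for n
    unfolding T_def by (intro borel_measurable_add borel_measurable_const borel_measurable_sum borel_measurable_power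
        measurable_filtration_mono[OF _ fm]) auto
  have Sm: "S n \<in> borel_measurable (F n)" for n
    unfolding S_def using Tm[of n] by measurable
  have S1: "1 \<le> S n \<omega>" for n \<omega> unfolding S_def using T1[of n \<omega>] by (simp add: ge_one_powr_ge_zero)
  have Smono: "S n \<omega> \<le> S (Suc n) \<omega>" for n \<omega>
    unfolding S_def by (rule powr_mono2) (use T1[of n \<omega>] in \<open>auto simp: T_def\<close>)
  have qm: "q n \<in> borel_measurable (F n)" for n
    unfolding q_def by (intro borel_measurable_divide fm Sm)
  have q2: "(q n \<omega>)\<^sup>2 = (f n \<omega>)\<^sup>2 / T n \<omega> powr (1 + 1/2)" for n \<omega>
    unfolding q_def S_def using T1[of n \<omega>] by (simp add: power_divide powr_power)
  have q2le: "(q n \<omega>)\<^sup>2 \<le> 1" for n \<omega>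
  proof -
    have "(f n \<omega>)\<^sup>2 \<le> (\<Sum>k\<le>n. (f k \<omega>)\<^sup>2)" by (rule member_le_sum) auto
    then have "(f n \<omega>)\<^sup>2 \<le> T n \<omega>" by (simp add: T_def)
    also have "\<dots> \<le> T n \<omega> powr (1 + 1/2)" using T1[of n \<omega>] powr_mono[of 1 "1+1/2" "T n \<omega>"] by simp
    finally show ?thesis unfolding q2 using T1[of n \<omega>] by simp
  qed
  then have qle: "\<bar>q n \<omega>\<bar> \<le> 1" for n \<omega> using abs_square_le_1 by blast
  have q2m: "(\<lambda>\<omega>. (q n \<omega>)\<^sup>2) \<in> borel_measurable (F n)" for n by (intro borel_measurable_power qm)
  note q2i = cond_exp_leD[OF var q2m, simplified q2le, simplified]
  have "AE \<omega> in M. \<exists>C. \<forall>n. (\<Sum>k\<le>n. S k \<omega> * (q k \<omega> * w k \<omega>)) \<le> C * S n \<omega>"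
  proof (rule weighted_supermartingale_bounded[OF Sm S1 Smono])
    show "(\<lambda>\<omega>. q k \<omega> * w k \<omega>) \<in> borel_measurable (F (Suc k))" for k
      by (intro borel_measurable_times wm measurable_filtration_mono[OF _ qm]) simp
    show "integrable M (\<lambda>\<omega>. (q k \<omega> * w k \<omega>)\<^sup>2)" for k
      using q2i(1)[of k] by (simp add: power_mult_distrib)
    show "(\<integral>\<omega>. g \<omega> * (q k \<omega> * w k \<omega>) \<partial>M) \<le> 0"
      if "g \<in> borel_measurable (F k)" "\<And>\<omega>. 0 \<le> g \<omega> \<and> g \<omega> \<le> 1" for k g
    proof -
      have "(\<integral>\<omega>. (g \<omega> * q k \<omega>) * w k \<omega> \<partial>M) = 0"
        by (rule mds) (use that qm qle in \<open>auto simp: abs_mult intro!: mult_le_one\<close>)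
      then show ?thesis by (simp add: mult.assoc)
    qed
    \<comment> \<open>\<open>1 / (1/2)\<close> is the Abel--Dini bound for \<open>d = 1/2\<close>,
      since squaring the normaliser gives the exponent \<open>2 * (3/4) = 1 + 1/2\<close>.\<close>
    show "(\<Sum>k<n. \<integral>\<omega>. (q k \<omega> * w k \<omega>)\<^sup>2 \<partial>M) \<le> K * (1 / (1/2))" for n
    proof -
      have iq: "integrable M (\<lambda>\<omega>. (q k \<omega>)\<^sup>2)" for k
        by (rule integrable_bounded[where C=1]) (use q2le measurable_filtration[OF q2m] in auto)
      have "(\<Sum>k<n. \<integral>\<omega>. (q k \<omega> * w k \<omega>)\<^sup>2 \<partial>M) \<le> (\<Sum>k<n. K * (\<integral>\<omega>. (q k \<omega>)\<^sup>2 \<partial>M))"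
        by (rule sum_mono) (use q2i(2) in \<open>simp add: power_mult_distrib\<close>)
      also have "\<dots> = K * (\<integral>\<omega>. (\<Sum>k<n. (q k \<omega>)\<^sup>2) \<partial>M)"
        by (simp add: sum_distrib_left[symmetric] Bochner_Integration.integral_sum[OF iq])
      also have "\<dots> \<le> K * (\<integral>\<omega>. 1 / (1/2) \<partial>M)"
      proof (intro mult_left_mono[OF _ K] integral_mono)
        show "(\<Sum>k<n. (q k \<omega>)\<^sup>2) \<le> 1 / (1/2)" for \<omega>
          unfolding q2 T_def by (rule sum_over_partial_sums_powr_le) auto
      qed (use iq in auto)
      finally show ?thesis by (simp add: prob_space)
    qed
  qed
  then show ?thesis
  proof eventually_elim
    fix \<omega> assume "\<exists>C. \<forall>n. (\<Sum>k\<le>n. S k \<omega> * (q k \<omega> * w k \<omega>)) \<le> C * S n \<omega>"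
    moreover have "S k \<omega> * (q k \<omega> * w k \<omega>) = f k \<omega> * w k \<omega>" for k using S1[of k \<omega>] by (simp add: q_def)
    ultimately have "\<exists>C. \<forall>n. (\<Sum>k\<le>n. f k \<omega> * w k \<omega>) \<le> C * S n \<omega>" by simp
    then show "\<exists>C. \<forall>n. (\<Sum>k\<le>n. f k \<omega> * w k \<omega>) \<le> C * (1 + (\<Sum>k\<le>n. (f k \<omega>)\<^sup>2)) powr (3/4)"
      by (simp add: S_def T_def)
  qed
qed

text \<open>The squared noise \<open>v = w\<^sup>2\<close> is truncated at the running sum \<open>S k\<close>; the truncated
  part satisfies an \<open>L\<^sup>2\<close> bound, and the excess is summable after division by \<open>S k\<close>.\<close>

lemma weighted_noise_square_sum_bound:
  fixes h w :: "nat \<Rightarrow> 'a \<Rightarrow> real"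
  assumes hm: "\<And>k. h k \<in> borel_measurable (F k)" and h01: "\<And>k \<omega>. 0 \<le> h k \<omega> \<and> h k \<omega> \<le> 1"
    and wm: "\<And>k. w k \<in> borel_measurable (F (Suc k))"
    and var: "\<And>k. cond_exp_le M (F k) (\<lambda>\<omega>. (w k \<omega>)\<^sup>2) K"
    and mom: "\<And>k. cond_exp_le M (F k) (\<lambda>\<omega>. ((w k \<omega>)\<^sup>2) powr (1 + d)) K"
    and K: "0 \<le> K" and d: "0 < d" "d \<le> 1"
  shows "AE \<omega> in M. \<exists>C. \<forall>n. (\<Sum>k\<le>n. h k \<omega> * (w k \<omega>)\<^sup>2) \<le> C * (1 + (\<Sum>k\<le>n. h k \<omega>))"
proof -
  define S where "S n \<omega> = 1 + (\<Sum>k\<le>n. h k \<omega>)" for n \<omega>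
  define q where "q n \<omega> = h n \<omega> / S n \<omega> powr (1 + d)" for n \<omega>
  define v where "v n \<omega> = (if (w n \<omega>)\<^sup>2 \<le> S n \<omega> then (w n \<omega>)\<^sup>2 else 0)" for n \<omega>
  \<comment> \<open>Centring by the constant \<open>K\<close> replaces the conditional mean of
    \<open>v\<close>: a nonpositive conditional drift is enough, and
    \<open>v \<le> w\<^sup>2\<close> provides it.\<close>
  define x where "x n \<omega> = h n \<omega> / S n \<omega> * (v n \<omega> - K)" for n \<omega>
  have S1: "1 \<le> S n \<omega>" for n \<omega> unfolding S_def using h01 by (simp add: sum_nonneg)
  have Sm: "S n \<in> borel_measurable (F n)" for n
    unfolding S_def by (intro borel_measurable_add borel_measurable_const borel_measurable_sum
        measurable_filtration_mono[OF _ hm]) auto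
  have Smono: "S n \<omega> \<le> S (Suc n) \<omega>" for n \<omega> using h01 by (simp add: S_def)
  have Smono': "S k \<omega> \<le> S n \<omega>" if "k \<le> n" for k n \<omega>
    using that by (rule lift_Suc_mono_le[of "\<lambda>n. S n \<omega>", OF Smono])
  have hS: "0 \<le> h n \<omega> / S n \<omega> \<and> h n \<omega> / S n \<omega> \<le> 1" for n \<omega>
  proof -
    have "h n \<omega> \<le> S n \<omega>" using h01[of n \<omega>] S1[of n \<omega>] by linarith
    then show ?thesis using h01[of n \<omega>] S1[of n \<omega>] by simp
  qed
  have hSm: "(\<lambda>\<omega>. h n \<omega> / S n \<omega>) \<in> borel_measurable (F n)" for n
    by (intro borel_measurable_divide hm Sm)
  have qm: "q n \<in> borel_measurable (F n)" for n
    unfolding q_def using hm[of n] Sm[of n] by measurable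
  have q01: "0 \<le> q n \<omega> \<and> q n \<omega> \<le> 1" for n \<omega>
  proof -
    have "1 \<le> S n \<omega> powr (1 + d)" using S1[of n \<omega>] d by (simp add: ge_one_powr_ge_zero)
    moreover have "h n \<omega> \<le> S n \<omega> powr (1 + d)" using calculation h01[of n \<omega>] by linarith
    ultimately show ?thesis unfolding q_def using h01[of n \<omega>] by (simp add: divide_le_eq_1)
  qed
  have qi: "integrable M (q k)" for k
    by (rule integrable_bounded[OF measurable_filtration[OF qm], where C=1]) (use q01[of k] in auto)
  have qsum: "(\<Sum>k<n. \<integral>\<omega>. q k \<omega> \<partial>M) \<le> 1 / d" for n
  proof -
    have "(\<Sum>k<n. \<integral>\<omega>. q k \<omega> \<partial>M) = (\<integral>\<omega>. (\<Sum>k<n. q k \<omega>) \<partial>M)"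
      by (simp add: Bochner_Integration.integral_sum[OF qi])
    also have "\<dots> \<le> (\<integral>\<omega>. 1 / d \<partial>M)"
    proof (rule integral_mono)
      show "(\<Sum>k<n. q k \<omega>) \<le> 1 / d" for \<omega>
        unfolding q_def S_def by (rule sum_over_partial_sums_powr_le) (use h01 d in auto)
    qed (use qi in auto)
    finally show ?thesis by (simp add: prob_space)
  qed
  have vm: "v n \<in> borel_measurable (F (Suc n))" for n
  proof -
    have [measurable]: "S n \<in> borel_measurable (F (Suc n))" by (rule measurable_filtration_mono[OF _ Sm]) simp
    show ?thesis unfolding v_def using wm[of n, measurable] by measurable
  qed
  have v0: "0 \<le> v n \<omega>" "v n \<omega> \<le> (w n \<omega>)\<^sup>2" for n \<omega> by (auto simp: v_def)
  have xm: "x n \<in> borel_measurable (F (Suc n))" for n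
    unfolding x_def by (intro borel_measurable_times borel_measurable_diff vm measurable_filtration_mono[OF _ hSm]) auto
  note iwp = cond_exp_leD[OF mom qm q01]
  have iw: "integrable M (\<lambda>\<omega>. (w k \<omega>)\<^sup>2)" for k using var[of k] by (simp add: cond_exp_le_def)
  have iv: "integrable M (v k)" for k
    by (rule Bochner_Integration.integrable_bound[OF iw[of k] measurable_filtration[OF vm]]) (use v0 in auto)
  \<comment> \<open>The truncation pays for a fourth power of the noise: \<open>v\<^sup>2\<close>
    splits into the power \<open>1 + d\<close> of \<open>w\<^sup>2\<close>, which has a bounded
    conditional mean, and the power \<open>1 - d\<close>, which is at most
    \<open>S powr (1 - d)\<close>. The latter cancels part of the denominator and leaves
    \<open>q\<close>.\<close>
  have x2: "(x k \<omega>)\<^sup>2 \<le> q k \<omega> * ((w k \<omega>)\<^sup>2) powr (1 + d) + q k \<omega> * K\<^sup>2" for k \<omega>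
  proof -
    have Sp: "S k \<omega> > 0" using S1[of k \<omega>] by simp
    have a: "(v k \<omega> - K)\<^sup>2 \<le> (v k \<omega>)\<^sup>2 + K\<^sup>2"
      using v0(1)[of k \<omega>] K by (simp add: power2_diff)
    have b: "(v k \<omega>)\<^sup>2 \<le> ((w k \<omega>)\<^sup>2) powr (1 + d) * S k \<omega> powr (1 - d)"
    proof (cases "(w k \<omega>)\<^sup>2 \<le> S k \<omega> \<and> w k \<omega> \<noteq> 0")
      case True
      let ?z = "(w k \<omega>)\<^sup>2"
      have "?z\<^sup>2 = ?z powr (1 + d) * ?z powr (1 - d)"
        using True by (simp add: powr_add[symmetric])
      also have "\<dots> \<le> ?z powr (1 + d) * S k \<omega> powr (1 - d)"
        by (intro mult_left_mono powr_mono2) (use True d in auto)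
      finally show ?thesis using True by (simp add: v_def)
    qed (auto simp: v_def)
    have c: "1 \<le> S k \<omega> powr (1 - d)" using S1[of k \<omega>] d by (simp add: ge_one_powr_ge_zero)
    have "(v k \<omega> - K)\<^sup>2 \<le> (((w k \<omega>)\<^sup>2) powr (1 + d) + K\<^sup>2) * S k \<omega> powr (1 - d)"
      using a b mult_left_mono[OF c, of "K\<^sup>2"] by (simp add: algebra_simps)
    moreover have "(h k \<omega> / S k \<omega>)\<^sup>2 \<le> h k \<omega> / (S k \<omega>)\<^sup>2"
    proof -
      have "(h k \<omega>)\<^sup>2 \<le> h k \<omega>" using h01[of k \<omega>] mult_left_le[of "h k \<omega>" "h k \<omega>"] by (simp add: power2_eq_square)
      then show ?thesis using Sp by (simp add: power_divide divide_right_mono)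
    qed
    ultimately have "(x k \<omega>)\<^sup>2 \<le> h k \<omega> / (S k \<omega>)\<^sup>2 * ((((w k \<omega>)\<^sup>2) powr (1 + d) + K\<^sup>2) * S k \<omega> powr (1 - d))"
      unfolding x_def power_mult_distrib by (intro mult_mono) (use h01 in auto)
    also have "(S k \<omega>)\<^sup>2 = S k \<omega> powr (1 + d) * S k \<omega> powr (1 - d)"
      using Sp by (simp add: powr_add[symmetric])
    also have "h k \<omega> / (S k \<omega> powr (1 + d) * S k \<omega> powr (1 - d)) * ((((w k \<omega>)\<^sup>2) powr (1 + d) + K\<^sup>2) * S k \<omega> powr (1 - d))
        = q k \<omega> * (((w k \<omega>)\<^sup>2) powr (1 + d) + K\<^sup>2)"
      using Sp by (simp add: q_def)
    finally show ?thesis by (simp add: algebra_simps)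
  qed
  have ib: "integrable M (\<lambda>\<omega>. q k \<omega> * ((w k \<omega>)\<^sup>2) powr (1 + d) + q k \<omega> * K\<^sup>2)" for k
    by (intro Bochner_Integration.integrable_add iwp(1) integrable_mult_left qi)
  have xM: "x k \<in> borel_measurable M" for k by (rule measurable_filtration[OF xm])
  have ix2: "integrable M (\<lambda>\<omega>. (x k \<omega>)\<^sup>2)" for k
    by (rule Bochner_Integration.integrable_bound[OF ib[of k]])
       (use x2[of k] xM in \<open>auto intro: order_trans[OF _ abs_ge_self]\<close>)
  have small: "AE \<omega> in M. \<exists>C. \<forall>n. (\<Sum>k\<le>n. S k \<omega> * x k \<omega>) \<le> C * S n \<omega>"
  proof (rule weighted_supermartingale_bounded[OF Sm S1 Smono xm ix2])
    show "(\<integral>\<omega>. g \<omega> * x k \<omega> \<partial>M) \<le> 0"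
      if g: "g \<in> borel_measurable (F k)" "\<And>\<omega>. 0 \<le> g \<omega> \<and> g \<omega> \<le> 1" for k g
    proof -
      define g' where "g' \<omega> = g \<omega> * (h k \<omega> / S k \<omega>)" for \<omega>
      have g'm: "g' \<in> borel_measurable (F k)" unfolding g'_def by (intro borel_measurable_times g hSm)
      have g'01: "0 \<le> g' \<omega> \<and> g' \<omega> \<le> 1" for \<omega>
        unfolding g'_def using g(2)[of \<omega>] hS[of k \<omega>] by (intro conjI mult_nonneg_nonneg mult_le_one) auto
      have abs: "\<bar>g' \<omega>\<bar> \<le> 1" for \<omega> using g'01[of \<omega>] by simp
      have ig: "integrable M g'" by (rule integrable_bounded[OF measurable_filtration[OF g'm] abs])
      have igv: "integrable M (\<lambda>\<omega>. g' \<omega> * v k \<omega>)"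
        by (rule integrable_bounded_mult[OF iv measurable_filtration[OF g'm] abs])
      have "(\<integral>\<omega>. g \<omega> * x k \<omega> \<partial>M) = (\<integral>\<omega>. g' \<omega> * v k \<omega> - K * g' \<omega> \<partial>M)"
        by (intro Bochner_Integration.integral_cong refl) (simp only: g'_def x_def right_diff_distrib left_diff_distrib mult_ac)
      also have "\<dots> = (\<integral>\<omega>. g' \<omega> * v k \<omega> \<partial>M) - K * (\<integral>\<omega>. g' \<omega> \<partial>M)"
        using ig igv by simp
      also have "(\<integral>\<omega>. g' \<omega> * v k \<omega> \<partial>M) \<le> (\<integral>\<omega>. g' \<omega> * (w k \<omega>)\<^sup>2 \<partial>M)"
        by (rule integral_mono[OF igv cond_exp_leD(1)[OF var g'm g'01]])
           (use g'01 v0 in \<open>auto intro!: mult_left_mono\<close>)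
      also have "\<dots> \<le> K * (\<integral>\<omega>. g' \<omega> \<partial>M)" by (rule cond_exp_leD(2)[OF var g'm g'01])
      finally show ?thesis by simp
    qed
    show "(\<Sum>k<n. \<integral>\<omega>. (x k \<omega>)\<^sup>2 \<partial>M) \<le> (K + K\<^sup>2) * (1 / d)" for n
    proof -
      have "(\<integral>\<omega>. (x k \<omega>)\<^sup>2 \<partial>M) \<le> (K + K\<^sup>2) * (\<integral>\<omega>. q k \<omega> \<partial>M)" for k
      proof -
        have "(\<integral>\<omega>. (x k \<omega>)\<^sup>2 \<partial>M) \<le> (\<integral>\<omega>. q k \<omega> * ((w k \<omega>)\<^sup>2) powr (1 + d) + q k \<omega> * K\<^sup>2 \<partial>M)"
          by (rule integral_mono[OF ix2 ib x2])
        also have "\<dots> = (\<integral>\<omega>. q k \<omega> * ((w k \<omega>)\<^sup>2) powr (1 + d) \<partial>M) + (\<integral>\<omega>. q k \<omega> \<partial>M) * K\<^sup>2"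
          using iwp(1)[of k] qi[of k] by simp
        finally show ?thesis using iwp(2)[of k] by (simp add: algebra_simps)
      qed
      then have "(\<Sum>k<n. \<integral>\<omega>. (x k \<omega>)\<^sup>2 \<partial>M) \<le> (K + K\<^sup>2) * (\<Sum>k<n. \<integral>\<omega>. q k \<omega> \<partial>M)"
        unfolding sum_distrib_left by (rule sum_mono)
      also have "\<dots> \<le> (K + K\<^sup>2) * (1 / d)"
        by (rule mult_left_mono[OF qsum]) (use K in simp)
      finally show ?thesis .
    qed
  qed
  \<comment> \<open>These terms have summable expectations and hence a finite sum almost surely.
    They dominate the excess over the truncation, since \<open>w\<^sup>2 > S\<close> implies
    \<open>w\<^sup>2 \<le> (w\<^sup>2) powr (1 + d) / S powr d\<close>.\<close>
  have big: "AE \<omega> in M. summable (\<lambda>k. q k \<omega> * ((w k \<omega>)\<^sup>2) powr (1 + d))"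
  proof -
    have wpM: "(\<lambda>\<omega>. q k \<omega> * ((w k \<omega>)\<^sup>2) powr (1 + d)) \<in> borel_measurable M" for k
      using iwp(1)[of k] by blast
    have nn: "(\<integral>\<^sup>+\<omega>. ennreal (q k \<omega> * ((w k \<omega>)\<^sup>2) powr (1 + d)) \<partial>M) = ennreal (\<integral>\<omega>. q k \<omega> * ((w k \<omega>)\<^sup>2) powr (1 + d) \<partial>M)" for k
      by (rule nn_integral_eq_integral[OF iwp(1)]) (use q01 in auto)
    have "(\<integral>\<^sup>+\<omega>. (\<Sum>k. ennreal (q k \<omega> * ((w k \<omega>)\<^sup>2) powr (1 + d))) \<partial>M)
        = (\<Sum>k. ennreal (\<integral>\<omega>. q k \<omega> * ((w k \<omega>)\<^sup>2) powr (1 + d) \<partial>M))"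
      by (subst nn_integral_suminf) (use wpM nn in auto)
    also have "\<dots> \<le> ennreal (K * (1 / d))"
    proof (rule suminf_le_const)
      show "(\<Sum>k<n. ennreal (\<integral>\<omega>. q k \<omega> * ((w k \<omega>)\<^sup>2) powr (1 + d) \<partial>M)) \<le> ennreal (K * (1 / d))" for n
      proof -
        have "(\<Sum>k<n. \<integral>\<omega>. q k \<omega> * ((w k \<omega>)\<^sup>2) powr (1 + d) \<partial>M) \<le> K * (\<Sum>k<n. \<integral>\<omega>. q k \<omega> \<partial>M)"
          unfolding sum_distrib_left by (rule sum_mono) (rule iwp(2))
        also have "\<dots> \<le> K * (1 / d)" by (rule mult_left_mono[OF qsum K])
        finally have "(\<Sum>k<n. \<integral>\<omega>. q k \<omega> * ((w k \<omega>)\<^sup>2) powr (1 + d) \<partial>M) \<le> K * (1 / d)" .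
        moreover have "0 \<le> (\<integral>\<omega>. q k \<omega> * ((w k \<omega>)\<^sup>2) powr (1 + d) \<partial>M)" for k
          by (rule Bochner_Integration.integral_nonneg) (use q01 in auto)
        ultimately show ?thesis by (subst sum_ennreal) (auto intro: ennreal_leI)
      qed
    qed simp
    finally have "(\<integral>\<^sup>+\<omega>. (\<Sum>k. ennreal (q k \<omega> * ((w k \<omega>)\<^sup>2) powr (1 + d))) \<partial>M) \<noteq> \<infinity>"
      by (auto simp: top_unique)
    then have "AE \<omega> in M. (\<Sum>k. ennreal (q k \<omega> * ((w k \<omega>)\<^sup>2) powr (1 + d))) \<noteq> \<infinity>"
      by (intro nn_integral_PInf_AE) (use wpM in auto)
    then show ?thesis
      by eventually_elim (rule summable_suminf_not_top, use q01 in auto)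
  qed
  from small big show ?thesis
  proof eventually_elim
    case (elim \<omega>)
    then obtain C where C: "\<And>n. (\<Sum>k\<le>n. S k \<omega> * x k \<omega>) \<le> C * S n \<omega>" by blast
    define z where "z k = q k \<omega> * ((w k \<omega>)\<^sup>2) powr (1 + d)" for k
    have z0: "0 \<le> z k" for k using q01 by (simp add: z_def)
    have zs: "summable z" using elim unfolding z_def by simp
    have le: "h k \<omega> * (w k \<omega>)\<^sup>2 \<le> S k \<omega> * x k \<omega> + K * h k \<omega> + S k \<omega> * z k" for k
    proof -
      have Sp: "S k \<omega> > 0" using S1[of k \<omega>] by simp
      have e: "S k \<omega> * x k \<omega> + K * h k \<omega> = h k \<omega> * v k \<omega>"
      proof -
        have "S k \<omega> * x k \<omega> = h k \<omega> * (v k \<omega> - K)" using Sp by (simp add: x_def)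
        then show ?thesis by (simp add: algebra_simps)
      qed
      show ?thesis
      proof (cases "(w k \<omega>)\<^sup>2 \<le> S k \<omega>")
        case True
        then show ?thesis unfolding e using Sp z0[of k] by (simp add: v_def)
      next
        case False
        let ?z = "(w k \<omega>)\<^sup>2"
        have "?z * S k \<omega> powr d \<le> ?z * ?z powr d"
          by (intro mult_left_mono powr_mono2) (use False Sp d in auto)
        also have "\<dots> = ?z powr (1 + d)" using False Sp by (simp add: powr_add)
        finally have "h k \<omega> * (?z * S k \<omega> powr d) \<le> h k \<omega> * ?z powr (1 + d)"
          by (rule mult_left_mono) (use h01 in auto)
        then have "h k \<omega> * ?z \<le> h k \<omega> * ?z powr (1 + d) / S k \<omega> powr d"
          using Sp by (simp add: pos_le_divide_eq mult_ac)
        also have "\<dots> = S k \<omega> * z k" using Sp by (simp add: z_def q_def powr_add)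
        finally show ?thesis unfolding e using False by (simp add: v_def)
      qed
    qed
    show ?case
    proof (intro exI allI)
      fix n
      have "(\<Sum>k\<le>n. h k \<omega> * (w k \<omega>)\<^sup>2) \<le> (\<Sum>k\<le>n. S k \<omega> * x k \<omega>) + K * (\<Sum>k\<le>n. h k \<omega>) + (\<Sum>k\<le>n. S k \<omega> * z k)"
        using sum_mono[of "{..n}", OF le] by (simp add: sum.distrib sum_distrib_left)
      also have "(\<Sum>k\<le>n. S k \<omega> * z k) \<le> (\<Sum>k\<le>n. S n \<omega> * z k)"
        by (intro sum_mono mult_right_mono Smono' z0) auto
      also have "\<dots> = S n \<omega> * (\<Sum>k\<le>n. z k)" by (simp add: sum_distrib_left)
      also have "\<dots> \<le> S n \<omega> * (\<Sum>k. z k)"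
        by (intro mult_left_mono sum_le_suminf[OF zs]) (use z0 S1[of n \<omega>] in auto)
      also have "K * (\<Sum>k\<le>n. h k \<omega>) \<le> K * S n \<omega>" by (rule mult_left_mono[OF _ K]) (simp add: S_def)
      finally show "(\<Sum>k\<le>n. h k \<omega> * (w k \<omega>)\<^sup>2) \<le> (C + K + (\<Sum>k. z k)) * (1 + (\<Sum>k\<le>n. h k \<omega>))"
        using C[of n] by (simp add: S_def[symmetric] algebra_simps)
    qed
  qed
qed

end

section \<open>The projected quasi-Newton recursion\<close>

text \<open>Nonexpansiveness removes the projection; the rest is an exact expansion. The gain
  matches the update of \<open>R\<close>: \<open>R' *v (P *v f)\<close> is a multiple of
  \<open>f\<close>, so the cross term and the quadratic term become scalars in \<open>x\<close>,
  \<open>r\<close> and \<open>s\<close>.\<close>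

lemma projected_step_quadratic_bound:
  fixes P R :: "real^'n^'n"
  assumes inv: "P ** R = mat 1" and R: "pos_def R" and mu: "mu > 0"
    and D: "convex D" "compact D" "theta \<in> D"
    and s: "s = f \<bullet> (P *v f)" and a: "a = 1 / (mu + b\<^sup>2 * s)"
    and R': "R' = R + (b\<^sup>2 / mu) *\<^sub>R outer f f"
    and th': "th' = projQ R' D (th + (a * b * r) *\<^sub>R (P *v f))"
    and x: "x = f \<bullet> (theta - th)"
  shows "(theta - th') \<bullet> (R' *v (theta - th')) \<le> (theta - th) \<bullet> (R *v (theta - th))
     + (b\<^sup>2 / mu) * x\<^sup>2 - 2 * (b / mu) * x * r + (a * b\<^sup>2 / mu) * s * r\<^sup>2"
proof -
  have pR': "pos_def R'" unfolding R' by (rule pos_def_add_outer[OF R]) (use mu in simp)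
  have sym: "transpose R' = R'" using pR' by (simp add: pos_def_def)
  have s0: "0 \<le> s" unfolding s by (rule pos_def_nonneg[OF pos_def_inverse_pair[OF R inv]])
  have den: "mu + b\<^sup>2 * s > 0" using mu s0 by (simp add: add_pos_nonneg)
  define v where "v = theta - th"
  define y where "y = P *v f"
  define c where "c = a * b * r"
  have RP: "R *v y = f"
    unfolding y_def using inv matrix_left_right_inverse[of P R] by (simp add: matrix_vector_mul_assoc)
  have R'v: "R' *v z = R *v z + (b\<^sup>2 / mu * (f \<bullet> z)) *\<^sub>R f" for z
    unfolding R' by (simp add: matrix_vector_mult_add_rdistrib scaleR_matrix_vec outer_mult_vec)
  have R'y: "R' *v y = (1 / (a * mu)) *\<^sub>R f"
  proof -
    have "R' *v y = (1 + b\<^sup>2 / mu * s) *\<^sub>R f" unfolding R'v RP by (simp add: s y_def scaleR_add_left)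
    also have "1 + b\<^sup>2 / mu * s = 1 / (a * mu)" using den mu unfolding a by (simp add: field_simps)
    finally show ?thesis .
  qed
  have "(theta - th') \<bullet> (R' *v (theta - th')) \<le> (v - c *\<^sub>R y) \<bullet> (R' *v (v - c *\<^sub>R y))"
    using projQ_nonexpansive[OF pR' D, of "th + (a * b * r) *\<^sub>R (P *v f)"]
    unfolding th' by (simp add: v_def c_def y_def diff_diff_eq)
  also have "\<dots> = v \<bullet> (R' *v v) - 2 * c * (v \<bullet> (R' *v y)) + c\<^sup>2 * (y \<bullet> (R' *v y))"
    unfolding quadratic_form_diff[OF sym] by (simp add: matrix_vector_mult_scaleR power2_eq_square)
  also have "v \<bullet> (R' *v v) = v \<bullet> (R *v v) + (b\<^sup>2 / mu) * x\<^sup>2"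
    unfolding R'v by (simp add: inner_add_right x v_def[symmetric] inner_commute power2_eq_square)
  also have "2 * c * (v \<bullet> (R' *v y)) = 2 * (b / mu) * x * r"
  proof -
    have "a \<noteq> 0" using den by (simp add: a)
    then show ?thesis unfolding R'y by (simp add: c_def x v_def inner_commute)
  qed
  also have "c\<^sup>2 * (y \<bullet> (R' *v y)) = (a * b\<^sup>2 / mu) * s * r\<^sup>2"
  proof -
    have "a \<noteq> 0" using den by (simp add: a)
    then show ?thesis unfolding R'y
      by (simp add: c_def s y_def inner_commute power2_eq_square)
  qed
  finally show ?thesis by (simp add: v_def)
qed

text \<open>The slope \<open>b\<close> and the residual \<open>r\<close> are free sequences, so that
  both steps of the algorithm are instances, the first with \<open>mu\<close> constantly 1. The
  parameters \<open>s\<close> and \<open>a\<close> are tied by equations so that each instance can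
  keep its own names for them.\<close>

locale quasi_newton =
  fixes D :: "(real^'n) set" and phi :: "nat \<Rightarrow> real^'n" and b mu r :: "nat \<Rightarrow> real"
    and th :: "nat \<Rightarrow> real^'n" and P :: "nat \<Rightarrow> real^'n^'n" and s a :: "nat \<Rightarrow> real"
  assumes D: "convex D" "compact D" and th0: "th 0 \<in> D" and P0: "pos_def (P 0)"
    and mu: "\<And>k. mu k > 0"
    and s: "\<And>k. s k = phi k \<bullet> (P k *v phi k)"
    and a: "\<And>k. a k = 1 / (mu k + (b k)\<^sup>2 * s k)"
    and P: "\<And>k. P (Suc k) = P k - (a k * (b k)\<^sup>2) *\<^sub>R (P k ** outer (phi k) (phi k) ** P k)"
    and th: "\<And>k. th (Suc k) = projQ (matrix_inv (P (Suc k))) D (th k + (a k * b k * r k) *\<^sub>R (P k *v phi k))"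
begin

text \<open>The inverse of \<open>P n\<close>, given as a sum rather than through
  \<open>matrix_inv\<close>; \<open>P_R\<close> confirms it.\<close>

definition R :: "nat \<Rightarrow> real^'n^'n" where
  "R n = matrix_inv (P 0) + (\<Sum>k<n. ((b k)\<^sup>2 / mu k) *\<^sub>R outer (phi k) (phi k))"

lemma R_Suc: "R (Suc n) = R n + ((b n)\<^sup>2 / mu n) *\<^sub>R outer (phi n) (phi n)"
  by (simp add: R_def)

lemma pos_def_R: "pos_def (R n)"
proof (induction n)
  case 0 then show ?case using P0 by (simp add: R_def pos_def_matrix_inv)
next
  case (Suc n)
  then show ?case unfolding R_Suc by (rule pos_def_add_outer) (use mu[of n] in simp)
qed

lemma P_R: "P n ** R n = mat 1"
proof (induction n)
  case 0 then show ?case using pos_def_invertible[OF P0] by (simp add: R_def)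
next
  case (Suc n)
  have "0 \<le> phi n \<bullet> (P n *v phi n)"
    by (rule pos_def_nonneg[OF pos_def_inverse_pair[OF pos_def_R Suc]])
  then show ?case
    unfolding R_Suc P by (intro covariance_update_inverse[OF Suc mu]) (auto simp: a s)
qed

lemma pos_def_P: "pos_def (P n)"
  by (rule pos_def_inverse_pair[OF pos_def_R P_R])

lemma matrix_inv_P: "matrix_inv (P n) = R n"
  by (rule matrix_inv_unique_left[OF P_R])

lemma th_in_D: "th n \<in> D"
proof (cases n)
  case (Suc m)
  have "D \<noteq> {}" using th0 by auto
  then show ?thesis unfolding Suc th by (rule projQ_in[OF D(2)])
qed (simp add: th0)

lemma s_nonneg: "0 \<le> s n"
  unfolding s by (rule pos_def_nonneg[OF pos_def_P])

lemma a_pos: "0 < a n"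
  unfolding a using mu[of n] s_nonneg[of n] by (simp add: add_pos_nonneg)

text \<open>Every update subtracts a nonnegative form; this keeps \<open>s\<close> bounded when the
  regressors are.\<close>

lemma P_le_P0: "x \<bullet> (P n *v x) \<le> x \<bullet> (P 0 *v x)"
proof (induction n)
  case (Suc n)
  have "transpose (P n) = P n" using pos_def_P[of n] by (simp add: pos_def_def)
  then have "x \<bullet> (P (Suc n) *v x) = x \<bullet> (P n *v x) - a n * (b n)\<^sup>2 * (phi n \<bullet> (P n *v x))\<^sup>2"
    unfolding P rank_one_update_vec
    by (simp add: inner_diff_right symmetric_inner[of "P n" x "phi n"] power2_eq_square)
  also have "\<dots> \<le> x \<bullet> (P n *v x)" using a_pos[of n] by simp
  finally show ?case using Suc by simp
qed simp

text \<open>It places the weight of the squared noise in [0, 1], and in the second step it completes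
  the square in the drift.\<close>

lemma gain_eq: "a n * (b n)\<^sup>2 * s n = 1 - a n * mu n"
proof -
  have "mu n + (b n)\<^sup>2 * s n > 0" using mu[of n] s_nonneg[of n] by (simp add: add_pos_nonneg)
  then show ?thesis unfolding a by (simp add: field_simps)
qed

lemma gain_bounds: "0 \<le> a n * (b n)\<^sup>2 * s n" "a n * (b n)\<^sup>2 * s n \<le> 1"
proof -
  show *: "0 \<le> a n * (b n)\<^sup>2 * s n" using a_pos[of n] s_nonneg[of n] by simp
  show "a n * (b n)\<^sup>2 * s n \<le> 1" using gain_eq[of n] mult_pos_pos[OF a_pos mu, of n n] by linarith
qed

lemma lyapunov_step:
  assumes "theta \<in> D"
  shows "(theta - th (Suc k)) \<bullet> (R (Suc k) *v (theta - th (Suc k))) \<le> (theta - th k) \<bullet> (R k *v (theta - th k))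
     + ((b k)\<^sup>2 / mu k) * (phi k \<bullet> (theta - th k))\<^sup>2 - 2 * (b k / mu k) * (phi k \<bullet> (theta - th k)) * r k
     + (a k * (b k)\<^sup>2 / mu k) * s k * (r k)\<^sup>2"
  by (rule projected_step_quadratic_bound[OF P_R pos_def_R mu D assms s a R_Suc _ refl])
     (simp add: th matrix_inv_P)

lemma det_R_nonzero: "det (R n) \<noteq> 0"
  using P_R[of n] by (metis det_I det_mul mult_zero_right zero_neq_one)

text \<open>With \<open>t = b\<^sup>2 / mu * s\<close> the determinant grows by the factor
  \<open>1 + t\<close> while the left side equals \<open>t / (1 + t)\<close>, which is at most
  \<open>ln (1 + t)\<close>.\<close>

lemma gain_le_ln_det: "a n * (b n)\<^sup>2 * s n \<le> ln \<bar>det (R (Suc n))\<bar> - ln \<bar>det (R n)\<bar>"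
proof -
  define t where "t = (b n)\<^sup>2 / mu n * s n"
  have t: "0 \<le> t" unfolding t_def using mu[of n] s_nonneg[of n] by simp
  have "R n ** P n = mat 1" using P_R matrix_left_right_inverse by blast
  then have "det (R (Suc n)) = det (R n) * (1 + t)"
    unfolding R_Suc by (simp add: det_add_outer s t_def)
  then have "ln \<bar>det (R (Suc n))\<bar> = ln \<bar>det (R n)\<bar> + ln (1 + t)"
    using t det_R_nonzero[of n] by (simp add: abs_mult ln_mult)
  moreover have "a n * (b n)\<^sup>2 * s n = t / (1 + t)"
  proof -
    have "mu n + (b n)\<^sup>2 * s n > 0" using mu[of n] s_nonneg[of n] by (simp add: add_pos_nonneg)
    then show ?thesis unfolding a t_def using mu[of n] by (simp add: field_simps)
  qed
  moreover have "t / (1 + t) \<le> ln (1 + t)"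
  proof -
    have "ln (1 / (1 + t)) \<le> 1 / (1 + t) - 1" by (rule ln_le_minus_one) (use t in simp)
    moreover have "1 / (1 + t) - 1 = - (t / (1 + t))" using t by (simp add: field_simps)
    ultimately show ?thesis using t by (simp add: ln_div)
  qed
  ultimately show ?thesis by linarith
qed

lemma sum_gain_le_ln_det: "(\<Sum>k\<le>n. a k * (b k)\<^sup>2 * s k) \<le> ln \<bar>det (R (Suc n))\<bar> - ln \<bar>det (R 0)\<bar>"
proof -
  have "(\<Sum>k<Suc n. a k * (b k)\<^sup>2 * s k) \<le> (\<Sum>k<Suc n. ln \<bar>det (R (Suc k))\<bar> - ln \<bar>det (R k)\<bar>)"
    by (rule sum_mono) (rule gain_le_ln_det)
  also have "\<dots> = ln \<bar>det (R (Suc n))\<bar> - ln \<bar>det (R 0)\<bar>"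
    by (rule sum_lessThan_telescope)
  finally show ?thesis by (simp only: lessThan_Suc_atMost)
qed

text \<open>An entry of \<open>R\<close> is controlled by diagonal entries of the regressor matrix
  (arithmetic-geometric mean), and these by its largest eigenvalue; the determinant is then at most
  polynomial in that eigenvalue. As \<open>lam\<close> may be small, the logarithm can be negative;
  the maximum with 1 also absorbs additive constants.\<close>

lemma sum_gain_le_ln_max_eig:
  assumes B: "\<And>k. (b k)\<^sup>2 / mu k \<le> B" and lam: "lam > 0"
  shows "\<exists>C\<ge>0. \<forall>n. (\<Sum>k\<le>n. a k * (b k)\<^sup>2 * s k)
    \<le> C * max 1 (ln (max_eig ((\<Sum>i\<le>n. outer (phi i) (phi i)) + lam *\<^sub>R mat 1)))"
proof -
  define A where "A n = (\<Sum>i\<le>n. outer (phi i) (phi i)) + lam *\<^sub>R mat 1" for n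
  define K where "K = (\<Sum>i\<in>UNIV. \<Sum>j\<in>UNIV. \<bar>R 0 $ i $ j\<bar>)"
  have K: "\<bar>R 0 $ i $ j\<bar> \<le> K" for i j
  proof -
    have "\<bar>R 0 $ i $ j\<bar> \<le> (\<Sum>j\<in>UNIV. \<bar>R 0 $ i $ j\<bar>)" by (rule member_le_sum) auto
    also have "\<dots> \<le> K" unfolding K_def
      by (rule member_le_sum[where f="\<lambda>i. \<Sum>j\<in>UNIV. \<bar>R 0 $ i $ j\<bar>"]) (auto intro: sum_nonneg)
    finally show ?thesis .
  qed
  have K0: "0 \<le> K" unfolding K_def by (intro sum_nonneg) auto
  have B0: "0 \<le> B" using B[of 0] mu[of 0] by (meson divide_nonneg_pos order_trans zero_le_power2)
  have Asym: "transpose (A n) = A n" for n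
    by (auto simp: A_def transpose_def vec_eq_iff outer_def mat_def sum_component mult.commute)
  have diag: "(\<Sum>k\<le>n. (phi k $ i)\<^sup>2) + lam \<le> max_eig (A n)" for n i
  proof -
    have "axis i 1 \<bullet> (A n *v axis i 1) \<le> max_eig (A n)"
      by (rule max_eig_ge_quadratic_form[OF Asym]) simp
    moreover have "axis i 1 \<bullet> (A n *v axis i 1) = A n $ i $ i"
      by (simp add: inner_axis' matrix_vector_mul_component inner_axis)
    moreover have "A n $ i $ i = (\<Sum>k\<le>n. (phi k $ i)\<^sup>2) + lam"
      by (simp add: A_def sum_component outer_def mat_def power2_eq_square)
    ultimately show ?thesis by simp
  qed
  \<comment> \<open>Any coordinate would do; \<open>undefined\<close> merely names one.\<close>
  have Lpos: "lam \<le> max_eig (A n)" for n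
    using diag[where n=n and i=undefined] sum_nonneg[of "{..n}" "\<lambda>k. (phi k $ undefined)\<^sup>2"] by simp
  \<comment> \<open>\<open>K / lam\<close> pays for the initial matrix, since \<open>max_eig\<close>
    is at least \<open>lam\<close>; \<open>B\<close> pays for the weights, and the summand 1 makes
    \<open>ln c\<close> nonnegative.\<close>
  define c where "c = K / lam + B + 1"
  have c1: "1 \<le> c" unfolding c_def using K0 B0 lam by simp
  have entry: "\<bar>R (Suc n) $ i $ j\<bar> \<le> c * max_eig (A n)" for n i j
  proof -
    have "R (Suc n) $ i $ j = R 0 $ i $ j + (\<Sum>k\<le>n. (b k)\<^sup>2 / mu k * (phi k $ i * phi k $ j))"
      by (simp add: R_def sum_component outer_def lessThan_Suc_atMost)
    then have "\<bar>R (Suc n) $ i $ j\<bar> \<le> \<bar>R 0 $ i $ j\<bar> + (\<Sum>k\<le>n. \<bar>(b k)\<^sup>2 / mu k * (phi k $ i * phi k $ j)\<bar>)"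
      using order_trans[OF abs_triangle_ineq add_left_mono[OF sum_abs]] by (simp only:)
    also have "(\<Sum>k\<le>n. \<bar>(b k)\<^sup>2 / mu k * (phi k $ i * phi k $ j)\<bar>) \<le> (\<Sum>k\<le>n. B * (((phi k $ i)\<^sup>2 + (phi k $ j)\<^sup>2) / 2))"
    proof (rule sum_mono)
      fix k
      have "\<bar>(b k)\<^sup>2 / mu k\<bar> \<le> B" using B[of k] mu[of k] by simp
      moreover have "\<bar>phi k $ i * phi k $ j\<bar> \<le> ((phi k $ i)\<^sup>2 + (phi k $ j)\<^sup>2) / 2"
        using sum_squares_bound[of "\<bar>phi k $ i\<bar>" "\<bar>phi k $ j\<bar>"] by (simp add: abs_mult)
      ultimately show "\<bar>(b k)\<^sup>2 / mu k * (phi k $ i * phi k $ j)\<bar> \<le> B * (((phi k $ i)\<^sup>2 + (phi k $ j)\<^sup>2) / 2)"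
        unfolding abs_mult[of "(b k)\<^sup>2 / mu k"] by (intro mult_mono) (use B0 in auto)
    qed
    also have "\<dots> = B * (((\<Sum>k\<le>n. (phi k $ i)\<^sup>2) + (\<Sum>k\<le>n. (phi k $ j)\<^sup>2)) / 2)"
      by (simp only: sum_distrib_left[symmetric] sum_divide_distrib[symmetric] sum.distrib)
    also have "\<dots> \<le> B * max_eig (A n)"
    proof (rule mult_left_mono[OF _ B0])
      have "(\<Sum>k\<le>n. (phi k $ i)\<^sup>2) + lam \<le> max_eig (A n)" "(\<Sum>k\<le>n. (phi k $ j)\<^sup>2) + lam \<le> max_eig (A n)"
        by (rule diag)+
      moreover have "(p + q) / 2 \<le> t" if "p + lam \<le> t" "q + lam \<le> t" for p q t :: real
        using that lam by simp
      ultimately show "((\<Sum>k\<le>n. (phi k $ i)\<^sup>2) + (\<Sum>k\<le>n. (phi k $ j)\<^sup>2)) / 2 \<le> max_eig (A n)"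
        by blast
    qed
    also have "\<bar>R 0 $ i $ j\<bar> \<le> K / lam * max_eig (A n)"
    proof -
      have "K / lam * lam \<le> K / lam * max_eig (A n)"
        by (rule mult_left_mono[OF Lpos]) (use K0 lam in simp)
      then show ?thesis using K[of i j] lam by simp
    qed
    finally have "\<bar>R (Suc n) $ i $ j\<bar> \<le> K / lam * max_eig (A n) + B * max_eig (A n)" by simp
    also have "\<dots> \<le> c * max_eig (A n)"
      using Lpos[of n] lam by (simp add: c_def distrib_right)
    finally show ?thesis .
  qed
  define m where "m = CARD('n)"
  define C where "C = \<bar>ln \<bar>det (R 0)\<bar>\<bar> + ln (fact m) + m * ln c + m"
  have C0: "0 \<le> C" unfolding C_def using c1 by (intro add_nonneg_nonneg mult_nonneg_nonneg) (auto simp: fact_ge_1)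
  have "(\<Sum>k\<le>n. a k * (b k)\<^sup>2 * s k) \<le> C * max 1 (ln (max_eig (A n)))" for n
  proof -
    have Lp: "0 < max_eig (A n)" using Lpos[of n] lam by linarith
    have "\<bar>det (R (Suc n))\<bar> \<le> fact m * (c * max_eig (A n)) ^ m"
      unfolding m_def by (rule abs_det_le[OF entry])
    then have "ln \<bar>det (R (Suc n))\<bar> \<le> ln (fact m * (c * max_eig (A n)) ^ m)"
      by (intro ln_mono) (use det_R_nonzero[of "Suc n"] in auto)
    also have "\<dots> = ln (fact m) + m * (ln c + ln (max_eig (A n)))"
      using c1 Lp by (simp add: ln_mult ln_realpow)
    finally have "(\<Sum>k\<le>n. a k * (b k)\<^sup>2 * s k) \<le> \<bar>ln \<bar>det (R 0)\<bar>\<bar> + ln (fact m) + m * ln c + m * ln (max_eig (A n))"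
      using sum_gain_le_ln_det[of n] by (simp add: algebra_simps)
    moreover define L where "L = max 1 (ln (max_eig (A n)))"
    have "m * ln (max_eig (A n)) \<le> m * L" by (rule mult_left_mono) (auto simp: L_def)
    moreover have "(\<bar>ln \<bar>det (R 0)\<bar>\<bar> + ln (fact m) + m * ln c) * 1 \<le> (\<bar>ln \<bar>det (R 0)\<bar>\<bar> + ln (fact m) + m * ln c) * L"
      by (rule mult_left_mono) (use c1 in \<open>auto simp: L_def fact_ge_1 intro!: add_nonneg_nonneg mult_nonneg_nonneg\<close>)
    ultimately show ?thesis unfolding C_def L_def[symmetric] by (simp add: algebra_simps)
  qed
  then show ?thesis using C0 unfolding A_def by blast
qed

end

text \<open>Telescoping sets \<open>c\<close> times the sum of \<open>z\<close> against a 3/4 power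
  of that same sum. The power is sublinear, so half of the left side absorbs it at the price of a
  constant.\<close>

lemma drift_sum_bound:
  fixes V z eps f w H L :: "nat \<Rightarrow> real"
  assumes V0: "\<And>k. 0 \<le> V k" and z: "\<And>k. 0 \<le> z k" and c: "c > 0"
    and step: "\<And>k. V (Suc k) \<le> V k - c * z k + eps k + f k * w k + H k"
    and f: "\<And>k. (f k)\<^sup>2 \<le> C1 * z k" and C1: "C1 > 0"
    and fw: "\<And>n. (\<Sum>k\<le>n. f k * w k) \<le> C2 * (1 + (\<Sum>k\<le>n. (f k)\<^sup>2)) powr (3/4)"
    and H: "\<And>n. (\<Sum>k\<le>n. H k) \<le> C3 * L n" and eps: "\<And>n. (\<Sum>k\<le>n. eps k) \<le> C4 * L n"
    and L: "\<And>n. 1 \<le> L n"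
  shows "\<exists>C\<ge>0. \<forall>n. (\<Sum>k\<le>n. z k) \<le> C * L n"
proof -
  define D2 where "D2 = \<bar>C2\<bar> + 1"
  \<comment> \<open>The solution of \<open>D2 * X powr (3/4) = c / (2 * C1) * X\<close>: up to it
    the power is bounded by a constant, beyond it the linear term prevails. The summand 1 in
    \<open>D2\<close> keeps the base positive.\<close>
  define X0 where "X0 = (2 * C1 * D2 / c) ^ 4"
  have D2: "D2 > 0" by (simp add: D2_def add_nonneg_pos)
  have X0: "X0 \<ge> 0" by (simp add: X0_def)
  have young: "D2 * X powr (3/4) \<le> c / (2 * C1) * X + D2 * X0 powr (3/4)" if X: "X > 0" for X
  proof (cases "X \<le> X0")
    case True
    then have "D2 * X powr (3/4) \<le> D2 * X0 powr (3/4)"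
      using X D2 by (intro mult_left_mono powr_mono2) auto
    then show ?thesis using X c C1 by (simp add: add_increasing)
  next
    case False
    have "2 * C1 * D2 / c \<le> X powr (1/4)"
    proof -
      have "X0 powr (1/4) \<le> X powr (1/4)" using False X0 by (intro powr_mono2) auto
      moreover have "X0 powr (1/4) = 2 * C1 * D2 / c"
      proof -
        have p: "2 * C1 * D2 / c > 0" using C1 D2 c by simp
        have "X0 = (2 * C1 * D2 / c) powr 4" unfolding X0_def using powr_realpow[OF p, of 4] by simp
        then have "X0 powr (1/4) = (2 * C1 * D2 / c) powr 1" by (simp only: powr_powr) simp
        then show ?thesis using p by (simp only: powr_one)
      qed
      ultimately show ?thesis by simp
    qed
    then have "D2 \<le> c / (2 * C1) * X powr (1/4)" using C1 c by (simp add: field_simps)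
    then have "D2 * X powr (3/4) \<le> c / (2 * C1) * X powr (1/4) * X powr (3/4)"
      by (rule mult_right_mono) simp
    also have "\<dots> = c / (2 * C1) * X" using X by (simp add: mult.assoc powr_add[symmetric])
    finally show ?thesis using D2 by (simp add: add_increasing2)
  qed
  define Cb where "Cb = V 0 + \<bar>C3\<bar> + \<bar>C4\<bar> + c / (2 * C1) + D2 * X0 powr (3/4)"
  have Cb: "0 \<le> Cb" unfolding Cb_def using V0[of 0] c C1 D2 by simp
  have "(\<Sum>k\<le>n. z k) \<le> (2 * Cb / c) * L n" for n
  proof -
    define Z where "Z = (\<Sum>k\<le>n. z k)"
    have Z0: "0 \<le> Z" unfolding Z_def by (rule sum_nonneg) (rule z)
    have tel: "V (Suc m) \<le> V 0 - c * (\<Sum>k\<le>m. z k) + (\<Sum>k\<le>m. eps k) + (\<Sum>k\<le>m. f k * w k) + (\<Sum>k\<le>m. H k)" for m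
    proof (induction m)
      case 0 then show ?case using step[of 0] by simp
    next
      case (Suc m) then show ?case using step[of "Suc m"] by (simp add: algebra_simps)
    qed
    have ff: "(\<Sum>k\<le>n. (f k)\<^sup>2) \<le> C1 * Z"
      unfolding Z_def sum_distrib_left by (rule sum_mono) (rule f)
    have "(\<Sum>k\<le>n. f k * w k) \<le> D2 * (1 + C1 * Z) powr (3/4)"
    proof -
      have "C2 * (1 + (\<Sum>k\<le>n. (f k)\<^sup>2)) powr (3/4) \<le> D2 * (1 + (\<Sum>k\<le>n. (f k)\<^sup>2)) powr (3/4)"
        by (rule mult_right_mono) (auto simp: D2_def)
      also have "\<dots> \<le> D2 * (1 + C1 * Z) powr (3/4)"
        using D2 ff by (intro mult_left_mono powr_mono2) (auto intro!: add_nonneg_nonneg sum_nonneg)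
      finally show ?thesis using fw[of n] by linarith
    qed
    also have "\<dots> \<le> c / (2 * C1) * (1 + C1 * Z) + D2 * X0 powr (3/4)"
      by (rule young) (use C1 Z0 in \<open>simp add: add_pos_nonneg\<close>)
    also have "\<dots> = c / (2 * C1) + c * Z / 2 + D2 * X0 powr (3/4)"
      using C1 by (simp add: field_simps)
    finally have "c * Z / 2 \<le> V 0 + (C4 * L n + C3 * L n) + c / (2 * C1) + D2 * X0 powr (3/4)"
      using tel[of n] V0[of "Suc n"] H[of n] eps[of n] unfolding Z_def[symmetric] by linarith
    also have "C4 * L n + C3 * L n \<le> \<bar>C4\<bar> * L n + \<bar>C3\<bar> * L n"
      using L[of n] by (intro add_mono mult_right_mono) auto
    also have "V 0 + (\<bar>C4\<bar> * L n + \<bar>C3\<bar> * L n) + c / (2 * C1) + D2 * X0 powr (3/4) \<le> Cb * L n"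
    proof -
      define Y where "Y = V 0 + c / (2 * C1) + D2 * X0 powr (3/4)"
      have "0 \<le> Y" unfolding Y_def using V0[of 0] c C1 D2 by simp
      then have "Y * 1 \<le> Y * L n" by (rule mult_left_mono[OF L])
      moreover have "Cb * L n = Y * L n + (\<bar>C4\<bar> * L n + \<bar>C3\<bar> * L n)"
        by (simp add: Cb_def Y_def algebra_simps)
      ultimately show ?thesis by (simp add: Y_def)
    qed
    finally have "c * Z / 2 \<le> Cb * L n" by simp
    then show ?thesis using c unfolding Z_def[symmetric] by (simp add: field_simps)
  qed
  then show ?thesis using Cb c by (intro exI[of _ "2 * Cb / c"]) simp
qed

section \<open>Secant slopes of a differentiable function\<close>

lemma slope_mean_value:
  fixes f f' :: "real \<Rightarrow> real"
  assumes der: "\<And>x. (f has_real_derivative f' x) (at x)"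
    and bnd: "\<And>x. \<bar>x\<bar> \<le> m \<Longrightarrow> lo \<le> f' x \<and> f' x \<le> hi"
    and xy: "\<bar>x\<bar> \<le> m" "\<bar>y\<bar> \<le> m"
  shows "\<exists>g. lo \<le> g \<and> g \<le> hi \<and> f x - f y = g * (x - y)"
proof -
  have *: "\<exists>g. lo \<le> g \<and> g \<le> hi \<and> f v - f u = g * (v - u)" if uv: "u < v" "\<bar>u\<bar> \<le> m" "\<bar>v\<bar> \<le> m" for u v
  proof -
    obtain z where z: "u < z" "z < v" "f v - f u = (v - u) * f' z"
      using MVT2[OF uv(1), of f f'] der by blast
    then have "\<bar>z\<bar> \<le> m" using uv by linarith
    then show ?thesis using z bnd[of z] by (intro exI[of _ "f' z"]) (auto simp: mult.commute)
  qed
  consider "x < y" | "x = y" | "y < x" by linarith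
  then show ?thesis
  proof cases
    case 1
    then obtain g where "lo \<le> g" "g \<le> hi" "f y - f x = g * (y - x)" using *[of x y] xy by blast
    then show ?thesis by (intro exI[of _ g]) (auto simp: algebra_simps)
  next
    case 2
    then show ?thesis using bnd[OF xy(1)] by (intro exI[of _ "f' x"]) auto
  next
    case 3
    then show ?thesis using *[of y x] xy by blast
  qed
qed

text \<open>Both slopes are averages of \<open>f'\<close> along the segments from \<open>y\<close>, so their difference is a value of
  \<open>f' (y + t * (x - y)) - f' (y + t * (z - y))\<close>.\<close>

lemma slope_difference_bound:
  fixes f f' :: "real \<Rightarrow> real"
  assumes der: "\<And>x. (f has_real_derivative f' x) (at x)"
    and lip: "\<And>x y. \<bar>x\<bar> \<le> m \<Longrightarrow> \<bar>y\<bar> \<le> m \<Longrightarrow> \<bar>f' x - f' y\<bar> \<le> rho * \<bar>x - y\<bar>"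
    and rho: "0 \<le> rho"
    and m: "\<bar>x\<bar> \<le> m" "\<bar>y\<bar> \<le> m" "\<bar>z\<bar> \<le> m"
    and b: "b = (if y \<noteq> x then (f x - f y) / (x - y) else f' y)"
  shows "\<bar>b * (z - y) - (f z - f y)\<bar> \<le> rho * \<bar>z - x\<bar> * \<bar>z - y\<bar>"
proof (cases "z = y")
  case False
  \<comment> \<open>Up to a constant, the integral of \<open>f'\<close> along the segment from
    \<open>y\<close> to \<open>x\<close>, parametrised over [0, 1]. For \<open>x = y\<close> it is
    linear with slope \<open>f' y\<close>, which is why the derivative is the matching value of
    \<open>b\<close> there.\<close>
  define k where "k t = (if y \<noteq> x then f (y + t * (x - y)) / (x - y) else t * f' y)" for t
  have kd: "(k has_real_derivative f' (y + t * (x - y))) (at t)" for t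
  proof (cases "y = x")
    case True
    have "((\<lambda>t. t * f' y) has_real_derivative f' y) (at t)" by (auto intro!: derivative_eq_intros)
    then show ?thesis using True unfolding k_def by simp
  next
    case False
    have "((\<lambda>t. f (y + t * (x - y))) has_real_derivative f' (y + t * (x - y)) * (x - y)) (at t)"
      by (rule DERIV_chain2[OF der]) (auto intro!: derivative_eq_intros)
    from DERIV_cdivide[OF this, of "x - y"] show ?thesis using False unfolding k_def by simp
  qed
  define j where "j t = f (y + t * (z - y)) / (z - y)" for t
  have jd: "(j has_real_derivative f' (y + t * (z - y))) (at t)" for t
  proof -
    have "((\<lambda>t. f (y + t * (z - y))) has_real_derivative f' (y + t * (z - y)) * (z - y)) (at t)"
      by (rule DERIV_chain2[OF der]) (auto intro!: derivative_eq_intros)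
    from DERIV_cdivide[OF this, of "z - y"] show ?thesis using False unfolding j_def by simp
  qed
  \<comment> \<open>Applying the mean value theorem once, to \<open>k - j\<close>, yields a common
    \<open>t\<close> on both segments. Two separate applications would give unrelated points and
    lose the factor \<open>\<bar>z - x\<bar>\<close>.\<close>
  have "\<exists>t::real. 0 < t \<and> t < 1 \<and> (k 1 - j 1) - (k 0 - j 0) = (1 - 0) * (f' (y + t * (x - y)) - f' (y + t * (z - y)))"
    by (rule MVT2) (auto intro!: DERIV_diff kd jd)
  then obtain t :: real where t: "0 < t" "t < 1"
    and eq: "(k 1 - j 1) - (k 0 - j 0) = f' (y + t * (x - y)) - f' (y + t * (z - y))" by auto
  have "k 1 - k 0 = b" unfolding b k_def by (auto simp: diff_divide_distrib)
  moreover have "j 1 - j 0 = (f z - f y) / (z - y)" unfolding j_def by (auto simp: diff_divide_distrib)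
  ultimately have eq': "b - (f z - f y) / (z - y) = f' (y + t * (x - y)) - f' (y + t * (z - y))"
    using eq by simp
  have seg: "\<bar>y + t * (v - y)\<bar> \<le> m" if "\<bar>v\<bar> \<le> m" for v
  proof -
    have "y + t * (v - y) = (1 - t) * y + t * v" by (simp add: algebra_simps)
    then have "\<bar>y + t * (v - y)\<bar> \<le> \<bar>(1 - t) * y\<bar> + \<bar>t * v\<bar>" by (simp only: abs_triangle_ineq)
    also have "\<dots> = (1 - t) * \<bar>y\<bar> + t * \<bar>v\<bar>" using t by (simp add: abs_mult)
    also have "\<dots> \<le> (1 - t) * m + t * m" using t that m by (intro add_mono mult_left_mono) auto
    finally show ?thesis by (simp add: algebra_simps)
  qed
  have "\<bar>b - (f z - f y) / (z - y)\<bar> \<le> rho * \<bar>(y + t * (x - y)) - (y + t * (z - y))\<bar>"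
    unfolding eq' by (rule lip) (intro seg m)+
  also have "(y + t * (x - y)) - (y + t * (z - y)) = t * (x - z)" by (simp add: algebra_simps)
  also have "rho * \<bar>t * (x - z)\<bar> \<le> rho * \<bar>z - x\<bar>"
    using t rho by (intro mult_left_mono) (auto simp: abs_mult abs_minus_commute mult_left_le_one_le)
  finally have "\<bar>b - (f z - f y) / (z - y)\<bar> * \<bar>z - y\<bar> \<le> rho * \<bar>z - x\<bar> * \<bar>z - y\<bar>"
    by (rule mult_right_mono) simp
  moreover have "\<bar>b - (f z - f y) / (z - y)\<bar> * \<bar>z - y\<bar> = \<bar>b * (z - y) - (f z - f y)\<bar>"
  proof -
    have "(b - (f z - f y) / (z - y)) * (z - y) = b * (z - y) - (f z - f y)"
      using False by (simp add: left_diff_distrib[of b])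
    then show ?thesis by (simp only: abs_mult[symmetric])
  qed
  ultimately show ?thesis by simp
qed simp

section \<open>From the one-step inequality to sums of squared prediction errors\<close>

context quasi_newton
begin

lemma s_bounded:
  assumes "\<And>k. norm (phi k) \<le> B"
  shows "\<exists>S\<ge>0. \<forall>k. s k \<le> S"
proof -
  have bl: "bounded_linear (\<lambda>x. P 0 *v x)" by (rule matrix_vector_mul_bounded_linear)
  define K where "K = onorm (\<lambda>x. P 0 *v x)"
  have K: "0 \<le> K" unfolding K_def by (rule onorm_pos_le[OF bl])
  have B: "0 \<le> B" using assms[of 0] norm_ge_zero order_trans by blast
  have "s k \<le> B * (K * B)" for k
  proof -
    have "s k \<le> phi k \<bullet> (P 0 *v phi k)" unfolding s by (rule P_le_P0)
    also have "\<dots> \<le> norm (phi k) * norm (P 0 *v phi k)" by (rule norm_cauchy_schwarz)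
    also have "\<dots> \<le> norm (phi k) * (K * norm (phi k))"
      unfolding K_def by (intro mult_left_mono onorm[OF bl]) simp
    also have "\<dots> \<le> B * (K * B)" using assms[of k] K B by (intro mult_mono) auto
    finally show ?thesis .
  qed
  then show ?thesis using K B by (intro exI[of _ "B * (K * B)"]) simp
qed

text \<open>The part shared by both steps. Splitting the residual into the known part
  \<open>psi\<close> and the noise \<open>w\<close> separates the Lyapunov inequality into a drift,
  a martingale term with coefficient \<open>f\<close>, and squared noise. \<open>z\<close> is the
  squared parameter prediction error in the first step and \<open>psi\<^sup>2\<close> in the second;
  \<open>eps\<close> makes room for a linearisation error.\<close>

lemma regret_bound:
  fixes L f psi w z eps :: "nat \<Rightarrow> real" and lam :: real and theta :: "real^'n"
  defines "L \<equiv> \<lambda>n. max 1 (ln (max_eig ((\<Sum>i\<le>n. outer (phi i) (phi i)) + lam *\<^sub>R mat 1)))"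
    and "f \<equiv> \<lambda>k. (2 / mu k) * (a k * (b k)\<^sup>2 * s k * psi k - b k * (phi k \<bullet> (theta - th k)))"
  assumes theta: "theta \<in> D" and lam: "0 < lam"
    and r: "\<And>k. r k = psi k + w k"
    and mu_low: "0 < mlow" "\<And>k. mlow \<le> mu k"
    and b: "\<And>k. (b k)\<^sup>2 \<le> B"
    and c: "0 < c" and z: "\<And>k. 0 \<le> z k"
    and drift: "\<And>k. ((b k)\<^sup>2 * (phi k \<bullet> (theta - th k))\<^sup>2 - 2 * b k * (phi k \<bullet> (theta - th k)) * psi k
        + a k * (b k)\<^sup>2 * s k * (psi k)\<^sup>2) / mu k \<le> - c * z k + eps k"
    and f: "0 < Cf" "\<And>k. (f k)\<^sup>2 \<le> Cf * z k"
    and eps: "\<And>n. (\<Sum>k\<le>n. eps k) \<le> Ce * L n"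
    and cross: "\<And>n. (\<Sum>k\<le>n. f k * w k) \<le> C2 * (1 + (\<Sum>k\<le>n. (f k)\<^sup>2)) powr (3/4)"
    and quad: "\<And>n. (\<Sum>k\<le>n. a k * (b k)\<^sup>2 * s k * (w k)\<^sup>2) \<le> C3 * (1 + (\<Sum>k\<le>n. a k * (b k)\<^sup>2 * s k))"
  shows "\<exists>C\<ge>0. \<forall>n. (\<Sum>k\<le>n. z k) \<le> C * L n"
proof -
  have "(b k)\<^sup>2 / mu k \<le> B / mlow" for k
    using mu_low(1) mu_low(2)[of k] b[of k] order_trans[OF zero_le_power2 b] by (intro frac_le) auto
  from sum_gain_le_ln_max_eig[OF this lam] obtain Cg where Cg: "0 \<le> Cg" "\<And>n. (\<Sum>k\<le>n. a k * (b k)\<^sup>2 * s k) \<le> Cg * L n"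
    unfolding L_def by blast
  have L1: "1 \<le> L n" for n by (simp add: L_def)
  define V where "V k = (theta - th k) \<bullet> (R k *v (theta - th k))" for k
  \<comment> \<open>\<open>mlow\<close> replaces \<open>mu k\<close>, so that \<open>H\<close> is a
    constant multiple of the terms in \<open>quad\<close>.\<close>
  define H where "H k = a k * (b k)\<^sup>2 * s k * (w k)\<^sup>2 / mlow" for k
  show ?thesis
  proof (rule drift_sum_bound[where V=V and f=f and w=w and H=H and eps=eps and c=c, OF _ z c _ f(2) f(1) cross _ eps L1])
    show "0 \<le> V k" for k unfolding V_def by (rule pos_def_nonneg[OF pos_def_R])
    show "V (Suc k) \<le> V k - c * z k + eps k + f k * w k + H k" for k
    proof -
      define x where "x = phi k \<bullet> (theta - th k)"
      define h where "h = a k * (b k)\<^sup>2 * s k"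
      have h: "0 \<le> h" unfolding h_def by (rule gain_bounds)
      have "V (Suc k) \<le> V k + ((b k)\<^sup>2 / mu k) * x\<^sup>2 - 2 * (b k / mu k) * x * r k + (a k * (b k)\<^sup>2 / mu k) * s k * (r k)\<^sup>2"
        unfolding V_def x_def by (rule lyapunov_step[OF theta])
      also have "\<dots> = V k + ((b k)\<^sup>2 * x\<^sup>2 - 2 * b k * x * psi k + h * (psi k)\<^sup>2) / mu k
          + (2 / mu k) * (h * psi k - b k * x) * w k + h * (w k)\<^sup>2 / mu k"
        unfolding r h_def using mu[of k] by (simp add: field_simps power2_eq_square)
      also have "((b k)\<^sup>2 * x\<^sup>2 - 2 * b k * x * psi k + h * (psi k)\<^sup>2) / mu k \<le> - c * z k + eps k"
        using drift[of k] unfolding x_def h_def .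
      also have "h * (w k)\<^sup>2 / mu k \<le> H k"
        unfolding H_def h_def[symmetric] using mu_low(1) mu_low(2)[of k] h by (intro divide_left_mono) (auto simp: mu)
      finally show ?thesis unfolding f_def x_def h_def by simp
    qed
    show "(\<Sum>k\<le>n. H k) \<le> (\<bar>C3\<bar> * (1 + Cg) / mlow) * L n" for n
    proof -
      have "(\<Sum>k\<le>n. a k * (b k)\<^sup>2 * s k * (w k)\<^sup>2) \<le> \<bar>C3\<bar> * (1 + (\<Sum>k\<le>n. a k * (b k)\<^sup>2 * s k))"
        by (rule order_trans[OF quad]) (auto intro!: mult_right_mono add_nonneg_nonneg sum_nonneg gain_bounds)
      also have "\<dots> \<le> \<bar>C3\<bar> * (L n + Cg * L n)"
        by (intro mult_left_mono add_mono L1 Cg) auto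
      finally have "(\<Sum>k\<le>n. a k * (b k)\<^sup>2 * s k * (w k)\<^sup>2) / mlow \<le> \<bar>C3\<bar> * (L n + Cg * L n) / mlow"
        by (rule divide_right_mono) (use mu_low(1) in simp)
      then show ?thesis unfolding H_def sum_divide_distrib[symmetric] by (simp add: algebra_simps)
    qed
  qed
qed

end

text \<open>The two entries of the minimum in \<open>b\<close> tame the two positive terms of the
  drift. With \<open>t = b * g * x\<^sup>2\<close>, the entry \<open>gl\<close> makes the first at
  most \<open>t\<close>, the other entry makes the last at most \<open>t / 2\<close>, and the cross
  term is \<open>- 2 * t\<close>; this leaves at most \<open>- t / 2\<close>.\<close>

lemma first_step_prediction_error_sum:
  fixes psi w g gl gu :: "nat \<Rightarrow> real"
  assumes qn: "quasi_newton D phi b (\<lambda>_. 1) r th P s a"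
    and theta: "theta \<in> D" and lam: "0 < lam"
    and phi: "\<And>k. norm (phi k) \<le> B"
    and r: "\<And>k. r k = psi k + w k"
    and psi: "\<And>k. psi k = g k * (phi k \<bullet> (theta - th k))"
    and g: "0 < g0" "\<And>k. g0 \<le> gl k" "\<And>k. gl k \<le> g k" "\<And>k. g k \<le> gu k" "\<And>k. gu k \<le> g1"
    and b: "\<And>k. b k = min (gl k) (1 / (2 * gu k * s k + 1))"
    and cross: "\<And>n. (\<Sum>k\<le>n. f k * w k) \<le> C2 * (1 + (\<Sum>k\<le>n. (f k)\<^sup>2)) powr (3/4)"
    and f: "\<And>k. f k = (2 / 1) * (a k * (b k)\<^sup>2 * s k * psi k - b k * (phi k \<bullet> (theta - th k)))"
    and quad: "\<And>n. (\<Sum>k\<le>n. a k * (b k)\<^sup>2 * s k * (w k)\<^sup>2) \<le> C3 * (1 + (\<Sum>k\<le>n. a k * (b k)\<^sup>2 * s k))"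
  shows "\<exists>C\<ge>0. \<forall>n. (\<Sum>k\<le>n. (phi k \<bullet> (theta - th k))\<^sup>2)
    \<le> C * max 1 (ln (max_eig ((\<Sum>i\<le>n. outer (phi i) (phi i)) + lam *\<^sub>R mat 1)))"
proof -
  interpret quasi_newton D phi b "\<lambda>_. 1" r th P s a by (rule qn)
  obtain S where S: "0 \<le> S" "\<And>k. s k \<le> S" using s_bounded[OF phi] by blast
  \<comment> \<open>A positive lower bound for \<open>b\<close> on the whole path, from the uniform
    bounds on the derivative and on \<open>s\<close>.\<close>
  define b0 where "b0 = min g0 (1 / (2 * g1 * S + 1))"
  have g1: "0 < g1" using g(1) g(2,3,4,5)[of 0] by linarith
  have b0: "0 < b0" unfolding b0_def using g(1) g1 S(1) by (simp add: add_nonneg_pos)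
  have gpos: "0 < g k" "0 < gl k" "0 < gu k" for k using g(1) g(2,3,4)[of k] by linarith+
  have b_low: "b0 \<le> b k" for k
  proof -
    have "1 / (2 * g1 * S + 1) \<le> 1 / (2 * gu k * s k + 1)"
    proof (rule divide_left_mono)
      have "gu k * s k \<le> g1 * S" by (intro mult_mono g(5) S s_nonneg) (use g1 in simp)
      then show "2 * gu k * s k + 1 \<le> 2 * g1 * S + 1" by (simp add: mult.assoc)
      have "0 \<le> gu k * s k" using gpos[of k] s_nonneg[of k] by simp
      then show "0 < (2 * g1 * S + 1) * (2 * gu k * s k + 1)" using g1 S(1) by (simp add: add_nonneg_pos mult.assoc)
    qed simp
    then show ?thesis unfolding b b0_def using g(2)[of k] by linarith
  qed
  have bpos: "0 < b k" for k using b0 b_low[of k] by linarith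
  have b_g: "b k \<le> g k" for k unfolding b using g(3)[of k] by linarith
  have gs: "0 \<le> gu k * s k" for k using gpos[of k] s_nonneg[of k] by simp
  have b_1: "b k \<le> 1" for k
  proof -
    have "1 / (2 * gu k * s k + 1) \<le> 1" using gs[of k] by (simp add: mult.assoc)
    then show ?thesis unfolding b by linarith
  qed
  have a_1: "a k \<le> 1" for k
  proof -
    have "1 \<le> 1 + (b k)\<^sup>2 * s k" using s_nonneg[of k] by simp
    then show ?thesis unfolding a by simp
  qed
  have half: "a k * b k * s k * g k \<le> 1/2" "0 \<le> a k * b k * s k * g k" for k
  proof -
    \<comment> \<open>The origin of the denominator in the second entry: the map
      \<open>v / (2 * v + 1)\<close> stays below 1/2.\<close>
    have bs: "b k * (gu k * s k) \<le> 1/2"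
    proof -
      have "b k * (gu k * s k) \<le> 1 / (2 * gu k * s k + 1) * (gu k * s k)"
        by (rule mult_right_mono[OF _ gs]) (simp add: b)
      also have "\<dots> \<le> 1/2" using gs[of k] by (simp add: divide_simps mult.assoc)
      finally show ?thesis .
    qed
    have "a k * (b k * (s k * g k)) \<le> 1 * (b k * (gu k * s k))"
    proof (rule mult_mono)
      show "b k * (s k * g k) \<le> b k * (gu k * s k)"
        using bpos[of k] mult_left_mono[OF g(4) s_nonneg, of k k] by (intro mult_left_mono) (auto simp: mult.commute)
    qed (use a_1[of k] a_pos[of k] bpos[of k] s_nonneg[of k] gpos[of k] in auto)
    then show "a k * b k * s k * g k \<le> 1/2" using bs by (simp add: mult.assoc)
    show "0 \<le> a k * b k * s k * g k" using a_pos[of k] bpos[of k] s_nonneg[of k] gpos[of k] by simp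
  qed
  show ?thesis
  \<comment> \<open>\<open>c\<close> is half of the lower bound \<open>b0 * g0\<close> for
    \<open>b * g\<close>. The slope \<open>g\<close> is exact, hence \<open>eps\<close> vanishes.
    The factor of the prediction error in the martingale coefficient is at most 2 in absolute value,
    so 16 is generous.\<close>
  proof (rule regret_bound[where psi=psi and w=w and eps="\<lambda>_. 0" and c="b0 * g0 / 2" and mlow=1 and B=1 and Cf=16 and Ce=0])
    show "theta \<in> D" "0 < lam" by fact+
    show "r k = psi k + w k" for k by (rule r)
    show "(b k)\<^sup>2 \<le> 1" for k using bpos[of k] b_1[of k] by (simp add: power_le_one)
    show "0 < b0 * g0 / 2" using b0 g(1) by simp
    show "((b k)\<^sup>2 * (phi k \<bullet> (theta - th k))\<^sup>2 - 2 * b k * (phi k \<bullet> (theta - th k)) * psi k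
        + a k * (b k)\<^sup>2 * s k * (psi k)\<^sup>2) / 1 \<le> - (b0 * g0 / 2) * (phi k \<bullet> (theta - th k))\<^sup>2 + 0" for k
    proof -
      define x where "x = phi k \<bullet> (theta - th k)"
      define t where "t = b k * g k * x\<^sup>2"
      have t0: "0 \<le> t" unfolding t_def using bpos[of k] gpos[of k] by simp
      have e: "(b k)\<^sup>2 * x\<^sup>2 - 2 * b k * x * psi k + a k * (b k)\<^sup>2 * s k * (psi k)\<^sup>2
          = b k * (b k * x\<^sup>2) - 2 * t + (a k * b k * s k * g k) * t"
        unfolding psi x_def[symmetric] t_def by (simp add: power2_eq_square algebra_simps)
      have "b k * (b k * x\<^sup>2) \<le> t" unfolding t_def mult.assoc
        using bpos[of k] b_g[of k] by (intro mult_left_mono mult_right_mono) auto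
      moreover have "(a k * b k * s k * g k) * t \<le> (1/2) * t" by (rule mult_right_mono[OF half(1) t0])
      moreover have "b0 * g0 * x\<^sup>2 \<le> t" unfolding t_def
      proof (intro mult_right_mono mult_mono b_low)
        show "g0 \<le> g k" using g(2,3)[of k] by linarith
      qed (use bpos[of k] g(1) in auto)
      ultimately show ?thesis unfolding x_def[symmetric] e by simp
    qed
    show "((2 / 1) * (a k * (b k)\<^sup>2 * s k * psi k - b k * (phi k \<bullet> (theta - th k))))\<^sup>2 \<le> 16 * (phi k \<bullet> (theta - th k))\<^sup>2" for k
    proof -
      define x where "x = phi k \<bullet> (theta - th k)"
      have e: "a k * (b k)\<^sup>2 * s k * psi k - b k * x = (a k * b k * s k * g k - 1) * b k * x"
        unfolding psi x_def[symmetric] by (simp add: power2_eq_square algebra_simps)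
      have "\<bar>(a k * b k * s k * g k - 1) * b k\<bar> \<le> 1 * 1"
        unfolding abs_mult using half[of k] bpos[of k] b_1[of k] by (intro mult_mono) auto
      then have "\<bar>2 * ((a k * b k * s k * g k - 1) * b k)\<bar> \<le> \<bar>4\<bar>" by simp
      then have "(2 * ((a k * b k * s k * g k - 1) * b k))\<^sup>2 \<le> 4\<^sup>2" by (simp only: abs_le_square_iff)
      then have "(2 * ((a k * b k * s k * g k - 1) * b k))\<^sup>2 * x\<^sup>2 \<le> 16 * x\<^sup>2" by (intro mult_right_mono) auto
      then show ?thesis unfolding x_def[symmetric] e by (simp add: power_mult_distrib)
    qed
    show "(\<Sum>k\<le>n. (2 / 1) * (a k * (b k)\<^sup>2 * s k * psi k - b k * (phi k \<bullet> (theta - th k))) * w k)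
      \<le> C2 * (1 + (\<Sum>k\<le>n. ((2 / 1) * (a k * (b k)\<^sup>2 * s k * psi k - b k * (phi k \<bullet> (theta - th k))))\<^sup>2)) powr (3/4)" for n
      using cross[of n] unfolding f .
    show "(\<Sum>k\<le>n. a k * (b k)\<^sup>2 * s k * (w k)\<^sup>2) \<le> C3 * (1 + (\<Sum>k\<le>n. a k * (b k)\<^sup>2 * s k))" for n by (rule quad)
  qed auto
qed

text \<open>By \<open>gain_eq\<close> the drift equals the squared linearisation error over
  \<open>mu\<close> minus \<open>a * psi\<^sup>2\<close>, regardless of how \<open>b\<close>
  compares with the true slope. The error is charged to \<open>zb\<close>, whose sum the first step
  controls.\<close>

lemma second_step_prediction_error_sum:
  fixes psi w zb :: "nat \<Rightarrow> real"
  assumes qn: "quasi_newton D phi b mu r th P s a"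
    and theta: "theta \<in> D" and lam: "0 < lam"
    and phi: "\<And>k. norm (phi k) \<le> B"
    and r: "\<And>k. r k = psi k + w k"
    and mub: "0 < m0" "\<And>k. m0 \<le> mu k" "\<And>k. mu k \<le> m1"
    and b: "\<And>k. \<bar>b k\<bar> \<le> g1"
    and psi: "\<And>k. \<bar>phi k \<bullet> (theta - th k)\<bar> \<le> K * \<bar>psi k\<bar>" "0 \<le> K"
    and lin: "\<And>k. (b k * (phi k \<bullet> (theta - th k)) - psi k)\<^sup>2 \<le> Cx * zb k" "0 \<le> Cx"
    and zb: "\<And>n. (\<Sum>k\<le>n. zb k) \<le> Cz * max 1 (ln (max_eig ((\<Sum>i\<le>n. outer (phi i) (phi i)) + lam *\<^sub>R mat 1)))"
    and zb0: "\<And>k. 0 \<le> zb k"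
    and cross: "\<And>n. (\<Sum>k\<le>n. f k * w k) \<le> C2 * (1 + (\<Sum>k\<le>n. (f k)\<^sup>2)) powr (3/4)"
    and f: "\<And>k. f k = (2 / mu k) * (a k * (b k)\<^sup>2 * s k * psi k - b k * (phi k \<bullet> (theta - th k)))"
    and quad: "\<And>n. (\<Sum>k\<le>n. a k * (b k)\<^sup>2 * s k * (w k)\<^sup>2) \<le> C3 * (1 + (\<Sum>k\<le>n. a k * (b k)\<^sup>2 * s k))"
  shows "\<exists>C\<ge>0. \<forall>n. (\<Sum>k\<le>n. (psi k)\<^sup>2)
    \<le> C * max 1 (ln (max_eig ((\<Sum>i\<le>n. outer (phi i) (phi i)) + lam *\<^sub>R mat 1)))"
proof -
  interpret quasi_newton D phi b mu r th P s a by (rule qn)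
  obtain S where S: "0 \<le> S" "\<And>k. s k \<le> S" using s_bounded[OF phi] by blast
  have g1: "0 \<le> g1" using b[of 0] by linarith
  have m1: "0 < m1" using mub(1) mub(2,3)[of 0] by linarith
  have b2: "(b k)\<^sup>2 \<le> g1\<^sup>2" for k using b[of k] g1 by (metis abs_le_square_iff abs_of_nonneg)
  \<comment> \<open>A lower bound for the gain \<open>a\<close>, obtained from the upper bounds on
    \<open>mu\<close>, \<open>b\<^sup>2\<close> and \<open>s\<close>.\<close>
  define c where "c = 1 / (m1 + g1\<^sup>2 * S)"
  have c: "0 < c" unfolding c_def using m1 S(1) by (simp add: add_pos_nonneg)
  have a_low: "c \<le> a k" for k
  proof -
    have "mu k + (b k)\<^sup>2 * s k \<le> m1 + g1\<^sup>2 * S"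
      by (intro add_mono mult_mono mub(3) b2 S s_nonneg) simp
    moreover have "0 < mu k + (b k)\<^sup>2 * s k" using quasi_newton.mu[OF qn, of k] s_nonneg[of k] by (simp add: add_pos_nonneg)
    ultimately show ?thesis unfolding c_def a by (intro divide_left_mono) auto
  qed
  \<comment> \<open>The gain is at most 1 and \<open>\<bar>b * x\<bar>\<close> at most
    \<open>g1 * K * \<bar>psi\<bar>\<close>; the added 1 only secures positivity.\<close>
  define C1 where "C1 = (2 / m0 * (1 + g1 * K))\<^sup>2 + 1"
  show ?thesis
  proof (rule regret_bound[where psi=psi and w=w and eps="\<lambda>k. Cx / m0 * zb k" and c=c and mlow=m0 and B="g1\<^sup>2" and Cf=C1 and Ce="Cx / m0 * Cz"])
    show "theta \<in> D" "0 < lam" "0 < m0" by fact+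
    show "r k = psi k + w k" for k by (rule r)
    show "m0 \<le> mu k" for k by (rule mub)
    show "(b k)\<^sup>2 \<le> g1\<^sup>2" for k by (rule b2)
    show "0 < c" by (rule c)
    show "0 < C1" unfolding C1_def by (simp add: add_nonneg_pos)
    show "((b k)\<^sup>2 * (phi k \<bullet> (theta - th k))\<^sup>2 - 2 * b k * (phi k \<bullet> (theta - th k)) * psi k
        + a k * (b k)\<^sup>2 * s k * (psi k)\<^sup>2) / mu k \<le> - c * (psi k)\<^sup>2 + Cx / m0 * zb k" for k
    proof -
      define x where "x = phi k \<bullet> (theta - th k)"
      have muk: "0 < mu k" by (rule quasi_newton.mu[OF qn])
      have e: "((b k)\<^sup>2 * x\<^sup>2 - 2 * b k * x * psi k + a k * (b k)\<^sup>2 * s k * (psi k)\<^sup>2) / mu k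
        = (b k * x - psi k)\<^sup>2 / mu k - a k * (psi k)\<^sup>2"
        unfolding gain_eq using muk by (simp add: field_simps power2_eq_square)
      have "(b k * x - psi k)\<^sup>2 / mu k \<le> (Cx * zb k) / m0"
        using lin(1)[of k] mub(1) mub(2)[of k] unfolding x_def by (intro frac_le) (auto intro: order_trans[OF zero_le_power2])
      moreover have "a k * (psi k)\<^sup>2 \<ge> c * (psi k)\<^sup>2" by (rule mult_right_mono[OF a_low]) simp
      ultimately show ?thesis unfolding x_def[symmetric] e by simp
    qed
    show "((2 / mu k) * (a k * (b k)\<^sup>2 * s k * psi k - b k * (phi k \<bullet> (theta - th k))))\<^sup>2 \<le> C1 * (psi k)\<^sup>2" for k
    proof -
      define x where "x = phi k \<bullet> (theta - th k)"
      define q where "q = (2 / mu k) * (a k * (b k)\<^sup>2 * s k * psi k - b k * x)"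
      have "\<bar>a k * (b k)\<^sup>2 * s k * psi k - b k * x\<bar> \<le> \<bar>a k * (b k)\<^sup>2 * s k\<bar> * \<bar>psi k\<bar> + \<bar>b k\<bar> * \<bar>x\<bar>"
        using abs_triangle_ineq4[of "a k * (b k)\<^sup>2 * s k * psi k" "b k * x"] by (simp only: abs_mult)
      also have "\<dots> \<le> 1 * \<bar>psi k\<bar> + g1 * (K * \<bar>psi k\<bar>)"
      proof (intro add_mono mult_mono)
        show "\<bar>a k * (b k)\<^sup>2 * s k\<bar> \<le> 1" using gain_bounds[of k] by simp
        show "\<bar>x\<bar> \<le> K * \<bar>psi k\<bar>" unfolding x_def by (rule psi)
      qed (use b[of k] g1 in auto)
      finally have u1: "\<bar>a k * (b k)\<^sup>2 * s k * psi k - b k * x\<bar> \<le> (1 + g1 * K) * \<bar>psi k\<bar>" by (simp add: algebra_simps)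
      have u2: "\<bar>2 / mu k\<bar> \<le> 2 / m0" using mub(1) mub(2)[of k] by (simp add: frac_le)
      have "\<bar>q\<bar> \<le> (2 / m0) * ((1 + g1 * K) * \<bar>psi k\<bar>)"
        unfolding q_def abs_mult[of "2 / mu k"] by (rule mult_mono[OF u2 u1]) (use mub(1) in auto)
      then have "\<bar>q\<bar> \<le> \<bar>2 / m0 * (1 + g1 * K) * psi k\<bar>"
      proof -
        have "\<bar>2 / m0 * (1 + g1 * K)\<bar> = 2 / m0 * (1 + g1 * K)"
          by (rule abs_of_nonneg) (use mub(1) g1 psi(2) in simp)
        then have "\<bar>2 / m0 * (1 + g1 * K) * psi k\<bar> = 2 / m0 * ((1 + g1 * K) * \<bar>psi k\<bar>)"
          by (subst abs_mult) (simp only: mult.assoc)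
        then show ?thesis using \<open>\<bar>q\<bar> \<le> (2 / m0) * ((1 + g1 * K) * \<bar>psi k\<bar>)\<close> by (simp only:)
      qed
      then have "q\<^sup>2 \<le> (2 / m0 * (1 + g1 * K) * psi k)\<^sup>2" by (simp only: abs_le_square_iff)
      also have "\<dots> \<le> C1 * (psi k)\<^sup>2" unfolding C1_def by (simp only: power_mult_distrib) (simp add: distrib_right)
      finally show ?thesis unfolding q_def x_def .
    qed
    show "(\<Sum>k\<le>n. Cx / m0 * zb k) \<le> Cx / m0 * Cz * max 1 (ln (max_eig ((\<Sum>i\<le>n. outer (phi i) (phi i)) + lam *\<^sub>R mat 1)))" for n
      using mult_left_mono[OF zb[of n], of "Cx / m0"] lin(2) mub(1) by (simp add: sum_distrib_left mult.assoc)
    show "(\<Sum>k\<le>n. (2 / mu k) * (a k * (b k)\<^sup>2 * s k * psi k - b k * (phi k \<bullet> (theta - th k))) * w k)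
      \<le> C2 * (1 + (\<Sum>k\<le>n. ((2 / mu k) * (a k * (b k)\<^sup>2 * s k * psi k - b k * (phi k \<bullet> (theta - th k))))\<^sup>2)) powr (3/4)" for n
      using cross[of n] unfolding f .
    show "(\<Sum>k\<le>n. a k * (b k)\<^sup>2 * s k * (w k)\<^sup>2) \<le> C3 * (1 + (\<Sum>k\<le>n. a k * (b k)\<^sup>2 * s k))" for n by (rule quad)
  qed auto
qed

section \<open>Conditional expectations and localised noise\<close>

context filtered_prob_space
begin

lemma sigma_finite_subalgebra_F: "sigma_finite_subalgebra M (F k)"
proof -
  interpret finite_measure_subalgebra M "F k"
    by unfold_locales (rule filt_sub)
  show ?thesis by (rule sigma_finite_subalgebra_axioms)
qed

lemma sets_F: "A \<in> sets (F k) \<Longrightarrow> A \<in> sets M"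
  using filt_sub[of k] by (auto simp: subalgebra_def)

text \<open>Integrability of \<open>f\<close>, which the library rules for \<open>real_cond_exp\<close> require, fails for the
  observations, as the regressors are bounded by a random constant only.\<close>

lemma cond_exp_indicator_localise:
  fixes f :: "'a \<Rightarrow> real"
  assumes B: "B \<in> sets (F k)" and f: "f \<in> borel_measurable M"
  shows "AE \<omega> in M. \<omega> \<in> B \<longrightarrow> real_cond_exp M (F k) (\<lambda>\<omega>. indicator B \<omega> * f \<omega>) \<omega> = real_cond_exp M (F k) f \<omega>"
proof -
  interpret sigma_finite_subalgebra M "F k" by (rule sigma_finite_subalgebra_F)
  \<comment> \<open>\<open>real_cond_exp\<close> is the difference of the conditional expectations
    of positive and negative part, and in the nonnegative setting the indicator can be pulled out of
    each without integrability.\<close>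
  have 1: "AE \<omega> in M. indicator B \<omega> * nn_cond_exp M (F k) g \<omega> = nn_cond_exp M (F k) (\<lambda>\<omega>. indicator B \<omega> * g \<omega>) \<omega>"
    if "g \<in> borel_measurable M" for g :: "'a \<Rightarrow> ennreal"
    by (rule nn_cond_exp_prod) (use that B in auto)
  have "(\<lambda>\<omega>. ennreal (f \<omega>)) \<in> borel_measurable M" "(\<lambda>\<omega>. ennreal (- f \<omega>)) \<in> borel_measurable M"
    using f by auto
  note 1[OF this(1)] 1[OF this(2)]
  moreover have "(\<lambda>\<omega>. indicator B \<omega> * ennreal (f \<omega>)) = (\<lambda>\<omega>. ennreal (indicator B \<omega> * f \<omega>))"
    "(\<lambda>\<omega>. indicator B \<omega> * ennreal (- f \<omega>)) = (\<lambda>\<omega>. ennreal (- (indicator B \<omega> * f \<omega>)))"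
    by (auto simp: indicator_def)
  ultimately show ?thesis unfolding real_cond_exp_def by auto
qed

text \<open>The test weight is the indicator of the set where the conditional expectation exceeds
  \<open>K\<close>; on it the integrated excess must vanish.\<close>

lemma cond_exp_le_imp_real_cond_exp_le:
  assumes "cond_exp_le M (F k) Z K"
  shows "AE \<omega> in M. real_cond_exp M (F k) Z \<omega> \<le> K"
proof -
  interpret sigma_finite_subalgebra M "F k" by (rule sigma_finite_subalgebra_F)
  have Z: "integrable M Z" using assms by (simp add: cond_exp_le_def)
  define E where "E = real_cond_exp M (F k) Z"
  have Em: "E \<in> borel_measurable (F k)" unfolding E_def by simp
  have Ei: "integrable M E" unfolding E_def by (rule real_cond_exp_int(1)[OF Z])
  define A where "A = {\<omega>\<in>space (F k). K < E \<omega>}"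
  have A: "A \<in> sets (F k)" unfolding A_def using Em by measurable
  define g where "g \<omega> = (indicator A \<omega> :: real)" for \<omega>
  have gm: "g \<in> borel_measurable (F k)" unfolding g_def using A by simp
  have g01: "0 \<le> g \<omega> \<and> g \<omega> \<le> 1" for \<omega> by (simp add: g_def)
  have gZ: "integrable M (\<lambda>\<omega>. g \<omega> * Z \<omega>)" "(\<integral>\<omega>. g \<omega> * Z \<omega> \<partial>M) \<le> K * (\<integral>\<omega>. g \<omega> \<partial>M)"
    by (rule cond_exp_leD[OF assms gm g01])+
  have gE: "integrable M (\<lambda>\<omega>. g \<omega> * E \<omega>)" "(\<integral>\<omega>. g \<omega> * E \<omega> \<partial>M) = (\<integral>\<omega>. g \<omega> * Z \<omega> \<partial>M)"
    unfolding E_def using real_cond_exp_intg[OF gZ(1) gm] Z by auto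
  have gi: "integrable M g"
    by (rule integrable_bounded[OF measurable_filtration[OF gm], of 1]) (use g01 in auto)
  have i: "integrable M (\<lambda>\<omega>. g \<omega> * E \<omega> - K * g \<omega>)" using gE(1) gi by simp
  have nn: "0 \<le> g \<omega> * E \<omega> - K * g \<omega>" for \<omega> by (auto simp: g_def indicator_def A_def)
  have "(\<integral>\<omega>. g \<omega> * E \<omega> - K * g \<omega> \<partial>M) \<le> 0" using gE gi gZ(2) by simp
  moreover have "0 \<le> (\<integral>\<omega>. g \<omega> * E \<omega> - K * g \<omega> \<partial>M)" by (rule Bochner_Integration.integral_nonneg) (rule nn)
  ultimately have "AE \<omega> in M. g \<omega> * E \<omega> - K * g \<omega> = 0"
    using integral_nonneg_eq_0_iff_AE[OF i] nn by simp
  with AE_space show ?thesis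
    by eventually_elim (auto simp: g_def indicator_def A_def E_def space_F split: if_splits)
qed

text \<open>Transfers a single conditional moment bound, that of the localised noise, to everything
  it dominates: the localised observation, its negative, and powers of the martingale
  difference.\<close>

lemma cond_exp_le_dominated:
  assumes u: "cond_exp_le M (F k) u N" and Z: "Z \<in> borel_measurable M"
    and le: "AE \<omega> in M. \<bar>Z \<omega>\<bar> \<le> \<alpha> + \<beta> * u \<omega>" and b: "0 \<le> \<beta>"
  shows "cond_exp_le M (F k) Z (\<alpha> + \<beta> * N)"
proof -
  have ui: "integrable M u" using u by (simp add: cond_exp_le_def)
  have di: "integrable M (\<lambda>\<omega>. \<alpha> + \<beta> * u \<omega>)" using ui by simp
  have Zi: "integrable M Z"
    by (rule Bochner_Integration.integrable_bound[OF di Z]) (use le in \<open>eventually_elim, auto\<close>)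
  have "(\<integral>\<omega>. g \<omega> * Z \<omega> \<partial>M) \<le> (\<alpha> + \<beta> * N) * (\<integral>\<omega>. g \<omega> \<partial>M)"
    if g: "g \<in> borel_measurable (F k)" "\<And>\<omega>. 0 \<le> g \<omega> \<and> g \<omega> \<le> 1" for g
  proof -
    have gM: "g \<in> borel_measurable M" by (rule measurable_filtration[OF g(1)])
    have abs: "\<bar>g \<omega>\<bar> \<le> 1" for \<omega> using g(2)[of \<omega>] by simp
    have gi: "integrable M g" by (rule integrable_bounded[OF gM abs])
    have gu: "integrable M (\<lambda>\<omega>. g \<omega> * u \<omega>)" by (rule integrable_bounded_mult[OF ui gM abs])
    have "(\<integral>\<omega>. g \<omega> * Z \<omega> \<partial>M) \<le> (\<integral>\<omega>. \<alpha> * g \<omega> + \<beta> * (g \<omega> * u \<omega>) \<partial>M)"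
    proof (rule integral_mono_AE)
      show "integrable M (\<lambda>\<omega>. g \<omega> * Z \<omega>)" by (rule integrable_bounded_mult[OF Zi gM abs])
      show "integrable M (\<lambda>\<omega>. \<alpha> * g \<omega> + \<beta> * (g \<omega> * u \<omega>))" using gi gu by simp
      show "AE \<omega> in M. g \<omega> * Z \<omega> \<le> \<alpha> * g \<omega> + \<beta> * (g \<omega> * u \<omega>)"
        using le
      proof eventually_elim
        case (elim \<omega>)
        then have "Z \<omega> \<le> \<alpha> + \<beta> * u \<omega>" by linarith
        then have "g \<omega> * Z \<omega> \<le> g \<omega> * (\<alpha> + \<beta> * u \<omega>)" by (rule mult_left_mono) (use g(2) in simp)
        then show ?case by (simp add: algebra_simps)
      qed
    qed
    also have "\<dots> = \<alpha> * (\<integral>\<omega>. g \<omega> \<partial>M) + \<beta> * (\<integral>\<omega>. g \<omega> * u \<omega> \<partial>M)" using gi gu by simp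
    also have "\<dots> \<le> \<alpha> * (\<integral>\<omega>. g \<omega> \<partial>M) + \<beta> * (N * (\<integral>\<omega>. g \<omega> \<partial>M))"
      by (intro add_left_mono mult_left_mono[OF _ b] cond_exp_leD(2)[OF u g])
    finally show ?thesis by (simp add: algebra_simps)
  qed
  then show ?thesis using Zi unfolding cond_exp_le_def by blast
qed

text \<open>Freezing lemma: monotonicity in the frozen argument replaces independence, by sandwiching
  \<open>X\<close> between rationals.\<close>

lemma cond_exp_substitution:
  fixes Y :: "real \<Rightarrow> 'a \<Rightarrow> real" and X C e :: "'a \<Rightarrow> real" and G :: "'a \<Rightarrow> real \<Rightarrow> real"
  assumes X: "X \<in> borel_measurable (F k)" and C: "C \<in> borel_measurable (F k)"
    and Ym: "\<And>x. Y x \<in> borel_measurable M" and YX: "(\<lambda>\<omega>. Y (X \<omega>) \<omega>) \<in> borel_measurable M"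
    and mono: "AE \<omega> in M. \<forall>x y. x \<le> y \<longrightarrow> Y x \<omega> \<le> Y y \<omega>"
    and bound: "AE \<omega> in M. \<forall>x. \<bar>Y x \<omega>\<bar> \<le> \<bar>x\<bar> + C \<omega> + \<bar>e \<omega>\<bar>" and e: "integrable M e"
    and G: "\<And>x. AE \<omega> in M. G \<omega> x = real_cond_exp M (F k) (Y x) \<omega>"
    and cont: "AE \<omega> in M. \<forall>x. isCont (G \<omega>) x"
  shows "AE \<omega> in M. real_cond_exp M (F k) (\<lambda>\<omega>. Y (X \<omega>) \<omega>) \<omega> = G \<omega> (X \<omega>)"
proof -
  interpret sigma_finite_subalgebra M "F k" by (rule sigma_finite_subalgebra_F)
  define E where "E = real_cond_exp M (F k) (\<lambda>\<omega>. Y (X \<omega>) \<omega>)"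
  have local_int: "integrable M (\<lambda>\<omega>. indicator A \<omega> * Y' \<omega>)"
    if A: "A \<in> sets (F k)" and Y': "Y' \<in> borel_measurable M"
      and le: "AE \<omega> in M. \<omega> \<in> A \<longrightarrow> \<bar>Y' \<omega>\<bar> \<le> c + \<bar>e \<omega>\<bar>" for A Y' and c :: real
  proof (rule Bochner_Integration.integrable_bound)
    show "integrable M (\<lambda>\<omega>. \<bar>c\<bar> + \<bar>e \<omega>\<bar>)" using e by simp
    show "(\<lambda>\<omega>. indicator A \<omega> * Y' \<omega>) \<in> borel_measurable M"
      using sets_F[OF A] Y' by (intro borel_measurable_times borel_measurable_indicator)
    show "AE \<omega> in M. norm (indicator A \<omega> * Y' \<omega>) \<le> norm (\<bar>c\<bar> + \<bar>e \<omega>\<bar>)"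
      using le by eventually_elim (auto simp: indicator_def)
  qed
  \<comment> \<open>On \<open>A\<close> monotonicity gives
    \<open>Y (X \<omega>) \<omega> \<le> Y q \<omega>\<close>. The bounds by \<open>N\<close> make
    both sides integrable after multiplication by the indicator, and since \<open>A\<close> belongs
    to the past, the conditional expectations are unchanged on it.\<close>
  have upper: "AE \<omega> in M. X \<omega> \<le> q \<and> \<bar>X \<omega>\<bar> \<le> N \<and> C \<omega> \<le> N \<longrightarrow> E \<omega> \<le> G \<omega> q" for q N :: real
  proof -
    define A where "A = {\<omega>\<in>space (F k). X \<omega> \<le> q \<and> \<bar>X \<omega>\<bar> \<le> N \<and> C \<omega> \<le> N}"
    have A: "A \<in> sets (F k)" unfolding A_def using X C by measurable
    have i1: "integrable M (\<lambda>\<omega>. indicator A \<omega> * Y (X \<omega>) \<omega>)"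
    proof (rule local_int[OF A YX])
      show "AE \<omega> in M. \<omega> \<in> A \<longrightarrow> \<bar>Y (X \<omega>) \<omega>\<bar> \<le> (N + N) + \<bar>e \<omega>\<bar>"
        using bound
      proof eventually_elim
        case (elim \<omega>)
        from elim[rule_format, of "X \<omega>"] show ?case by (auto simp: A_def)
      qed
    qed
    have i2: "integrable M (\<lambda>\<omega>. indicator A \<omega> * Y q \<omega>)"
    proof (rule local_int[OF A Ym])
      show "AE \<omega> in M. \<omega> \<in> A \<longrightarrow> \<bar>Y q \<omega>\<bar> \<le> (\<bar>q\<bar> + N) + \<bar>e \<omega>\<bar>"
        using bound
      proof eventually_elim
        case (elim \<omega>)
        from elim[rule_format, of q] show ?case by (auto simp: A_def)
      qed
    qed
    have "AE \<omega> in M. real_cond_exp M (F k) (\<lambda>\<omega>. indicator A \<omega> * Y (X \<omega>) \<omega>) \<omega>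
        \<le> real_cond_exp M (F k) (\<lambda>\<omega>. indicator A \<omega> * Y q \<omega>) \<omega>"
      by (rule real_cond_exp_mono[OF _ i1 i2])
         (use mono in \<open>eventually_elim, auto simp: A_def indicator_def\<close>)
    with cond_exp_indicator_localise[OF A YX] cond_exp_indicator_localise[OF A Ym[of q]] G[of q] AE_space
    show ?thesis
    proof eventually_elim
      case (elim \<omega>)
      show ?case
      proof
        assume "X \<omega> \<le> q \<and> \<bar>X \<omega>\<bar> \<le> N \<and> C \<omega> \<le> N"
        then have "\<omega> \<in> A" using elim(4) by (simp add: A_def space_F)
        then show "E \<omega> \<le> G \<omega> q" using elim(1,2,3,5) by (simp add: E_def)
      qed
    qed
  qed
  have lower: "AE \<omega> in M. q \<le> X \<omega> \<and> \<bar>X \<omega>\<bar> \<le> N \<and> C \<omega> \<le> N \<longrightarrow> G \<omega> q \<le> E \<omega>" for q N :: real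
  proof -
    define A where "A = {\<omega>\<in>space (F k). q \<le> X \<omega> \<and> \<bar>X \<omega>\<bar> \<le> N \<and> C \<omega> \<le> N}"
    have A: "A \<in> sets (F k)" unfolding A_def using X C by measurable
    have i1: "integrable M (\<lambda>\<omega>. indicator A \<omega> * Y (X \<omega>) \<omega>)"
    proof (rule local_int[OF A YX])
      show "AE \<omega> in M. \<omega> \<in> A \<longrightarrow> \<bar>Y (X \<omega>) \<omega>\<bar> \<le> (N + N) + \<bar>e \<omega>\<bar>"
        using bound
      proof eventually_elim
        case (elim \<omega>)
        from elim[rule_format, of "X \<omega>"] show ?case by (auto simp: A_def)
      qed
    qed
    have i2: "integrable M (\<lambda>\<omega>. indicator A \<omega> * Y q \<omega>)"
    proof (rule local_int[OF A Ym])
      show "AE \<omega> in M. \<omega> \<in> A \<longrightarrow> \<bar>Y q \<omega>\<bar> \<le> (\<bar>q\<bar> + N) + \<bar>e \<omega>\<bar>"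
        using bound
      proof eventually_elim
        case (elim \<omega>)
        from elim[rule_format, of q] show ?case by (auto simp: A_def)
      qed
    qed
    have "AE \<omega> in M. real_cond_exp M (F k) (\<lambda>\<omega>. indicator A \<omega> * Y q \<omega>) \<omega>
        \<le> real_cond_exp M (F k) (\<lambda>\<omega>. indicator A \<omega> * Y (X \<omega>) \<omega>) \<omega>"
      by (rule real_cond_exp_mono[OF _ i2 i1])
         (use mono in \<open>eventually_elim, auto simp: A_def indicator_def\<close>)
    with cond_exp_indicator_localise[OF A YX] cond_exp_indicator_localise[OF A Ym[of q]] G[of q] AE_space
    show ?thesis
    proof eventually_elim
      case (elim \<omega>)
      show ?case
      proof
        assume "q \<le> X \<omega> \<and> \<bar>X \<omega>\<bar> \<le> N \<and> C \<omega> \<le> N"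
        then have "\<omega> \<in> A" using elim(4) by (simp add: A_def space_F)
        then show "G \<omega> q \<le> E \<omega>" using elim(1,2,3,5) by (simp add: E_def)
      qed
    qed
  qed
  \<comment> \<open>Countably many \<open>q\<close> and \<open>N\<close> leave one common null set;
    continuity of \<open>G\<close> then closes the gap between \<open>q\<close> and
    \<open>X\<close>.\<close>
  have u': "AE \<omega> in M. \<forall>(q::rat) (N::nat). X \<omega> \<le> of_rat q \<and> \<bar>X \<omega>\<bar> \<le> real N \<and> C \<omega> \<le> real N \<longrightarrow> E \<omega> \<le> G \<omega> (of_rat q)"
    unfolding AE_all_countable using upper by blast
  have l': "AE \<omega> in M. \<forall>(q::rat) (N::nat). of_rat q \<le> X \<omega> \<and> \<bar>X \<omega>\<bar> \<le> real N \<and> C \<omega> \<le> real N \<longrightarrow> G \<omega> (of_rat q) \<le> E \<omega>"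
    unfolding AE_all_countable using lower by blast
  from u' l' cont show ?thesis
  proof eventually_elim
    case (elim \<omega>)
    obtain N :: nat where "max \<bar>X \<omega>\<bar> (C \<omega>) \<le> real N" using real_arch_simple by blast
    then have N: "\<bar>X \<omega>\<bar> \<le> real N" "C \<omega> \<le> real N" by auto
    have c: "isCont (G \<omega>) (X \<omega>)" using elim by blast
    have "E \<omega> \<le> G \<omega> (X \<omega>)"
    proof (rule ccontr)
      assume "\<not> ?thesis"
      then have "0 < E \<omega> - G \<omega> (X \<omega>)" by simp
      with c obtain d where d: "0 < d" "\<And>x. dist x (X \<omega>) < d \<Longrightarrow> dist (G \<omega> x) (G \<omega> (X \<omega>)) < E \<omega> - G \<omega> (X \<omega>)"
        unfolding continuous_at_eps_delta by metis
      obtain q where q: "X \<omega> < of_rat q" "of_rat q < X \<omega> + d" using of_rat_dense[of "X \<omega>" "X \<omega> + d"] d(1) by auto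
      then have "G \<omega> (of_rat q) < E \<omega>" using d(2)[of "of_rat q"] by (auto simp: dist_real_def)
      moreover have "E \<omega> \<le> G \<omega> (of_rat q)" using elim(1) N q(1) by (meson less_imp_le)
      ultimately show False by simp
    qed
    moreover have "G \<omega> (X \<omega>) \<le> E \<omega>"
    proof (rule ccontr)
      assume "\<not> ?thesis"
      then have "0 < G \<omega> (X \<omega>) - E \<omega>" by simp
      with c obtain d where d: "0 < d" "\<And>x. dist x (X \<omega>) < d \<Longrightarrow> dist (G \<omega> x) (G \<omega> (X \<omega>)) < G \<omega> (X \<omega>) - E \<omega>"
        unfolding continuous_at_eps_delta by metis
      obtain q where q: "X \<omega> - d < of_rat q" "of_rat q < X \<omega>" using of_rat_dense[of "X \<omega> - d" "X \<omega>"] d(1) by auto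
      then have "E \<omega> < G \<omega> (of_rat q)" using d(2)[of "of_rat q"] by (auto simp: dist_real_def)
      moreover have "G \<omega> (of_rat q) \<le> E \<omega>" using elim(2) N q(2) by (meson less_imp_le)
      ultimately show False by simp
    qed
    ultimately show ?case by (simp add: E_def)
  qed
qed

text \<open>The observation restricted to \<open>B\<close> is centred; as \<open>B\<close> belongs
  to the past, nothing changes on \<open>B\<close> itself, while the restricted variable has bounded
  conditional moments. One constant serves both moments because \<open>2\<close> and
  \<open>2 + 2 * d\<close> are at most \<open>p\<close>.\<close>

lemma localised_noise:
  fixes X C e y :: "'a \<Rightarrow> real" and N p d :: real
  assumes X: "X \<in> borel_measurable (F k)" and C: "C \<in> borel_measurable (F k)"
    and y: "y \<in> borel_measurable (F (Suc k))" and e: "e \<in> borel_measurable M"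
    and bound: "AE \<omega> in M. \<bar>y \<omega>\<bar> \<le> \<bar>X \<omega>\<bar> + C \<omega> + \<bar>e \<omega>\<bar>"
    and N: "0 \<le> N" and p: "2 \<le> p" "2 + 2 * d \<le> p" "0 \<le> d"
  defines "B \<equiv> {\<omega>\<in>space M. \<bar>X \<omega>\<bar> \<le> N \<and> C \<omega> \<le> N \<and> nn_cond_exp M (F k) (\<lambda>\<omega>. ennreal (\<bar>e \<omega>\<bar> powr p)) \<omega> \<le> ennreal N}"
    and "K \<equiv> 2 powr p * ((5 * N + 1) powr p + N)"
  shows "\<exists>w. w \<in> borel_measurable (F (Suc k))
    \<and> (\<forall>g\<in>borel_measurable (F k). (\<forall>\<omega>. \<bar>g \<omega>\<bar> \<le> 1) \<longrightarrow> (\<integral>\<omega>. g \<omega> * w \<omega> \<partial>M) = 0)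
    \<and> cond_exp_le M (F k) (\<lambda>\<omega>. (w \<omega>)\<^sup>2) K
    \<and> cond_exp_le M (F k) (\<lambda>\<omega>. ((w \<omega>)\<^sup>2) powr (1 + d)) K
    \<and> (AE \<omega> in M. \<omega> \<in> B \<longrightarrow> w \<omega> = y \<omega> - real_cond_exp M (F k) y \<omega>)"
proof -
  interpret sigma_finite_subalgebra M "F k" by (rule sigma_finite_subalgebra_F)
  have yM: "y \<in> borel_measurable M" by (rule measurable_filtration[OF y])
  have B: "B \<in> sets (F k)"
  proof -
    have "{\<omega>\<in>space (F k). \<bar>X \<omega>\<bar> \<le> N \<and> C \<omega> \<le> N \<and> nn_cond_exp M (F k) (\<lambda>\<omega>. ennreal (\<bar>e \<omega>\<bar> powr p)) \<omega> \<le> ennreal N} \<in> sets (F k)"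
      using X C by measurable
    then show ?thesis by (simp add: B_def space_F)
  qed
  note BM = sets_F[OF B]
  define v where "v \<omega> = indicator B \<omega> * \<bar>e \<omega>\<bar>" for \<omega>
  define u where "u \<omega> = indicator B \<omega> * \<bar>e \<omega>\<bar> powr p" for \<omega>
  have vu: "v \<omega> powr p = u \<omega>" for \<omega> using p by (simp add: u_def v_def indicator_def)
  have v0: "0 \<le> v \<omega>" for \<omega> by (simp add: v_def)
  have um: "u \<in> borel_measurable M" unfolding u_def using BM e by measurable
  have u0: "0 \<le> u \<omega>" for \<omega> by (simp add: u_def)
  have nn_u: "(\<integral>\<^sup>+\<omega>. ennreal (g \<omega> * u \<omega>) \<partial>M) \<le> ennreal N * (\<integral>\<^sup>+\<omega>. ennreal (g \<omega>) \<partial>M)"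
    if g: "g \<in> borel_measurable (F k)" "\<And>\<omega>. 0 \<le> g \<omega>" for g
  proof -
    have gM: "g \<in> borel_measurable M" by (rule measurable_filtration[OF g(1)])
    have "(\<integral>\<^sup>+\<omega>. ennreal (g \<omega> * u \<omega>) \<partial>M) = (\<integral>\<^sup>+\<omega>. (ennreal (g \<omega>) * indicator B \<omega>) * ennreal (\<bar>e \<omega>\<bar> powr p) \<partial>M)"
      by (rule nn_integral_cong) (use g in \<open>auto simp: u_def indicator_def ennreal_mult\<close>)
    also have "\<dots> = (\<integral>\<^sup>+\<omega>. (ennreal (g \<omega>) * indicator B \<omega>) * nn_cond_exp M (F k) (\<lambda>\<omega>. ennreal (\<bar>e \<omega>\<bar> powr p)) \<omega> \<partial>M)"
      by (rule nn_cond_exp_intg[symmetric]) (use g B e in measurable)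
    also have "\<dots> \<le> (\<integral>\<^sup>+\<omega>. ennreal N * ennreal (g \<omega>) \<partial>M)"
      by (rule nn_integral_mono) (auto simp: B_def indicator_def mult.commute[of "ennreal N"] intro: mult_left_mono)
    also have "\<dots> = ennreal N * (\<integral>\<^sup>+\<omega>. ennreal (g \<omega>) \<partial>M)"
      by (rule nn_integral_cmult) (use gM in measurable)
    finally show ?thesis .
  qed
  have cu: "cond_exp_le M (F k) u N"
    unfolding cond_exp_le_def
  proof (intro conjI ballI impI)
    show ui: "integrable M u"
    proof (rule integrableI_nonneg[OF um])
      have "(\<integral>\<^sup>+\<omega>. ennreal (1 * u \<omega>) \<partial>M) \<le> ennreal N * (\<integral>\<^sup>+\<omega>. ennreal 1 \<partial>M)"
        by (rule nn_u) auto
      also have "\<dots> < \<infinity>" by (simp add: emeasure_space_1 ennreal_mult_less_top)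
      finally show "(\<integral>\<^sup>+\<omega>. ennreal (u \<omega>) \<partial>M) < \<infinity>" by simp
    qed (use u0 in auto)
    fix g :: "'a \<Rightarrow> real" assume g: "g \<in> borel_measurable (F k)" "\<forall>\<omega>. 0 \<le> g \<omega> \<and> g \<omega> \<le> 1"
    have gM: "g \<in> borel_measurable M" by (rule measurable_filtration[OF g(1)])
    have abs: "\<bar>g \<omega>\<bar> \<le> 1" for \<omega> using g(2) by auto
    have gi: "integrable M g" by (rule integrable_bounded[OF gM abs])
    have gu: "integrable M (\<lambda>\<omega>. g \<omega> * u \<omega>)" by (rule integrable_bounded_mult[OF ui gM abs])
    have "ennreal (\<integral>\<omega>. g \<omega> * u \<omega> \<partial>M) \<le> ennreal N * ennreal (\<integral>\<omega>. g \<omega> \<partial>M)"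
      using nn_u[OF g(1)] g(2) u0 by (simp add: nn_integral_eq_integral[OF gu] nn_integral_eq_integral[OF gi])
    then have "ennreal (\<integral>\<omega>. g \<omega> * u \<omega> \<partial>M) \<le> ennreal (N * (\<integral>\<omega>. g \<omega> \<partial>M))"
      using N g(2) by (simp add: ennreal_mult Bochner_Integration.integral_nonneg)
    then show "(\<integral>\<omega>. g \<omega> * u \<omega> \<partial>M) \<le> N * (\<integral>\<omega>. g \<omega> \<partial>M)"
      using N g(2) by (subst (asm) ennreal_le_iff) (auto intro!: mult_nonneg_nonneg Bochner_Integration.integral_nonneg)
  qed
  define z where "z \<omega> = indicator B \<omega> * y \<omega>" for \<omega>
  have zm: "z \<in> borel_measurable (F (Suc k))"
    unfolding z_def using B filt_mono[of k "Suc k"] y by (intro borel_measurable_times borel_measurable_indicator) auto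
  have zM: "z \<in> borel_measurable M" by (rule measurable_filtration[OF zm])
  have zv: "AE \<omega> in M. \<bar>z \<omega>\<bar> \<le> 2 * N + v \<omega>"
    using bound N by (auto simp: z_def v_def B_def indicator_def elim!: eventually_mono)
  \<comment> \<open>Passes from the moment of order \<open>p\<close>, the only one that
    \<open>B\<close> controls, to the first.\<close>
  have v1: "v \<omega> \<le> 1 + u \<omega>" for \<omega>
  proof (cases "v \<omega> \<le> 1")
    case False
    then have "v \<omega> powr 1 \<le> v \<omega> powr p" by (intro powr_mono) (use p in auto)
    then show ?thesis using False vu[of \<omega>] by simp
  qed (use u0[of \<omega>] in simp)
  have zu: "AE \<omega> in M. \<bar>z \<omega>\<bar> \<le> (2 * N + 1) + 1 * u \<omega>"
    using zv
  proof eventually_elim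
    case (elim \<omega>)
    then show ?case using v1[of \<omega>] by linarith
  qed
  have cz: "cond_exp_le M (F k) z (2 * N + 1 + 1 * N)" "cond_exp_le M (F k) (\<lambda>\<omega>. - z \<omega>) (2 * N + 1 + 1 * N)"
    by (rule cond_exp_le_dominated[OF cu]; use zu zM in simp)+
  have zi: "integrable M z" using cz(1) by (simp add: cond_exp_le_def)
  define E where "E = real_cond_exp M (F k) z"
  have Em: "E \<in> borel_measurable (F k)" by (simp add: E_def)
  \<comment> \<open>The bound \<open>2 * N + 1 + N\<close> of \<open>cz\<close> for \<open>z\<close>
    and for its negative; added to the \<open>2 * N\<close> of \<open>zv\<close> it produces the
    \<open>5 * N + 1\<close> in \<open>K\<close>.\<close>
  have Eb: "AE \<omega> in M. \<bar>E \<omega>\<bar> \<le> 3 * N + 1"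
  proof -
    have "AE \<omega> in M. real_cond_exp M (F k) (\<lambda>\<omega>. (- 1) * z \<omega>) \<omega> = (- 1) * real_cond_exp M (F k) z \<omega>"
      by (rule real_cond_exp_cmult[OF zi])
    with cz[THEN cond_exp_le_imp_real_cond_exp_le] show ?thesis
      by eventually_elim (simp add: E_def)
  qed
  define w where "w \<omega> = z \<omega> - E \<omega>" for \<omega>
  have wm: "w \<in> borel_measurable (F (Suc k))"
    unfolding w_def by (intro borel_measurable_diff zm measurable_filtration_mono[OF _ Em]) simp
  have wM: "w \<in> borel_measurable M" by (rule measurable_filtration[OF wm])
  have wv: "AE \<omega> in M. \<bar>w \<omega>\<bar> \<le> 5 * N + 1 + v \<omega>"
    using zv Eb by eventually_elim (simp add: w_def)
  \<comment> \<open>\<open>c + v\<close> is at least 1, so the exponent may be raised from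
    \<open>q\<close> to \<open>p\<close>; the factor \<open>2 powr p\<close> comes from
    \<open>c + v \<le> 2 * max c v\<close>.\<close>
  have pow: "AE \<omega> in M. \<bar>w \<omega>\<bar> powr q \<le> 2 powr p * (5 * N + 1) powr p + 2 powr p * u \<omega>" if q: "0 \<le> q" "q \<le> p" for q
    using wv
  proof eventually_elim
    case (elim \<omega>)
    define c where "c = 5 * N + 1"
    have c: "1 \<le> c" using N by (simp add: c_def)
    have "\<bar>w \<omega>\<bar> powr q \<le> (c + v \<omega>) powr q"
      using elim q by (intro powr_mono2) (auto simp: c_def)
    also have "\<dots> \<le> (c + v \<omega>) powr p" using c v0[of \<omega>] q by (intro powr_mono) auto
    also have "\<dots> \<le> (2 * max c (v \<omega>)) powr p" using c v0[of \<omega>] p by (intro powr_mono2) auto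
    also have "\<dots> = 2 powr p * max c (v \<omega>) powr p" using c by (subst powr_mult) auto
    also have "\<dots> \<le> 2 powr p * (c powr p + v \<omega> powr p)"
      by (intro mult_left_mono) (auto simp: max_def)
    finally show ?case by (simp add: vu c_def distrib_left)
  qed
  have mds: "(\<integral>\<omega>. g \<omega> * w \<omega> \<partial>M) = 0" if g: "g \<in> borel_measurable (F k)" "\<And>\<omega>. \<bar>g \<omega>\<bar> \<le> 1" for g :: "'a \<Rightarrow> real"
  proof -
    have gz: "integrable M (\<lambda>\<omega>. g \<omega> * z \<omega>)"
      by (rule integrable_bounded_mult[OF zi measurable_filtration[OF g(1)] g(2)])
    have "integrable M (\<lambda>\<omega>. g \<omega> * E \<omega>)" "(\<integral>\<omega>. g \<omega> * E \<omega> \<partial>M) = (\<integral>\<omega>. g \<omega> * z \<omega> \<partial>M)"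
      unfolding E_def using real_cond_exp_intg[OF gz g(1)] zM by auto
    then show ?thesis using gz by (simp add: w_def right_diff_distrib)
  qed
  have K: "K = 2 powr p * (5 * N + 1) powr p + 2 powr p * N" by (simp add: K_def distrib_left)
  have "AE \<omega> in M. \<bar>(w \<omega>)\<^sup>2\<bar> \<le> 2 powr p * (5 * N + 1) powr p + 2 powr p * u \<omega>"
    using pow[of 2] p by (auto simp: powr_numeral elim!: eventually_mono)
  then have c2: "cond_exp_le M (F k) (\<lambda>\<omega>. (w \<omega>)\<^sup>2) K"
    unfolding K by (intro cond_exp_le_dominated[OF cu]) (use wM in auto)
  have "AE \<omega> in M. \<bar>((w \<omega>)\<^sup>2) powr (1 + d)\<bar> \<le> 2 powr p * (5 * N + 1) powr p + 2 powr p * u \<omega>"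
  proof -
    have "((w \<omega>)\<^sup>2) powr (1 + d) = \<bar>w \<omega>\<bar> powr (2 + 2 * d)" for \<omega>
    proof -
      have "(w \<omega>)\<^sup>2 = \<bar>w \<omega>\<bar> powr 2" by (simp add: powr_numeral)
      then show ?thesis by (simp only: powr_powr) (simp add: distrib_left)
    qed
    then show ?thesis using pow[of "2 + 2 * d"] p by simp
  qed
  then have cp: "cond_exp_le M (F k) (\<lambda>\<omega>. ((w \<omega>)\<^sup>2) powr (1 + d)) K"
    unfolding K by (intro cond_exp_le_dominated[OF cu]) (use wM in auto)
  have "AE \<omega> in M. \<omega> \<in> B \<longrightarrow> w \<omega> = y \<omega> - real_cond_exp M (F k) y \<omega>"
    using cond_exp_indicator_localise[OF B yM]
    by eventually_elim (auto simp: w_def E_def z_def[abs_def])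
  then show ?thesis using wm mds c2 cp by blast
qed

end

section \<open>Adaptedness of the estimates\<close>

lemma continuous_on_matrix_vector_mult:
  fixes f :: "'a::topological_space \<Rightarrow> real^'n^'m" and g :: "'a \<Rightarrow> real^'n"
  assumes "continuous_on S f" "continuous_on S g"
  shows "continuous_on S (\<lambda>x. f x *v g x)"
  unfolding matrix_vector_mult_def
  by (intro continuous_intros continuous_on_vec_lambda assms)

lemma continuous_on_matrix_matrix_mult:
  fixes f :: "'a::topological_space \<Rightarrow> real^'n^'m" and g :: "'a \<Rightarrow> real^'p^'n"
  assumes "continuous_on S f" "continuous_on S g"
  shows "continuous_on S (\<lambda>x. f x ** g x)"
  unfolding matrix_matrix_mult_def
  by (intro continuous_intros continuous_on_vec_lambda assms)

lemma continuous_on_outer: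
  assumes "continuous_on S f" "continuous_on S g"
  shows "continuous_on S (\<lambda>x. outer (f x) (g x))"
  unfolding outer_def
  by (intro continuous_intros continuous_on_vec_lambda assms)

lemma measurable_matrix_vector_mult:
  fixes f :: "'a \<Rightarrow> real^'n^'m" and g :: "'a \<Rightarrow> real^'n"
  assumes "f \<in> borel_measurable N" "g \<in> borel_measurable N"
  shows "(\<lambda>x. f x *v g x) \<in> borel_measurable N"
  by (rule borel_measurable_continuous_Pair[OF assms])
     (intro continuous_on_matrix_vector_mult continuous_intros)

lemma measurable_matrix_matrix_mult:
  fixes f :: "'a \<Rightarrow> real^'n^'m" and g :: "'a \<Rightarrow> real^'p^'n"
  assumes "f \<in> borel_measurable N" "g \<in> borel_measurable N"
  shows "(\<lambda>x. f x ** g x) \<in> borel_measurable N"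
  by (rule borel_measurable_continuous_Pair[OF assms])
     (intro continuous_on_matrix_matrix_mult continuous_intros)

lemma measurable_outer:
  fixes f g :: "'a \<Rightarrow> real^'n"
  assumes "f \<in> borel_measurable N" "g \<in> borel_measurable N"
  shows "(\<lambda>x. outer (f x) (g x)) \<in> borel_measurable N"
  by (rule borel_measurable_continuous_Pair[OF assms])
     (intro continuous_on_outer continuous_intros)

text \<open>Closed graph theorem for maps into a compact set. Minimality against a fixed
  \<open>z\<close> is a closed condition on weight, point and candidate together, and uniqueness of
  the minimiser, which relies on positive definiteness, says that these conditions cut out exactly
  the graph.\<close>

lemma continuous_on_projQ:
  fixes D :: "(real^'n) set"
  assumes D: "convex D" "compact D" "D \<noteq> {}"
  shows "continuous_on {Qx. pos_def (fst Qx)} (\<lambda>Qx. projQ (fst Qx) D (snd Qx))"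
proof -
  define S where "S = {Qx :: (real^'n^'n) \<times> (real^'n). pos_def (fst Qx)}"
  define f where "f Qx = projQ (fst Qx) D (snd Qx)" for Qx
  define A where "A z = {t :: ((real^'n^'n) \<times> (real^'n)) \<times> (real^'n). qnorm (fst (fst t)) (snd (fst t) - snd t) \<le> qnorm (fst (fst t)) (snd (fst t) - z)}" for z
  have clA: "closed (A z)" for z
    unfolding A_def qnorm_def
    by (intro closed_Collect_le continuous_intros continuous_on_matrix_vector_mult)
  have graph: "(\<lambda>x. (x, f x)) ` S = (S \<times> D) \<inter> (\<Inter>z\<in>D. A z)"
  proof (intro equalityI subsetI)
    fix t assume "t \<in> (\<lambda>x. (x, f x)) ` S"
    then show "t \<in> (S \<times> D) \<inter> (\<Inter>z\<in>D. A z)"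
      using projQ_in[OF D(2,3)] projQ_min[OF D(2,3)] by (auto simp: f_def A_def)
  next
    fix t assume t: "t \<in> (S \<times> D) \<inter> (\<Inter>z\<in>D. A z)"
    obtain Q x p where tq: "t = ((Q, x), p)" by (metis prod.collapse)
    have Q: "pos_def Q" using t by (simp add: tq S_def)
    have "p = projQ Q D x"
      by (rule projection_unique[OF Q D(1) _ projQ_in[OF D(2,3)] _ projQ_min[OF D(2,3)]])
         (use t in \<open>auto simp: tq A_def\<close>)
    then show "t \<in> (\<lambda>x. (x, f x)) ` S" using t by (auto simp: tq f_def)
  qed
  have "closedin (top_of_set (S \<times> D)) ((S \<times> D) \<inter> (\<Inter>z\<in>D. A z))"
    by (rule closedin_closed_Int) (use clA in auto)
  then have cl: "closedin (top_of_set (S \<times> D)) ((\<lambda>x. (x, f x)) ` S)"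
    by (simp only: graph)
  have "f \<in> S \<rightarrow> D" using projQ_in[OF D(2,3)] by (auto simp: f_def)
  from continuous_closed_graph_eq[OF D(2) this] cl have "continuous_on S f" by (rule iffD2)
  then show ?thesis unfolding S_def f_def .
qed

text \<open>Density turns an uncountable infimum into a countable one, which is measurable.\<close>

lemma INF_rat_eq_Inf_range:
  fixes f :: "real \<Rightarrow> real"
  assumes c: "continuous_on UNIV f" and b: "bdd_below (range f)"
  shows "(INF q::rat. f (of_rat q)) = Inf (range f)"
proof (rule antisym)
  have b': "bdd_below (range (\<lambda>q::rat. f (of_rat q)))"
    by (rule bdd_below_mono[OF b]) auto
  show "(INF q::rat. f (of_rat q)) \<le> Inf (range f)"
  proof (rule cInf_greatest)
    fix v assume "v \<in> range f"
    then obtain x where x: "v = f x" by blast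
    show "(INF q::rat. f (of_rat q)) \<le> v"
    proof (rule ccontr)
      assume "\<not> ?thesis"
      then have "0 < (INF q::rat. f (of_rat q)) - f x" by (simp add: x)
      moreover have "isCont f x" using c by (simp add: continuous_on_eq_continuous_at)
      ultimately obtain d where d: "0 < d" "\<And>y. dist y x < d \<Longrightarrow> dist (f y) (f x) < (INF q::rat. f (of_rat q)) - f x"
        unfolding continuous_at_eps_delta by metis
      obtain q where q: "x < of_rat q" "of_rat q < x + d" using of_rat_dense[of x "x + d"] d(1) by auto
      then have "f (of_rat q) < (INF q::rat. f (of_rat q))" using d(2)[of "of_rat q"] by (auto simp: dist_real_def)
      moreover have "(INF q::rat. f (of_rat q)) \<le> f (of_rat q)" by (rule cINF_lower[OF b']) simp
      ultimately show False by simp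
    qed
  qed simp
  show "Inf (range f) \<le> (INF q::rat. f (of_rat q))"
    by (rule cInf_superset_mono[OF _ b]) auto
qed

section \<open>The completed filtration and adaptedness with respect to it\<close>

context filtered_prob_space
begin

text \<open>The filtration completed by the null sets of \<open>M\<close>; the regression function \<open>G\<close> and hence the
  estimates are adapted to it only, as \<open>G\<close> is continuous merely almost surely.\<close>

definition Fc :: "nat \<Rightarrow> 'a measure" where
  "Fc k = sigma (space M) {A. A \<subseteq> space M \<and> (\<exists>B\<in>sets (F k). AE \<omega> in M. \<omega> \<in> A \<longleftrightarrow> \<omega> \<in> B)}"

lemma space_Fc [simp]: "space (Fc k) = space M"
  by (simp add: Fc_def space_measure_of_conv)

lemma sets_Fc: "sets (Fc k) = {A. A \<subseteq> space M \<and> (\<exists>B\<in>sets (F k). AE \<omega> in M. \<omega> \<in> A \<longleftrightarrow> \<omega> \<in> B)}"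
  (is "_ = ?S")
proof -
  have "sigma_algebra (space M) ?S"
    unfolding sigma_algebra_iff2
  proof (intro conjI ballI allI impI)
    show "{} \<in> ?S" by (auto intro!: bexI[of _ "{}"])
  next
    fix A assume "A \<in> ?S"
    then obtain B where B: "B \<in> sets (F k)" "AE \<omega> in M. \<omega> \<in> A \<longleftrightarrow> \<omega> \<in> B" by blast
    have "AE \<omega> in M. \<omega> \<in> space M - A \<longleftrightarrow> \<omega> \<in> space M - B" using B(2) by eventually_elim auto
    moreover have "space M - B \<in> sets (F k)" using B(1) sets.compl_sets[of B "F k"] by (simp add: space_F)
    ultimately show "space M - A \<in> ?S" by blast
  next
    fix A :: "nat \<Rightarrow> 'a set" assume A: "range A \<subseteq> ?S"
    then have "\<forall>i. \<exists>B\<in>sets (F k). AE \<omega> in M. \<omega> \<in> A i \<longleftrightarrow> \<omega> \<in> B" by blast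
    then obtain B where B: "\<And>i. B i \<in> sets (F k)" "\<And>i. AE \<omega> in M. \<omega> \<in> A i \<longleftrightarrow> \<omega> \<in> B i" by metis
    have "AE \<omega> in M. \<forall>i. \<omega> \<in> A i \<longleftrightarrow> \<omega> \<in> B i" unfolding AE_all_countable by (intro allI B(2))
    then have "AE \<omega> in M. \<omega> \<in> (\<Union>i. A i) \<longleftrightarrow> \<omega> \<in> (\<Union>i. B i)" by eventually_elim auto
    moreover have "(\<Union>i. B i) \<in> sets (F k)" using B(1) by blast
    ultimately show "(\<Union>i. A i) \<in> ?S" using A by blast
  qed auto
  then show ?thesis unfolding Fc_def by (rule sigma_algebra.sets_measure_of_eq)
qed

lemma measurable_Fc: "f \<in> measurable (F k) N \<Longrightarrow> f \<in> measurable (Fc k) N"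
proof -
  have "sets (F k) \<subseteq> sets (Fc k)"
    unfolding sets_Fc using sets.sets_into_space[of _ "F k"] by (auto simp: space_F)
  then show "f \<in> measurable (F k) N \<Longrightarrow> f \<in> measurable (Fc k) N"
    unfolding measurable_def by (auto simp: space_F)
qed

lemma measurable_Fc_mono: "i \<le> j \<Longrightarrow> f \<in> measurable (Fc i) N \<Longrightarrow> f \<in> measurable (Fc j) N"
proof -
  assume ij: "i \<le> j"
  have "sets (Fc i) \<subseteq> sets (Fc j)"
    unfolding sets_Fc using filt_mono[OF ij] by blast
  then show "f \<in> measurable (Fc i) N \<Longrightarrow> f \<in> measurable (Fc j) N"
    unfolding measurable_def by auto
qed

text \<open>The point of the completion: identities and limits that hold only almost surely still
  yield measurability.\<close>

lemma measurable_Fc_AE_cong: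
  assumes f: "f \<in> borel_measurable (Fc k)" and eq: "AE \<omega> in M. f \<omega> = g \<omega>"
  shows "g \<in> borel_measurable (Fc k)"
proof (rule measurableI)
  fix S :: "'b set" assume S: "S \<in> sets borel"
  have "f -` S \<inter> space (Fc k) \<in> sets (Fc k)" by (rule measurable_sets[OF f S])
  then obtain B where B: "B \<in> sets (F k)" "AE \<omega> in M. \<omega> \<in> f -` S \<inter> space (Fc k) \<longleftrightarrow> \<omega> \<in> B"
    unfolding sets_Fc by blast
  have "AE \<omega> in M. \<omega> \<in> g -` S \<inter> space (Fc k) \<longleftrightarrow> \<omega> \<in> B"
    using B(2) eq by eventually_elim auto
  then show "g -` S \<inter> space (Fc k) \<in> sets (Fc k)" unfolding sets_Fc using B(1) by auto
qed auto

lemma measurable_Fc_AE_lim: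
  fixes f :: "nat \<Rightarrow> 'a \<Rightarrow> real"
  assumes f: "\<And>n. f n \<in> borel_measurable (Fc k)" and lim: "AE \<omega> in M. (\<lambda>n. f n \<omega>) \<longlonglongrightarrow> g \<omega>"
  shows "g \<in> borel_measurable (Fc k)"
proof (rule measurable_Fc_AE_cong)
  show "(\<lambda>\<omega>. lim (\<lambda>n. f n \<omega>)) \<in> borel_measurable (Fc k)" by (rule borel_measurable_lim_metric[OF f])
  show "AE \<omega> in M. lim (\<lambda>n. f n \<omega>) = g \<omega>" using lim by eventually_elim (rule limI)
qed

text \<open>The way back: the martingale estimates are stated for \<open>F\<close>, so coefficients
  measurable for \<open>Fc\<close> are exchanged for versions there. Nonnegative functions are built
  up from indicators, and the general case uses positive and negative parts.\<close>

lemma measurable_Fc_version: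
  fixes f :: "'a \<Rightarrow> real"
  assumes "f \<in> borel_measurable (Fc k)"
  shows "\<exists>g\<in>borel_measurable (F k). AE \<omega> in M. f \<omega> = g \<omega>"
proof -
  have *: "\<exists>g\<in>borel_measurable (F k). AE \<omega> in M. f \<omega> = g \<omega>"
    if "f \<in> borel_measurable (Fc k)" "\<And>\<omega>. 0 \<le> f \<omega>" for f :: "'a \<Rightarrow> real"
    using that
  proof (induction rule: borel_measurable_induct_real)
    case (set A)
    then obtain B where B: "B \<in> sets (F k)" "AE \<omega> in M. \<omega> \<in> A \<longleftrightarrow> \<omega> \<in> B" unfolding sets_Fc by blast
    have "AE \<omega> in M. (indicator A \<omega> :: real) = indicator B \<omega>"
      using B(2) by eventually_elim (auto simp: indicator_def)
    then show ?case using B(1) by (intro bexI[of _ "indicator B"]) auto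
  next
    case (mult u c)
    then obtain g where g: "g \<in> borel_measurable (F k)" "AE \<omega> in M. u \<omega> = g \<omega>" by blast
    then show ?case by (intro bexI[of _ "\<lambda>\<omega>. c * g \<omega>"]) auto
  next
    case (add u v)
    then obtain g h where g: "g \<in> borel_measurable (F k)" "AE \<omega> in M. u \<omega> = g \<omega>"
      and h: "h \<in> borel_measurable (F k)" "AE \<omega> in M. v \<omega> = h \<omega>" by blast
    have "AE \<omega> in M. v \<omega> + u \<omega> = h \<omega> + g \<omega>" using g(2) h(2) by eventually_elim auto
    then show ?case using g(1) h(1) by (intro bexI[of _ "\<lambda>\<omega>. h \<omega> + g \<omega>"]) auto
  next
    case (seq U)
    have conv: "(\<lambda>i. U i \<omega>) \<longlonglongrightarrow> f \<omega>" if "\<omega> \<in> space (Fc k)" for \<omega> by (rule seq) (rule that)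
    have "\<forall>i. \<exists>g\<in>borel_measurable (F k). AE \<omega> in M. U i \<omega> = g \<omega>" using seq by blast
    then obtain g where g: "\<And>i. g i \<in> borel_measurable (F k)" "\<And>i. AE \<omega> in M. U i \<omega> = g i \<omega>" by metis
    have "AE \<omega> in M. \<forall>i. U i \<omega> = g i \<omega>" unfolding AE_all_countable using g(2) by blast
    with AE_space have lim: "AE \<omega> in M. f \<omega> = lim (\<lambda>i. g i \<omega>)"
    proof eventually_elim
      case (elim \<omega>)
      then have "(\<lambda>i. g i \<omega>) \<longlonglongrightarrow> f \<omega>" using conv[of \<omega>] by simp
      then show ?case by (simp add: limI)
    qed
    show ?case
    proof (rule bexI)
      show "AE \<omega> in M. f \<omega> = lim (\<lambda>i. g i \<omega>)" by (rule lim)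
      show "(\<lambda>\<omega>. lim (\<lambda>i. g i \<omega>)) \<in> borel_measurable (F k)" by (rule borel_measurable_lim_metric[OF g(1)])
    qed
  qed
  have "\<exists>g\<in>borel_measurable (F k). AE \<omega> in M. max 0 (f \<omega>) = g \<omega>"
    by (rule *) (use assms in simp_all)
  then obtain g where g: "g \<in> borel_measurable (F k)" "AE \<omega> in M. max 0 (f \<omega>) = g \<omega>" by (elim bexE)
  have "\<exists>g\<in>borel_measurable (F k). AE \<omega> in M. max 0 (- f \<omega>) = g \<omega>"
    by (rule *) (use assms in simp_all)
  then obtain h where h: "h \<in> borel_measurable (F k)" "AE \<omega> in M. max 0 (- f \<omega>) = h \<omega>" by (elim bexE)
  have "AE \<omega> in M. f \<omega> = g \<omega> - h \<omega>" using g(2) h(2) by eventually_elim auto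
  then show ?thesis using g(1) h(1) by (intro bexI[of _ "\<lambda>\<omega>. g \<omega> - h \<omega>"]) auto
qed

text \<open>Rounded down to a grid, \<open>X\<close> takes countably many values, for each of which
  \<open>H\<close> is measurable; continuity passes to the limit as the mesh shrinks.\<close>

lemma measurable_Fc_caratheodory:
  fixes H :: "'a \<Rightarrow> real \<Rightarrow> real"
  assumes H: "\<And>x. (\<lambda>\<omega>. H \<omega> x) \<in> borel_measurable (Fc k)"
    and cont: "AE \<omega> in M. \<forall>x. isCont (H \<omega>) x" and X: "X \<in> borel_measurable (Fc k)"
  shows "(\<lambda>\<omega>. H \<omega> (X \<omega>)) \<in> borel_measurable (Fc k)"
proof (rule measurable_Fc_AE_lim)
  define x where "x n \<omega> = real_of_int \<lfloor>real (Suc n) * X \<omega>\<rfloor> / real (Suc n)" for n \<omega>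
  show "(\<lambda>\<omega>. H \<omega> (x n \<omega>)) \<in> borel_measurable (Fc k)" for n
    unfolding x_def
    by (rule measurable_compose_countable[where f="\<lambda>i \<omega>. H \<omega> (real_of_int i / real (Suc n))" and g="\<lambda>\<omega>. \<lfloor>real (Suc n) * X \<omega>\<rfloor>"])
       (use H X in measurable)
  have "(\<lambda>n. x n \<omega>) \<longlonglongrightarrow> X \<omega>" for \<omega>
  proof (rule Lim_null_comparison[THEN LIM_zero_cancel])
    show "\<forall>\<^sub>F n in sequentially. norm (x n \<omega> - X \<omega>) \<le> 1 / real (Suc n)"
    proof (rule always_eventually, rule allI)
      fix n
      have "\<bar>real_of_int \<lfloor>real (Suc n) * X \<omega>\<rfloor> - real (Suc n) * X \<omega>\<bar> \<le> 1" by linarith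
      then have "\<bar>real_of_int \<lfloor>real (Suc n) * X \<omega>\<rfloor> - real (Suc n) * X \<omega>\<bar> / real (Suc n) \<le> 1 / real (Suc n)"
        by (rule divide_right_mono) simp
      also have "\<bar>real_of_int \<lfloor>real (Suc n) * X \<omega>\<rfloor> - real (Suc n) * X \<omega>\<bar> / real (Suc n) = norm (x n \<omega> - X \<omega>)"
        unfolding x_def real_norm_def by (subst abs_div_pos) (auto simp: diff_divide_distrib simp del: of_nat_Suc)
      finally show "norm (x n \<omega> - X \<omega>) \<le> 1 / real (Suc n)" .
    qed
    show "(\<lambda>n. 1 / real (Suc n)) \<longlonglongrightarrow> 0" by (rule LIMSEQ_Suc[OF lim_const_over_n])
  qed
  note lim = this
  show "AE \<omega> in M. (\<lambda>n. H \<omega> (x n \<omega>)) \<longlonglongrightarrow> H \<omega> (X \<omega>)"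
    using cont
  proof eventually_elim
    case (elim \<omega>)
    then have "isCont (H \<omega>) (X \<omega>)" by blast
    then show ?case by (rule isCont_tendsto_compose[OF _ lim])
  qed
qed

text \<open>Difference quotients carry measurability from \<open>H\<close> over to its derivative,
  for which none is assumed.\<close>

lemma measurable_Fc_derivative:
  fixes H H' :: "'a \<Rightarrow> real \<Rightarrow> real"
  assumes H: "\<And>x. (\<lambda>\<omega>. H \<omega> x) \<in> borel_measurable (Fc k)"
    and der: "AE \<omega> in M. \<forall>x. (H \<omega> has_real_derivative H' \<omega> x) (at x)" and X: "X \<in> borel_measurable (Fc k)"
  shows "(\<lambda>\<omega>. H' \<omega> (X \<omega>)) \<in> borel_measurable (Fc k)"
proof (rule measurable_Fc_AE_lim)
  define h where "h n = 1 / real (Suc n)" for n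
  have cont: "AE \<omega> in M. \<forall>x. isCont (H \<omega>) x" using der by eventually_elim (auto intro: DERIV_isCont)
  show "(\<lambda>\<omega>. (H \<omega> (X \<omega> + h n) - H \<omega> (X \<omega>)) / h n) \<in> borel_measurable (Fc k)" for n
    by (intro borel_measurable_divide borel_measurable_diff measurable_Fc_caratheodory[OF H cont] borel_measurable_add X) auto
  have h0: "filterlim h (at 0) sequentially"
  proof -
    have "h \<longlonglongrightarrow> 0" unfolding h_def by (rule LIMSEQ_Suc[OF lim_const_over_n])
    then show ?thesis unfolding filterlim_at by (simp add: h_def)
  qed
  show "AE \<omega> in M. (\<lambda>n. (H \<omega> (X \<omega> + h n) - H \<omega> (X \<omega>)) / h n) \<longlonglongrightarrow> H' \<omega> (X \<omega>)"
    using der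
  proof eventually_elim
    case (elim \<omega>)
    then have "((\<lambda>t. (H \<omega> (X \<omega> + t) - H \<omega> (X \<omega>)) / t) \<longlongrightarrow> H' \<omega> (X \<omega>)) (at 0)"
      by (simp add: DERIV_def)
    then show ?case by (rule filterlim_compose[OF _ h0])
  qed
qed

text \<open>Clamping rationals to the random interval turns an infimum over a moving set into one
  over a fixed countable index set.\<close>

lemma measurable_Fc_Inf:
  fixes H :: "'a \<Rightarrow> real \<Rightarrow> real"
  assumes H: "\<And>X. X \<in> borel_measurable (Fc k) \<Longrightarrow> (\<lambda>\<omega>. H \<omega> (X \<omega>)) \<in> borel_measurable (Fc k)"
    and m: "m \<in> borel_measurable (Fc k)"
    and cont: "AE \<omega> in M. 0 \<le> m \<omega> \<and> continuous_on {- m \<omega> .. m \<omega>} (H \<omega>)"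
  shows "(\<lambda>\<omega>. Inf (H \<omega> ` {- m \<omega> .. m \<omega>})) \<in> borel_measurable (Fc k)"
proof (rule measurable_Fc_AE_cong)
  define f where "f q \<omega> = H \<omega> (max (- m \<omega>) (min (m \<omega>) (of_rat q)))" for q :: rat and \<omega>
  have f: "f q \<in> borel_measurable (Fc k)" for q
    unfolding f_def by (rule H) (use m in simp)
  have "(\<lambda>\<omega>. INF q. f q \<omega>) \<in> borel_measurable (Fc k)"
    by (rule borel_measurable_cINF_real) (simp_all add: f)
  then show "(\<lambda>\<omega>. INF q::rat. H \<omega> (max (- m \<omega>) (min (m \<omega>) (of_rat q)))) \<in> borel_measurable (Fc k)"
    by (simp only: f_def)
  show "AE \<omega> in M. (INF q::rat. H \<omega> (max (- m \<omega>) (min (m \<omega>) (of_rat q)))) = Inf (H \<omega> ` {- m \<omega> .. m \<omega>})"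
    using cont
  proof eventually_elim
    case (elim \<omega>)
    define c where "c x = max (- m \<omega>) (min (m \<omega>) x)" for x
    have rc: "range c = {- m \<omega> .. m \<omega>}"
    proof (intro equalityI subsetI)
      fix x assume x: "x \<in> {- m \<omega> .. m \<omega>}"
      then have "x = c x" by (auto simp: c_def)
      then show "x \<in> range c" by blast
    qed (use elim in \<open>auto simp: c_def\<close>)
    have cH: "continuous_on UNIV (\<lambda>x. H \<omega> (c x))"
    proof (rule continuous_on_compose2[where g="H \<omega>" and f=c and t="{- m \<omega> .. m \<omega>}"])
      show "continuous_on {- m \<omega> .. m \<omega>} (H \<omega>)" using elim by blast
      show "continuous_on UNIV c" unfolding c_def by (intro continuous_intros)
      show "c ` UNIV \<subseteq> {- m \<omega> .. m \<omega>}" by (simp only: rc order_refl)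
    qed
    have rH: "range (\<lambda>x. H \<omega> (c x)) = H \<omega> ` {- m \<omega> .. m \<omega>}" unfolding rc[symmetric] image_image ..
    have "bdd_below (H \<omega> ` {- m \<omega> .. m \<omega>})"
      by (intro bounded_imp_bdd_below compact_imp_bounded compact_continuous_image) (use elim in auto)
    then have "(INF q::rat. H \<omega> (c (of_rat q))) = Inf (range (\<lambda>x. H \<omega> (c x)))"
      by (intro INF_rat_eq_Inf_range[OF cH]) (simp only: rH)
    then have "(INF q::rat. H \<omega> (c (of_rat q))) = Inf (H \<omega> ` {- m \<omega> .. m \<omega>})"
      by (simp only: rH)
    then show ?case by (simp only: c_def)
  qed
qed

lemma measurable_Fc_Sup:
  fixes H :: "'a \<Rightarrow> real \<Rightarrow> real"
  assumes H: "\<And>X. X \<in> borel_measurable (Fc k) \<Longrightarrow> (\<lambda>\<omega>. H \<omega> (X \<omega>)) \<in> borel_measurable (Fc k)"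
    and m: "m \<in> borel_measurable (Fc k)"
    and cont: "AE \<omega> in M. 0 \<le> m \<omega> \<and> continuous_on {- m \<omega> .. m \<omega>} (H \<omega>)"
  shows "(\<lambda>\<omega>. Sup (H \<omega> ` {- m \<omega> .. m \<omega>})) \<in> borel_measurable (Fc k)"
proof -
  have "(\<lambda>\<omega>. Inf ((\<lambda>x. - H \<omega> x) ` {- m \<omega> .. m \<omega>})) \<in> borel_measurable (Fc k)"
  proof (rule measurable_Fc_Inf[OF _ m])
    show "(\<lambda>\<omega>. - H \<omega> (X \<omega>)) \<in> borel_measurable (Fc k)" if "X \<in> borel_measurable (Fc k)" for X
      by (rule borel_measurable_uminus[OF H[OF that]])
    show "AE \<omega> in M. 0 \<le> m \<omega> \<and> continuous_on {- m \<omega> .. m \<omega>} (\<lambda>x. - H \<omega> x)"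
      using cont by eventually_elim (auto intro: continuous_on_minus)
  qed
  from borel_measurable_uminus[OF this]
  have "(\<lambda>\<omega>. - Inf ((\<lambda>x. - H \<omega> x) ` {- m \<omega> .. m \<omega>})) \<in> borel_measurable (Fc k)" .
  moreover have "- Inf ((\<lambda>x. - H \<omega> x) ` {- m \<omega> .. m \<omega>}) = Sup (H \<omega> ` {- m \<omega> .. m \<omega>})" for \<omega>
    unfolding Inf_real_def image_image minus_minus ..
  ultimately show ?thesis by (simp only:)
qed

lemma measurable_Fc_projQ:
  fixes D :: "(real^'n) set" and Q :: "'a \<Rightarrow> real^'n^'n" and x :: "'a \<Rightarrow> real^'n"
  assumes D: "convex D" "compact D" "D \<noteq> {}"
    and Q: "Q \<in> borel_measurable (Fc k)" and pd: "AE \<omega> in M. pos_def (Q \<omega>)" and x: "x \<in> borel_measurable (Fc k)"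
  shows "(\<lambda>\<omega>. projQ (Q \<omega>) D (x \<omega>)) \<in> borel_measurable (Fc k)"
proof (rule measurable_Fc_AE_cong)
  \<comment> \<open>Continuity of the projection is known at positive definite weights only; the
    identity matrix fills the exceptional null set.\<close>
  define Q' where "Q' \<omega> = (if pos_def (Q \<omega>) then Q \<omega> else mat 1)" for \<omega>
  have eq: "AE \<omega> in M. Q \<omega> = Q' \<omega>" using pd by eventually_elim (simp add: Q'_def)
  have Q'm: "Q' \<in> borel_measurable (Fc k)" by (rule measurable_Fc_AE_cong[OF Q eq])
  have pd1: "pos_def (mat 1 :: real^'n^'n)" by (simp add: pos_def_def transpose_mat)
  define S where "S = {Qx :: (real^'n^'n) \<times> (real^'n). pos_def (fst Qx)}"
  have m1: "(\<lambda>\<omega>. (Q' \<omega>, x \<omega>)) \<in> measurable (Fc k) (restrict_space borel S)"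
    by (rule measurable_restrict_space2)
       (use borel_measurable_Pair[OF Q'm x] pd1 in \<open>auto simp: S_def Q'_def\<close>)
  have m2: "(\<lambda>Qx. projQ (fst Qx) D (snd Qx)) \<in> borel_measurable (restrict_space borel S)"
    unfolding S_def by (rule borel_measurable_continuous_on_restrict[OF continuous_on_projQ[OF D]])
  show "(\<lambda>\<omega>. projQ (Q' \<omega>) D (x \<omega>)) \<in> borel_measurable (Fc k)"
    using measurable_compose[OF m1 m2] by simp
  show "AE \<omega> in M. projQ (Q' \<omega>) D (x \<omega>) = projQ (Q \<omega>) D (x \<omega>)" using eq by eventually_elim simp
qed

text \<open>By Sherman--Morrison the inverse covariances are explicit sums, which avoids the measurability
  of \<open>matrix_inv\<close>.\<close>

lemma quasi_newton_measurable:
  fixes D :: "(real^'n) set" and phi th :: "nat \<Rightarrow> 'a \<Rightarrow> real^'n" and P :: "nat \<Rightarrow> 'a \<Rightarrow> real^'n^'n"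
    and b mu r s a :: "nat \<Rightarrow> 'a \<Rightarrow> real"
  assumes D: "convex D" "compact D" "D \<noteq> {}"
    and qn: "AE \<omega> in M. quasi_newton D (\<lambda>k. phi k \<omega>) (\<lambda>k. b k \<omega>) (\<lambda>k. mu k \<omega>) (\<lambda>k. r k \<omega>)
       (\<lambda>k. th k \<omega>) (\<lambda>k. P k \<omega>) (\<lambda>k. s k \<omega>) (\<lambda>k. a k \<omega>)"
    and th0: "\<And>\<omega>. th 0 \<omega> = t0" and P0: "\<And>\<omega>. P 0 \<omega> = p0"
    and phi: "\<And>k. phi k \<in> borel_measurable (Fc k)" and mu: "\<And>k. mu k \<in> borel_measurable (Fc k)"
    and b: "\<And>k. th k \<in> borel_measurable (Fc k) \<Longrightarrow> P k \<in> borel_measurable (Fc k) \<Longrightarrow> b k \<in> borel_measurable (Fc k)"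
    and r: "\<And>k. th k \<in> borel_measurable (Fc k) \<Longrightarrow> r k \<in> borel_measurable (Fc (Suc k))"
  shows "th k \<in> borel_measurable (Fc k)" "P k \<in> borel_measurable (Fc k)"
    "s k \<in> borel_measurable (Fc k)" "a k \<in> borel_measurable (Fc k)" "b k \<in> borel_measurable (Fc k)"
proof -
  have sa: "s k \<in> borel_measurable (Fc k) \<and> b k \<in> borel_measurable (Fc k) \<and> a k \<in> borel_measurable (Fc k)"
    if m: "th k \<in> borel_measurable (Fc k)" "P k \<in> borel_measurable (Fc k)" for k
  proof -
    have 1: "(\<lambda>\<omega>. phi k \<omega> \<bullet> (P k \<omega> *v phi k \<omega>)) \<in> borel_measurable (Fc k)"
      by (rule borel_measurable_inner[OF phi measurable_matrix_vector_mult[OF m(2) phi]])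
    have 2: "s k \<in> borel_measurable (Fc k)"
    proof (rule measurable_Fc_AE_cong[OF 1])
      show "AE \<omega> in M. phi k \<omega> \<bullet> (P k \<omega> *v phi k \<omega>) = s k \<omega>"
        using qn
      proof eventually_elim
        case (elim \<omega>)
        show ?case using quasi_newton.s[OF elim, of k] by simp
      qed
    qed
    note 3 = b[OF m]
    have 4: "(\<lambda>\<omega>. 1 / (mu k \<omega> + (b k \<omega>)\<^sup>2 * s k \<omega>)) \<in> borel_measurable (Fc k)"
      by (intro borel_measurable_divide borel_measurable_const borel_measurable_add borel_measurable_times borel_measurable_power mu 2 3)
    have "a k \<in> borel_measurable (Fc k)"
    proof (rule measurable_Fc_AE_cong[OF 4])
      show "AE \<omega> in M. 1 / (mu k \<omega> + (b k \<omega>)\<^sup>2 * s k \<omega>) = a k \<omega>"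
        using qn
      proof eventually_elim
        case (elim \<omega>)
        show ?case using quasi_newton.a[OF elim, of k] by simp
      qed
    qed
    with 2 3 show ?thesis by blast
  qed
  \<comment> \<open>All earlier indices are carried along because the inverse covariance at
    \<open>Suc k\<close> contains every earlier gain.\<close>
  have all: "\<forall>j\<le>k. th j \<in> borel_measurable (Fc j) \<and> P j \<in> borel_measurable (Fc j)" for k
  proof (induction k)
    case 0
    have "th 0 = (\<lambda>_. t0)" "P 0 = (\<lambda>_. p0)" using th0 P0 by auto
    then show ?case by simp
  next
    case (Suc k)
    have thk: "th k \<in> borel_measurable (Fc k)" and Pk: "P k \<in> borel_measurable (Fc k)" using Suc by auto
    have up: "f \<in> borel_measurable (Fc (Suc k))" if "f \<in> borel_measurable (Fc j)" "j \<le> k" for f :: "'a \<Rightarrow> 'c::topological_space" and j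
      by (rule measurable_Fc_mono[OF _ that(1)]) (use that in simp)
    have am: "a k \<in> borel_measurable (Fc (Suc k))" and bm: "b k \<in> borel_measurable (Fc (Suc k))"
      and phm: "phi k \<in> borel_measurable (Fc (Suc k))" and Pm: "P k \<in> borel_measurable (Fc (Suc k))"
      and thkm: "th k \<in> borel_measurable (Fc (Suc k))"
      using up[OF _ order_refl] sa[OF thk Pk] phi[of k] Pk thk by blast+
    have rm: "r k \<in> borel_measurable (Fc (Suc k))" by (rule r[OF thk])
    have P1: "(\<lambda>\<omega>. P k \<omega> - (a k \<omega> * (b k \<omega>)\<^sup>2) *\<^sub>R (P k \<omega> ** outer (phi k \<omega>) (phi k \<omega>) ** P k \<omega>)) \<in> borel_measurable (Fc (Suc k))"
      by (intro borel_measurable_diff borel_measurable_scaleR borel_measurable_times borel_measurable_power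
          measurable_matrix_matrix_mult measurable_outer am bm phm Pm)
    have PS: "P (Suc k) \<in> borel_measurable (Fc (Suc k))"
    proof (rule measurable_Fc_AE_cong[OF P1])
      show "AE \<omega> in M. P k \<omega> - (a k \<omega> * (b k \<omega>)\<^sup>2) *\<^sub>R (P k \<omega> ** outer (phi k \<omega>) (phi k \<omega>) ** P k \<omega>) = P (Suc k) \<omega>"
        using qn
      proof eventually_elim
        case (elim \<omega>)
        show ?case using quasi_newton.P[OF elim, of k] by simp
      qed
    qed
    define R where "R \<omega> = matrix_inv p0 + (\<Sum>j<Suc k. ((b j \<omega>)\<^sup>2 / mu j \<omega>) *\<^sub>R outer (phi j \<omega>) (phi j \<omega>))" for \<omega>
    have Rm: "R \<in> borel_measurable (Fc (Suc k))"
      unfolding R_def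
    proof (intro borel_measurable_add borel_measurable_const borel_measurable_sum)
      fix j assume "j \<in> {..<Suc k}"
      then have j: "j \<le> k" by simp
      have "b j \<in> borel_measurable (Fc j)" using sa[of j] Suc j by blast
      then show "(\<lambda>\<omega>. ((b j \<omega>)\<^sup>2 / mu j \<omega>) *\<^sub>R outer (phi j \<omega>) (phi j \<omega>)) \<in> borel_measurable (Fc (Suc k))"
        by (intro borel_measurable_scaleR borel_measurable_divide borel_measurable_power measurable_outer up[OF _ j] mu phi)
    qed
    have Rinv: "AE \<omega> in M. matrix_inv (P (Suc k) \<omega>) = R \<omega> \<and> pos_def (R \<omega>)"
      using qn
    proof eventually_elim
      case (elim \<omega>)
      have "quasi_newton.R (\<lambda>k. phi k \<omega>) (\<lambda>k. b k \<omega>) (\<lambda>k. mu k \<omega>) (\<lambda>k. P k \<omega>) (Suc k) = R \<omega>"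
        by (simp add: quasi_newton.R_def[OF elim] R_def P0)
      then show ?case using quasi_newton.matrix_inv_P[OF elim, of "Suc k"] quasi_newton.pos_def_R[OF elim, of "Suc k"] by simp
    qed
    have t1: "(\<lambda>\<omega>. projQ (R \<omega>) D (th k \<omega> + (a k \<omega> * b k \<omega> * r k \<omega>) *\<^sub>R (P k \<omega> *v phi k \<omega>))) \<in> borel_measurable (Fc (Suc k))"
    proof (rule measurable_Fc_projQ[OF D Rm])
      show "AE \<omega> in M. pos_def (R \<omega>)" using Rinv by eventually_elim simp
      show "(\<lambda>\<omega>. th k \<omega> + (a k \<omega> * b k \<omega> * r k \<omega>) *\<^sub>R (P k \<omega> *v phi k \<omega>)) \<in> borel_measurable (Fc (Suc k))"
        by (intro borel_measurable_add borel_measurable_scaleR borel_measurable_times measurable_matrix_vector_mult am bm phm Pm thkm rm)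
    qed
    have tS: "th (Suc k) \<in> borel_measurable (Fc (Suc k))"
    proof (rule measurable_Fc_AE_cong[OF t1])
      show "AE \<omega> in M. projQ (R \<omega>) D (th k \<omega> + (a k \<omega> * b k \<omega> * r k \<omega>) *\<^sub>R (P k \<omega> *v phi k \<omega>)) = th (Suc k) \<omega>"
        using qn Rinv
      proof eventually_elim
        case (elim \<omega>)
        show ?case using quasi_newton.th[OF elim(1), of k] elim(2) by simp
      qed
    qed
    show ?case using Suc PS tS by (auto simp: le_Suc_eq)
  qed
  show 1: "th k \<in> borel_measurable (Fc k)" and 2: "P k \<in> borel_measurable (Fc k)" using all[of k] by auto
  show "s k \<in> borel_measurable (Fc k)" "a k \<in> borel_measurable (Fc k)" "b k \<in> borel_measurable (Fc k)"
    using sa[OF 1 2] by auto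
qed

end

section \<open>Regret of the two-step algorithm\<close>

lemma tsqn1_quasi_newton:
  fixes phi :: "nat \<Rightarrow> real^'n"
  assumes D: "convex D" "compact D" "th0 \<in> D" "pos_def P0"
    and th: "\<And>k. th k = fst (tsqn1 phi y G gl gu D th0 P0 k)"
    and P: "\<And>k. P k = snd (tsqn1 phi y G gl gu D th0 P0 k)"
    and s: "\<And>k. s k = phi k \<bullet> (P k *v phi k)"
    and b: "\<And>k. b k = min (gl k) (1 / (2 * gu k * s k + 1))"
    and a: "\<And>k. a k = 1 / (1 + (b k)\<^sup>2 * s k)"
    and r: "\<And>k. r k = y k - G k (phi k \<bullet> th k)"
  shows "quasi_newton D phi b (\<lambda>_. 1) r th P s a"
proof
  show "P (Suc k) = P k - (a k * (b k)\<^sup>2) *\<^sub>R (P k ** outer (phi k) (phi k) ** P k)" for k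
    unfolding a b s P by (simp add: Let_def case_prod_beta)
  then show "th (Suc k) = projQ (matrix_inv (P (Suc k))) D (th k + (a k * b k * r k) *\<^sub>R (P k *v phi k))" for k
    unfolding a b s P th r by (simp add: Let_def case_prod_beta)
qed (use D in \<open>auto simp: th P s a\<close>)

lemma tsqn2_quasi_newton:
  fixes phi :: "nat \<Rightarrow> real^'n"
  assumes D: "convex D" "compact D" "th0 \<in> D" "pos_def P0" and mu: "\<And>k. 0 < mu k"
    and th: "\<And>k. th k = fst (tsqn2 phi y G G' mu thb D th0 P0 k)"
    and P: "\<And>k. P k = snd (tsqn2 phi y G G' mu thb D th0 P0 k)"
    and s: "\<And>k. s k = phi k \<bullet> (P k *v phi k)"
    and b: "\<And>k. b k = (if phi k \<bullet> th k \<noteq> phi k \<bullet> thb k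
              then (G k (phi k \<bullet> thb k) - G k (phi k \<bullet> th k)) / (phi k \<bullet> thb k - phi k \<bullet> th k)
              else G' k (phi k \<bullet> th k))"
    and a: "\<And>k. a k = 1 / (mu k + (b k)\<^sup>2 * s k)"
    and r: "\<And>k. r k = y k - G k (phi k \<bullet> th k)"
  shows "quasi_newton D phi b mu r th P s a"
proof
  show "P (Suc k) = P k - (a k * (b k)\<^sup>2) *\<^sub>R (P k ** outer (phi k) (phi k) ** P k)" for k
    unfolding a b s P th by (simp add: Let_def case_prod_beta)
  then show "th (Suc k) = projQ (matrix_inv (P (Suc k))) D (th k + (a k * b k * r k) *\<^sub>R (P k *v phi k))" for k
    unfolding a b s P th r by (simp add: Let_def case_prod_beta)
qed (use D mu in \<open>auto simp: th P s a\<close>)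

text \<open>The deterministic half of the argument: randomness enters only through the four noise
  bounds \<open>cross1\<close>, \<open>cross2\<close>, \<open>quad1\<close> and
  \<open>quad2\<close>.\<close>

lemma tsqn_regret_pathwise:
  fixes phi thb th :: "nat \<Rightarrow> real^'n" and G G' :: "nat \<Rightarrow> real \<Rightarrow> real"
  assumes theta: "theta \<in> D" and lam: "0 < lam" and phi: "\<And>k. norm (phi k) \<le> B"
    and Mk: "\<And>k x. x \<in> D \<Longrightarrow> \<bar>phi k \<bullet> x\<bar> \<le> Mk k" "\<And>k. Mk k \<le> Mb"
    and der: "\<And>k x. (G k has_real_derivative G' k x) (at x)"
    and g: "0 < g0" "\<And>k x. \<bar>x\<bar> \<le> Mk k \<Longrightarrow> g0 \<le> G' k x \<and> G' k x \<le> g1"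
    and lip: "\<And>k x y. \<bar>x\<bar> \<le> Mk k \<Longrightarrow> \<bar>y\<bar> \<le> Mk k \<Longrightarrow> \<bar>G' k x - G' k y\<bar> \<le> rho * \<bar>x - y\<bar>"
    and rho: "0 \<le> rho"
    and mu: "0 < m0" "\<And>k. m0 \<le> mu k" "\<And>k. mu k \<le> m1"
    and w: "\<And>k. w k = y k - G k (phi k \<bullet> theta)"
    and qn1: "quasi_newton D phi bb (\<lambda>_. 1) rb thb Pb sb ab"
    and rb: "\<And>k. rb k = y k - G k (phi k \<bullet> thb k)"
    and bb: "\<And>k. bb k = min (Inf (G' k ` {- Mk k .. Mk k})) (1 / (2 * Sup (G' k ` {- Mk k .. Mk k}) * sb k + 1))"
    and qn2: "quasi_newton D phi b mu r th P s a"
    and r: "\<And>k. r k = y k - G k (phi k \<bullet> th k)"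
    and b: "\<And>k. b k = (if phi k \<bullet> th k \<noteq> phi k \<bullet> thb k
              then (G k (phi k \<bullet> thb k) - G k (phi k \<bullet> th k)) / (phi k \<bullet> thb k - phi k \<bullet> th k)
              else G' k (phi k \<bullet> th k))"
    and f1: "\<And>k. f1 k = (2 / 1) * (ab k * (bb k)\<^sup>2 * sb k * (G k (phi k \<bullet> theta) - G k (phi k \<bullet> thb k)) - bb k * (phi k \<bullet> (theta - thb k)))"
    and f2: "\<And>k. f2 k = (2 / mu k) * (a k * (b k)\<^sup>2 * s k * (G k (phi k \<bullet> theta) - G k (phi k \<bullet> th k)) - b k * (phi k \<bullet> (theta - th k)))"
    and cross1: "\<exists>C. \<forall>n. (\<Sum>k\<le>n. f1 k * w k) \<le> C * (1 + (\<Sum>k\<le>n. (f1 k)\<^sup>2)) powr (3/4)"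
    and cross2: "\<exists>C. \<forall>n. (\<Sum>k\<le>n. f2 k * w k) \<le> C * (1 + (\<Sum>k\<le>n. (f2 k)\<^sup>2)) powr (3/4)"
    and quad1: "\<exists>C. \<forall>n. (\<Sum>k\<le>n. ab k * (bb k)\<^sup>2 * sb k * (w k)\<^sup>2) \<le> C * (1 + (\<Sum>k\<le>n. ab k * (bb k)\<^sup>2 * sb k))"
    and quad2: "\<exists>C. \<forall>n. (\<Sum>k\<le>n. a k * (b k)\<^sup>2 * s k * (w k)\<^sup>2) \<le> C * (1 + (\<Sum>k\<le>n. a k * (b k)\<^sup>2 * s k))"
  shows "\<exists>C\<ge>0. \<forall>n. (\<Sum>k\<le>n. (G k (phi k \<bullet> theta) - G k (phi k \<bullet> th k))\<^sup>2)
    \<le> C * max 1 (ln (max_eig ((\<Sum>i\<le>n. outer (phi i) (phi i)) + lam *\<^sub>R mat 1)))"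
proof -
  define gl where "gl k = Inf (G' k ` {- Mk k .. Mk k})" for k
  define gu where "gu k = Sup (G' k ` {- Mk k .. Mk k})" for k
  have M0: "0 \<le> Mk k" for k using Mk(1)[OF theta, of k] by linarith
  have g0gl: "g0 \<le> gl k" for k
    unfolding gl_def by (rule cINF_greatest) (use M0[of k] g(2)[of _ k] in auto)
  have gug1: "gu k \<le> g1" for k
    unfolding gu_def by (rule cSUP_least) (use M0[of k] g(2)[of _ k] in auto)
  have gG: "gl k \<le> G' k x \<and> G' k x \<le> gu k" if "\<bar>x\<bar> \<le> Mk k" for k x
  proof
    show "gl k \<le> G' k x" unfolding gl_def
      by (rule cINF_lower) (use that g(2)[of _ k] in \<open>auto intro!: bdd_belowI2[of _ g0]\<close>)
    show "G' k x \<le> gu k" unfolding gu_def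
      by (rule cSUP_upper) (use that g(2)[of _ k] in \<open>auto intro!: bdd_aboveI2[of _ _ g1]\<close>)
  qed
  have thbD: "thb k \<in> D" and thD: "th k \<in> D" for k
    by (rule quasi_newton.th_in_D[OF qn1], rule quasi_newton.th_in_D[OF qn2])
  have X0: "\<bar>phi k \<bullet> theta\<bar> \<le> Mk k" and X1: "\<bar>phi k \<bullet> thb k\<bar> \<le> Mk k" and X2: "\<bar>phi k \<bullet> th k\<bar> \<le> Mk k" for k
    by (rule Mk(1), fact theta thbD thD)+
  have "\<forall>k. \<exists>g. gl k \<le> g \<and> g \<le> gu k \<and> G k (phi k \<bullet> theta) - G k (phi k \<bullet> thb k) = g * (phi k \<bullet> theta - phi k \<bullet> thb k)"
    by (rule allI, rule slope_mean_value[OF der gG X0 X1])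
  \<comment> \<open>The true secant slopes between \<open>theta\<close> and the first-step estimate:
    unknown to the algorithm, but within the bounds from which \<open>bb\<close> is formed.\<close>
  then obtain q where q: "\<And>k. gl k \<le> q k" "\<And>k. q k \<le> gu k"
      "\<And>k. G k (phi k \<bullet> theta) - G k (phi k \<bullet> thb k) = q k * (phi k \<bullet> theta - phi k \<bullet> thb k)"
    by metis
  obtain C1 where C1: "\<And>n. (\<Sum>k\<le>n. f1 k * w k) \<le> C1 * (1 + (\<Sum>k\<le>n. (f1 k)\<^sup>2)) powr (3/4)" using cross1 by blast
  obtain C2 where C2: "\<And>n. (\<Sum>k\<le>n. f2 k * w k) \<le> C2 * (1 + (\<Sum>k\<le>n. (f2 k)\<^sup>2)) powr (3/4)" using cross2 by blast
  obtain C3 where C3: "\<And>n. (\<Sum>k\<le>n. ab k * (bb k)\<^sup>2 * sb k * (w k)\<^sup>2) \<le> C3 * (1 + (\<Sum>k\<le>n. ab k * (bb k)\<^sup>2 * sb k))" using quad1 by blast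
  obtain C4 where C4: "\<And>n. (\<Sum>k\<le>n. a k * (b k)\<^sup>2 * s k * (w k)\<^sup>2) \<le> C4 * (1 + (\<Sum>k\<le>n. a k * (b k)\<^sup>2 * s k))" using quad2 by blast
  have rb': "rb k = (G k (phi k \<bullet> theta) - G k (phi k \<bullet> thb k)) + w k" for k
    by (simp add: rb w)
  have r': "r k = (G k (phi k \<bullet> theta) - G k (phi k \<bullet> th k)) + w k" for k
    by (simp add: r w)
  have "\<exists>C\<ge>0. \<forall>n. (\<Sum>k\<le>n. (phi k \<bullet> (theta - thb k))\<^sup>2)
    \<le> C * max 1 (ln (max_eig ((\<Sum>i\<le>n. outer (phi i) (phi i)) + lam *\<^sub>R mat 1)))"
    by (rule first_step_prediction_error_sum[OF qn1 theta lam phi rb' _ g(1) g0gl q(1,2) gug1 _ C1 f1 C3])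
       (auto simp: q(3) bb gl_def gu_def inner_diff_right)
  then obtain Cz where Cz: "\<And>n. (\<Sum>k\<le>n. (phi k \<bullet> (theta - thb k))\<^sup>2)
    \<le> Cz * max 1 (ln (max_eig ((\<Sum>i\<le>n. outer (phi i) (phi i)) + lam *\<^sub>R mat 1)))" by blast
  show ?thesis
  \<comment> \<open>\<open>K\<close> reflects that the slope of \<open>G\<close> is at least
    \<open>g0\<close>. \<open>Cx\<close> combines the slope error, at most \<open>rho\<close> times
    the first-step prediction error, with the factor \<open>2 * Mb\<close>, since both predictions
    lie within \<open>Mb\<close>.\<close>
  proof (rule second_step_prediction_error_sum[OF qn2 theta lam phi r' mu, where ?g1.0=g1 and K="1 / g0" and Cx="(rho * (2 * Mb))\<^sup>2"])
    fix k
    obtain v where v: "g0 \<le> v" "v \<le> g1" "G k (phi k \<bullet> thb k) - G k (phi k \<bullet> th k) = v * (phi k \<bullet> thb k - phi k \<bullet> th k)"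
      using slope_mean_value[OF der g(2) X1 X2] by blast
    show "\<bar>b k\<bar> \<le> g1"
    proof (cases "phi k \<bullet> th k = phi k \<bullet> thb k")
      case True
      then show ?thesis using g(2)[OF X2[where k=k]] g(1) unfolding b by auto
    next
      case False
      then have "b k = v" using v(3) unfolding b by simp
      then show ?thesis using v g(1) by simp
    qed
    obtain u where u: "g0 \<le> u" "u \<le> g1" "G k (phi k \<bullet> theta) - G k (phi k \<bullet> th k) = u * (phi k \<bullet> theta - phi k \<bullet> th k)"
      using slope_mean_value[OF der g(2) X0 X2] by blast
    have "g0 * \<bar>phi k \<bullet> theta - phi k \<bullet> th k\<bar> \<le> u * \<bar>phi k \<bullet> theta - phi k \<bullet> th k\<bar>"
      by (rule mult_right_mono[OF u(1)]) simp
    also have "\<dots> = \<bar>G k (phi k \<bullet> theta) - G k (phi k \<bullet> th k)\<bar>"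
      unfolding u(3) abs_mult using u(1) g(1) by simp
    finally show "\<bar>phi k \<bullet> (theta - th k)\<bar> \<le> 1 / g0 * \<bar>G k (phi k \<bullet> theta) - G k (phi k \<bullet> th k)\<bar>"
      using g(1) by (simp add: inner_diff_right pos_le_divide_eq mult.commute)
    define t where "t = phi k \<bullet> (theta - th k)"
    define tb where "tb = phi k \<bullet> (theta - thb k)"
    have "\<bar>b k * (phi k \<bullet> theta - phi k \<bullet> th k) - (G k (phi k \<bullet> theta) - G k (phi k \<bullet> th k))\<bar>
        \<le> rho * \<bar>phi k \<bullet> theta - phi k \<bullet> thb k\<bar> * \<bar>phi k \<bullet> theta - phi k \<bullet> th k\<bar>"
      by (rule slope_difference_bound[OF der lip rho X1 X2 X0 b])
    then have "\<bar>b k * t - (G k (phi k \<bullet> theta) - G k (phi k \<bullet> th k))\<bar> \<le> rho * \<bar>tb\<bar> * \<bar>t\<bar>"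
      by (simp add: t_def tb_def inner_diff_right)
    also have "\<dots> \<le> rho * \<bar>tb\<bar> * (2 * Mb)"
    proof (rule mult_left_mono)
      show "\<bar>t\<bar> \<le> 2 * Mb" using X0[of k] X2[of k] Mk(2)[of k] unfolding t_def inner_diff_right by linarith
    qed (use rho in simp)
    also have "\<dots> = \<bar>rho * (2 * Mb) * tb\<bar>"
      using rho M0[of k] Mk(2)[of k] by (simp add: abs_mult)
    finally have "(b k * t - (G k (phi k \<bullet> theta) - G k (phi k \<bullet> th k)))\<^sup>2 \<le> (rho * (2 * Mb) * tb)\<^sup>2"
      by (simp only: abs_le_square_iff)
    then show "(b k * (phi k \<bullet> (theta - th k)) - (G k (phi k \<bullet> theta) - G k (phi k \<bullet> th k)))\<^sup>2
        \<le> (rho * (2 * Mb))\<^sup>2 * (phi k \<bullet> (theta - thb k))\<^sup>2"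
      unfolding t_def tb_def by (simp only: power_mult_distrib)
  qed (rule Cz C2 f2 C4 | use g(1) in simp)+
qed

section \<open>Noise estimates without localisation\<close>

context filtered_prob_space
begin

text \<open>Each integer \<open>N\<close> has its localised noise sequence. On almost every path
  some \<open>N\<close> bounds all indices at once, and there \<open>w\<close> coincides with that
  sequence for every \<open>k\<close>. Integer levels keep the union of exceptional sets
  null.\<close>

lemma noise_bounds:
  fixes X C e y w f h :: "nat \<Rightarrow> 'a \<Rightarrow> real" and p :: real
  assumes X: "\<And>k. X k \<in> borel_measurable (F k)" and C: "\<And>k. C k \<in> borel_measurable (F k)"
    and y: "\<And>k. y k \<in> borel_measurable (F (Suc k))" and e: "\<And>k. e k \<in> borel_measurable M"
    and bound: "\<And>k. AE \<omega> in M. \<bar>y k \<omega>\<bar> \<le> \<bar>X k \<omega>\<bar> + C k \<omega> + \<bar>e k \<omega>\<bar>"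
    and p: "2 < p"
    and bdd: "AE \<omega> in M. \<exists>N. \<forall>k. \<bar>X k \<omega>\<bar> \<le> N \<and> C k \<omega> \<le> N
        \<and> nn_cond_exp M (F k) (\<lambda>\<omega>. ennreal (\<bar>e k \<omega>\<bar> powr p)) \<omega> \<le> ennreal N"
    and w: "AE \<omega> in M. \<forall>k. w k \<omega> = y k \<omega> - real_cond_exp M (F k) (y k) \<omega>"
    and f: "\<And>k. f k \<in> borel_measurable (Fc k)"
    and h: "\<And>k. h k \<in> borel_measurable (Fc k)" and h01: "AE \<omega> in M. \<forall>k. 0 \<le> h k \<omega> \<and> h k \<omega> \<le> 1"
  shows "AE \<omega> in M. \<exists>K. \<forall>n. (\<Sum>k\<le>n. f k \<omega> * w k \<omega>) \<le> K * (1 + (\<Sum>k\<le>n. (f k \<omega>)\<^sup>2)) powr (3/4)"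
    and "AE \<omega> in M. \<exists>K. \<forall>n. (\<Sum>k\<le>n. h k \<omega> * (w k \<omega>)\<^sup>2) \<le> K * (1 + (\<Sum>k\<le>n. h k \<omega>))"
proof -
  \<comment> \<open>\<open>2 + 2 * d\<close> must not exceed \<open>p\<close>, and
    \<open>d \<le> 1\<close> keeps the exponent \<open>1 - d\<close> in the truncation estimate
    nonnegative.\<close>
  define d where "d = min 1 ((p - 2) / 2)"
  have d: "0 < d" "d \<le> 1" using p by (auto simp: d_def)
  have "d \<le> (p - 2) / 2" unfolding d_def by (rule min.cobounded2)
  then have dp: "2 + 2 * d \<le> p" by (simp add: field_simps)
  define B where "B N k = {\<omega>\<in>space M. \<bar>X k \<omega>\<bar> \<le> N \<and> C k \<omega> \<le> N
      \<and> nn_cond_exp M (F k) (\<lambda>\<omega>. ennreal (\<bar>e k \<omega>\<bar> powr p)) \<omega> \<le> ennreal N}" for N k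
  define K where "K N = 2 powr p * ((5 * N + 1) powr p + N)" for N :: real
  define Q where "Q N k v \<longleftrightarrow> v \<in> borel_measurable (F (Suc k))
    \<and> (\<forall>g\<in>borel_measurable (F k). (\<forall>\<omega>. \<bar>g \<omega>\<bar> \<le> 1) \<longrightarrow> (\<integral>\<omega>. g \<omega> * v \<omega> \<partial>M) = 0)
    \<and> cond_exp_le M (F k) (\<lambda>\<omega>. (v \<omega>)\<^sup>2) (K N)
    \<and> cond_exp_le M (F k) (\<lambda>\<omega>. ((v \<omega>)\<^sup>2) powr (1 + d)) (K N)
    \<and> (AE \<omega> in M. \<omega> \<in> B N k \<longrightarrow> v \<omega> = y k \<omega> - real_cond_exp M (F k) (y k) \<omega>)" for N k v
  have "\<exists>v. Q (real N) k v" for N :: nat and k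
    unfolding Q_def B_def K_def
    by (rule localised_noise[OF X C y e bound]) (use p d dp in auto)
  then obtain v where Q: "\<And>(N::nat) k. Q (real N) k (v N k)" by metis
  have v: "v N k \<in> borel_measurable (F (Suc k))"
    "g \<in> borel_measurable (F k) \<Longrightarrow> (\<And>\<omega>. \<bar>g \<omega>\<bar> \<le> 1) \<Longrightarrow> (\<integral>\<omega>. g \<omega> * v N k \<omega> \<partial>M) = 0"
    "cond_exp_le M (F k) (\<lambda>\<omega>. (v N k \<omega>)\<^sup>2) (K (real N))"
    "cond_exp_le M (F k) (\<lambda>\<omega>. ((v N k \<omega>)\<^sup>2) powr (1 + d)) (K (real N))"
    "AE \<omega> in M. \<omega> \<in> B (real N) k \<longrightarrow> v N k \<omega> = y k \<omega> - real_cond_exp M (F k) (y k) \<omega>" for N k g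
    using Q[of N k] unfolding Q_def by blast+
  have K0: "0 \<le> K (real N)" for N by (simp add: K_def)
  have veq: "AE \<omega> in M. \<forall>N k. \<omega> \<in> B (real N) k \<longrightarrow> v N k \<omega> = y k \<omega> - real_cond_exp M (F k) (y k) \<omega>"
    unfolding AE_all_countable using v(5) by blast
  have good: "AE \<omega> in M. \<exists>N. \<forall>k. w k \<omega> = v N k \<omega>"
    using veq w bdd AE_space
  proof eventually_elim
    case (elim \<omega>)
    then obtain r where r: "\<And>k. \<bar>X k \<omega>\<bar> \<le> r \<and> C k \<omega> \<le> r
        \<and> nn_cond_exp M (F k) (\<lambda>\<omega>. ennreal (\<bar>e k \<omega>\<bar> powr p)) \<omega> \<le> ennreal r" by blast
    obtain N :: nat where N: "r \<le> real N" using real_arch_simple by blast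
    have "\<omega> \<in> B (real N) k" for k
      unfolding B_def using r[of k] N elim(4) by (auto intro: order_trans ennreal_leI)
    then have "\<forall>k. w k \<omega> = v N k \<omega>" using elim(1,2) by simp
    then show ?case by blast
  qed
  obtain f' where f': "\<And>k. f' k \<in> borel_measurable (F k)" "\<And>k. AE \<omega> in M. f k \<omega> = f' k \<omega>"
    using measurable_Fc_version[OF f] by metis
  have feq: "AE \<omega> in M. \<forall>k. f k \<omega> = f' k \<omega>" unfolding AE_all_countable using f'(2) by blast
  have "AE \<omega> in M. \<forall>N. \<exists>K. \<forall>n. (\<Sum>k\<le>n. f' k \<omega> * v N k \<omega>) \<le> K * (1 + (\<Sum>k\<le>n. (f' k \<omega>)\<^sup>2)) powr (3/4)"
    unfolding AE_all_countable
    by (intro allI weighted_noise_sum_bound[OF f'(1) v(1) v(2) v(3) K0])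
  with good feq show "AE \<omega> in M. \<exists>K. \<forall>n. (\<Sum>k\<le>n. f k \<omega> * w k \<omega>) \<le> K * (1 + (\<Sum>k\<le>n. (f k \<omega>)\<^sup>2)) powr (3/4)"
  proof eventually_elim
    case (elim \<omega>)
    then obtain N where N: "\<And>k. w k \<omega> = v N k \<omega>" by blast
    have fe: "\<And>k. f k \<omega> = f' k \<omega>" using elim(2) by blast
    show ?case unfolding N fe using elim(3) by blast
  qed
  obtain h0 where h0: "\<And>k. h0 k \<in> borel_measurable (F k)" "\<And>k. AE \<omega> in M. h k \<omega> = h0 k \<omega>"
    using measurable_Fc_version[OF h] by metis
  \<comment> \<open>A version satisfies the bounds 0 and 1 only almost surely; clamping enforces
    them everywhere and alters it on a null set at most.\<close>
  define h' where "h' k \<omega> = max 0 (min 1 (h0 k \<omega>))" for k \<omega>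
  have h'm: "h' k \<in> borel_measurable (F k)" for k unfolding h'_def using h0(1)[of k] by measurable
  have h'01: "0 \<le> h' k \<omega> \<and> h' k \<omega> \<le> 1" for k \<omega> by (simp add: h'_def)
  have "AE \<omega> in M. \<forall>k. h k \<omega> = h0 k \<omega>" unfolding AE_all_countable using h0(2) by blast
  with h01 have heq: "AE \<omega> in M. \<forall>k. h k \<omega> = h' k \<omega>"
  proof eventually_elim
    case (elim \<omega>)
    show ?case
    proof
      fix k
      have "0 \<le> h0 k \<omega>" "h0 k \<omega> \<le> 1" "h k \<omega> = h0 k \<omega>" using elim by metis+
      then show "h k \<omega> = h' k \<omega>" by (simp add: h'_def)
    qed
  qed
  have "AE \<omega> in M. \<forall>N. \<exists>K. \<forall>n. (\<Sum>k\<le>n. h' k \<omega> * (v N k \<omega>)\<^sup>2) \<le> K * (1 + (\<Sum>k\<le>n. h' k \<omega>))"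
    unfolding AE_all_countable
    by (intro allI weighted_noise_square_sum_bound[OF h'm h'01 v(1) v(3) v(4) K0 d(1,2)])
  with good heq show "AE \<omega> in M. \<exists>K. \<forall>n. (\<Sum>k\<le>n. h k \<omega> * (w k \<omega>)\<^sup>2) \<le> K * (1 + (\<Sum>k\<le>n. h k \<omega>))"
  proof eventually_elim
    case (elim \<omega>)
    then obtain N where N: "\<And>k. w k \<omega> = v N k \<omega>" by blast
    have he: "\<And>k. h k \<omega> = h' k \<omega>" using elim(2) by blast
    show ?case unfolding N he using elim(3) by blast
  qed
qed

end

text \<open>A very negative \<open>l\<close> does no harm: \<open>x < l\<close> is then larger in
  absolute value than \<open>l\<close>. Hence only the positive part of \<open>l\<close> enters, and
  symmetrically the negative part of \<open>u\<close>, besides the two jumps.\<close>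

lemma abs_sat_le:
  assumes "L \<le> l" "l \<le> u" "u \<le> U"
  shows "\<bar>sat L l u U x\<bar> \<le> \<bar>x\<bar> + ((U - u) + (l - L) + max l 0 + max (- u) 0)"
  using assms by (auto simp: sat_def)

lemma sat_mono:
  assumes "L \<le> l" "l \<le> u" "u \<le> U" "x \<le> y"
  shows "sat L l u U x \<le> sat L l u U y"
  using assms by (auto simp: sat_def)

lemma measurable_sat:
  assumes "L \<in> borel_measurable N" "l \<in> borel_measurable N" "u \<in> borel_measurable N" "U \<in> borel_measurable N"
    "x \<in> borel_measurable N"
  shows "(\<lambda>\<omega>. sat (L \<omega>) (l \<omega>) (u \<omega>) (U \<omega>) (x \<omega>)) \<in> borel_measurable N"
  unfolding sat_def using assms by measurable

theorem theorem2:
  fixes M :: "'a measure" and F :: "nat \<Rightarrow> 'a measure"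
    and theta :: "real^'m" and D :: "(real^'m) set"
    and phi :: "nat \<Rightarrow> 'a \<Rightarrow> real^'m" and e :: "nat \<Rightarrow> 'a \<Rightarrow> real"
    and Mk :: "nat \<Rightarrow> 'a \<Rightarrow> real"
    and lb ub Lb Ub :: "nat \<Rightarrow> 'a \<Rightarrow> real"
    and c l u :: "'a \<Rightarrow> real"
    and eta :: real
    and G G' :: "nat \<Rightarrow> 'a \<Rightarrow> real \<Rightarrow> real"
    and Mbig rho :: "'a \<Rightarrow> real"
    and mu :: "nat \<Rightarrow> 'a \<Rightarrow> real"
    and thb0 th0 :: "real^'m" and Pb0 P0 :: "real^'m^'m"
    and lambda0 :: real
  assumes prob: "prob_space M"
    and filt_sub: "\<And>k. subalgebra M (F k)"
    and filt_mono: "\<And>i j. i \<le> j \<Longrightarrow> sets (F i) \<subseteq> sets (F j)"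
    \<comment> \<open>(A1)\<close>
    and phi_adapted: "\<And>k. phi k \<in> borel_measurable (F k)"
    and phi_bounded: "AE \<omega> in M. bdd_above (range (\<lambda>k. norm (phi k \<omega>)))"
    and D_convex: "convex D" and D_compact: "compact D"
    and theta_int: "theta \<in> interior D"
    and Mk_adapted: "\<And>k. Mk k \<in> borel_measurable (F k)"
    and Mk_bounded: "AE \<omega> in M. bdd_above (range (\<lambda>k. \<bar>Mk k \<omega>\<bar>))"
    and Mk_bound: "AE \<omega> in M. \<forall>k. \<forall>x\<in>D. \<bar>phi k \<omega> \<bullet> x\<bar> \<le> Mk k \<omega>"
    \<comment> \<open>(A2)\<close>
    and lb_adapted: "\<And>k. lb k \<in> borel_measurable (F k)"
    and ub_adapted: "\<And>k. ub k \<in> borel_measurable (F k)"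
    and Lb_adapted: "\<And>k. Lb k \<in> borel_measurable (F k)"
    and Ub_adapted: "\<And>k. Ub k \<in> borel_measurable (F k)"
    and thresholds: "AE \<omega> in M. \<forall>k. lb k \<omega> - c \<omega> \<le> Lb k \<omega> \<and> Lb k \<omega> \<le> lb k \<omega> \<and>
                        lb k \<omega> \<le> ub k \<omega> \<and> ub k \<omega> \<le> Ub k \<omega> \<and> Ub k \<omega> \<le> ub k \<omega> + c \<omega>"
    and l_bound: "AE \<omega> in M. \<forall>k. max (lb k \<omega>) 0 \<le> l \<omega>"
    and u_bound: "AE \<omega> in M. \<forall>k. max (- ub k \<omega>) 0 \<le> u \<omega>"
    and c_rv: "c \<in> borel_measurable M" and l_rv: "l \<in> borel_measurable M"
    and u_rv: "u \<in> borel_measurable M"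
    and c_nonneg: "AE \<omega> in M. c \<omega> \<ge> 0" and l_nonneg: "AE \<omega> in M. l \<omega> \<ge> 0"
    and u_nonneg: "AE \<omega> in M. u \<omega> \<ge> 0"
    and c_sq: "integrable M (\<lambda>\<omega>. (c \<omega>)\<^sup>2)" and l_sq: "integrable M (\<lambda>\<omega>. (l \<omega>)\<^sup>2)"
    and u_sq: "integrable M (\<lambda>\<omega>. (u \<omega>)\<^sup>2)"
    \<comment> \<open>(A3)\<close>
    and e_adapted: "\<And>k. e (Suc k) \<in> borel_measurable (F (Suc k))"
    and e_sq: "\<And>k. integrable M (\<lambda>\<omega>. (e (Suc k) \<omega>)\<^sup>2)"
    and e_mds: "\<And>k. AE \<omega> in M. real_cond_exp M (F k) (e (Suc k)) \<omega> = 0"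
    and eta_pos: "eta > 0"
    and e_var_low: "AE \<omega> in M.
          (INF k. nn_cond_exp M (F k) (\<lambda>\<omega>'. ennreal ((e (Suc k) \<omega>')\<^sup>2)) \<omega>) > 0"
    and e_mom_up: "AE \<omega> in M.
          (SUP k. nn_cond_exp M (F k) (\<lambda>\<omega>'. ennreal (\<bar>e (Suc k) \<omega>'\<bar> powr (2 + eta))) \<omega>) < \<infinity>"
    and G_adapted: "\<And>k x. (\<lambda>\<omega>. G k \<omega> x) \<in> borel_measurable (F k)"
    and G_def: "\<And>k x. AE \<omega> in M. G k \<omega> x =
          real_cond_exp M (F k) (\<lambda>\<omega>'. sat (Lb k \<omega>') (lb k \<omega>') (ub k \<omega>') (Ub k \<omega>') (x + e (Suc k) \<omega>')) \<omega>"
    and G_deriv: "AE \<omega> in M. \<forall>k x. (G k \<omega> has_real_derivative G' k \<omega> x) (at x)"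
    and Mbig_rv: "Mbig \<in> borel_measurable M"
    and Mbig_gt: "AE \<omega> in M. (SUP k. Mk k \<omega>) < Mbig \<omega>"
    and G'_bounds: "AE \<omega> in M.
          0 < (INF k. INF x\<in>{- Mbig \<omega> .. Mbig \<omega>}. ereal (G' k \<omega> x)) \<and>
          (INF k. INF x\<in>{- Mbig \<omega> .. Mbig \<omega>}. ereal (G' k \<omega> x))
            < (SUP k. SUP x\<in>{- Mbig \<omega> .. Mbig \<omega>}. ereal (G' k \<omega> x)) \<and>
          (SUP k. SUP x\<in>{- Mbig \<omega> .. Mbig \<omega>}. ereal (G' k \<omega> x)) < \<infinity>"
    and rho_rv: "rho \<in> borel_measurable M"
    and rho_nonneg: "AE \<omega> in M. rho \<omega> \<ge> 0"
    and G'_lip: "AE \<omega> in M. \<forall>k x y. \<bar>x\<bar> \<le> Mbig \<omega> \<longrightarrow> \<bar>y\<bar> \<le> Mbig \<omega> \<longrightarrow>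
          \<bar>G' k \<omega> x - G' k \<omega> y\<bar> \<le> rho \<omega> * \<bar>x - y\<bar>"
    \<comment> \<open>algorithm parameters\<close>
    and mu_adapted: "\<And>k. mu k \<in> borel_measurable (F k)"
    and mu_pos: "AE \<omega> in M. \<forall>k. mu k \<omega> > 0"
    and mu_bounds: "AE \<omega> in M. 0 < (INF k. ereal (mu k \<omega>)) \<and> (SUP k. ereal (mu k \<omega>)) < \<infinity>"
    and thb0_D: "thb0 \<in> D" and Pb0_pos: "pos_def Pb0"
    and th0_D: "th0 \<in> D" and P0_pos: "pos_def P0"
    and lambda0_gt: "lambda0 > onorm (\<lambda>x. matrix_inv P0 *v x)"
  shows "AE \<omega> in M.
    (\<lambda>k. \<Sum>i = 1..k.
        (real_cond_exp M (F i)
            (\<lambda>\<omega>'. sat (Lb i \<omega>') (lb i \<omega>') (ub i \<omega>') (Ub i \<omega>') (phi i \<omega>' \<bullet> theta + e (Suc i) \<omega>')) \<omega>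
         - G i \<omega> (phi i \<omega> \<bullet>
              tsqn_est (\<lambda>j. phi j \<omega>)
                (\<lambda>j. sat (Lb j \<omega>) (lb j \<omega>) (ub j \<omega>) (Ub j \<omega>) (phi j \<omega> \<bullet> theta + e (Suc j) \<omega>))
                (\<lambda>j. G j \<omega>) (\<lambda>j. G' j \<omega>) (\<lambda>j. Mk j \<omega>) (\<lambda>j. mu j \<omega>) D thb0 Pb0 th0 P0 i))\<^sup>2)
    \<in> O(\<lambda>k. max 1 (ln (max_eig ((\<Sum>i\<le>k. outer (phi i \<omega>) (phi i \<omega>)) + lambda0 *\<^sub>R mat 1))))"
proof -
  interpret filtered_prob_space M F
    using prob filt_sub filt_mono by (simp add: filtered_prob_space_def filtered_prob_space_axioms_def)
  have thetaD: "theta \<in> D" using theta_int interior_subset by blast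
  have Dne: "D \<noteq> {}" using thetaD by auto
  have lam: "0 < lambda0"
    using lambda0_gt onorm_pos_le[OF matrix_vector_mul_bounded_linear, of "matrix_inv P0"] by linarith
  \<comment> \<open>Names for all quantities of both recursions along a path, arranged so that
    \<open>tsqn_est\<close> unfolds to \<open>th\<close>.\<close>
  define X where "X k \<omega> = phi k \<omega> \<bullet> theta" for k \<omega>
  define Y where "Y k x \<omega> = sat (Lb k \<omega>) (lb k \<omega>) (ub k \<omega>) (Ub k \<omega>) (x + e (Suc k) \<omega>)" for k x \<omega>
  define y where "y k \<omega> = Y k (X k \<omega>) \<omega>" for k \<omega>
  define C where "C k \<omega> = (Ub k \<omega> - ub k \<omega>) + (lb k \<omega> - Lb k \<omega>) + max (lb k \<omega>) 0 + max (- ub k \<omega>) 0" for k \<omega>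
  define w where "w k \<omega> = y k \<omega> - G k \<omega> (phi k \<omega> \<bullet> theta)" for k \<omega>
  define gl where "gl k \<omega> = Inf (G' k \<omega> ` {- Mk k \<omega> .. Mk k \<omega>})" for k \<omega>
  define gu where "gu k \<omega> = Sup (G' k \<omega> ` {- Mk k \<omega> .. Mk k \<omega>})" for k \<omega>
  define thb where "thb k \<omega> = fst (tsqn1 (\<lambda>j. phi j \<omega>) (\<lambda>j. y j \<omega>) (\<lambda>j. G j \<omega>) (\<lambda>j. gl j \<omega>) (\<lambda>j. gu j \<omega>) D thb0 Pb0 k)" for k \<omega>
  define Pb where "Pb k \<omega> = snd (tsqn1 (\<lambda>j. phi j \<omega>) (\<lambda>j. y j \<omega>) (\<lambda>j. G j \<omega>) (\<lambda>j. gl j \<omega>) (\<lambda>j. gu j \<omega>) D thb0 Pb0 k)" for k \<omega>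
  define sb where "sb k \<omega> = phi k \<omega> \<bullet> (Pb k \<omega> *v phi k \<omega>)" for k \<omega>
  define bb where "bb k \<omega> = min (gl k \<omega>) (1 / (2 * gu k \<omega> * sb k \<omega> + 1))" for k \<omega>
  define ab where "ab k \<omega> = 1 / (1 + (bb k \<omega>)\<^sup>2 * sb k \<omega>)" for k \<omega>
  define rb where "rb k \<omega> = y k \<omega> - G k \<omega> (phi k \<omega> \<bullet> thb k \<omega>)" for k \<omega>
  define th where "th k \<omega> = fst (tsqn2 (\<lambda>j. phi j \<omega>) (\<lambda>j. y j \<omega>) (\<lambda>j. G j \<omega>) (\<lambda>j. G' j \<omega>) (\<lambda>j. mu j \<omega>) (\<lambda>j. thb j \<omega>) D th0 P0 k)" for k \<omega>
  define P where "P k \<omega> = snd (tsqn2 (\<lambda>j. phi j \<omega>) (\<lambda>j. y j \<omega>) (\<lambda>j. G j \<omega>) (\<lambda>j. G' j \<omega>) (\<lambda>j. mu j \<omega>) (\<lambda>j. thb j \<omega>) D th0 P0 k)" for k \<omega>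
  define s where "s k \<omega> = phi k \<omega> \<bullet> (P k \<omega> *v phi k \<omega>)" for k \<omega>
  define b where "b k \<omega> = (if phi k \<omega> \<bullet> th k \<omega> \<noteq> phi k \<omega> \<bullet> thb k \<omega>
      then (G k \<omega> (phi k \<omega> \<bullet> thb k \<omega>) - G k \<omega> (phi k \<omega> \<bullet> th k \<omega>)) / (phi k \<omega> \<bullet> thb k \<omega> - phi k \<omega> \<bullet> th k \<omega>)
      else G' k \<omega> (phi k \<omega> \<bullet> th k \<omega>))" for k \<omega>
  define a where "a k \<omega> = 1 / (mu k \<omega> + (b k \<omega>)\<^sup>2 * s k \<omega>)" for k \<omega>
  define r where "r k \<omega> = y k \<omega> - G k \<omega> (phi k \<omega> \<bullet> th k \<omega>)" for k \<omega>
  \<comment> \<open>The factor \<open>2 / 1\<close> preserves the pattern \<open>2 / mu k\<close> of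
    the general recursion with weight 1.\<close>
  define f1 where "f1 k \<omega> = (2 / 1) * (ab k \<omega> * (bb k \<omega>)\<^sup>2 * sb k \<omega> * (G k \<omega> (phi k \<omega> \<bullet> theta) - G k \<omega> (phi k \<omega> \<bullet> thb k \<omega>)) - bb k \<omega> * (phi k \<omega> \<bullet> (theta - thb k \<omega>)))" for k \<omega>
  define f2 where "f2 k \<omega> = (2 / mu k \<omega>) * (a k \<omega> * (b k \<omega>)\<^sup>2 * s k \<omega> * (G k \<omega> (phi k \<omega> \<bullet> theta) - G k \<omega> (phi k \<omega> \<bullet> th k \<omega>)) - b k \<omega> * (phi k \<omega> \<bullet> (theta - th k \<omega>)))" for k \<omega>

  have Xm: "X k \<in> borel_measurable (F k)" for k
    unfolding X_def by (intro borel_measurable_inner phi_adapted borel_measurable_const)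
  have Cm: "C k \<in> borel_measurable (F k)" for k
    unfolding C_def using lb_adapted[of k] ub_adapted[of k] Lb_adapted[of k] Ub_adapted[of k] by measurable
  have Ym: "Y k x \<in> borel_measurable M" for k x
    unfolding Y_def
    by (intro measurable_sat borel_measurable_add borel_measurable_const measurable_filtration[OF lb_adapted]
        measurable_filtration[OF ub_adapted] measurable_filtration[OF Lb_adapted] measurable_filtration[OF Ub_adapted]
        measurable_filtration[OF e_adapted])
  have ym: "y k \<in> borel_measurable (F (Suc k))" for k
  proof -
    have up: "f \<in> borel_measurable (F (Suc k))" if "f \<in> borel_measurable (F k)" for f :: "'a \<Rightarrow> real"
      by (rule measurable_filtration_mono[OF _ that]) simp
    show ?thesis unfolding y_def Y_def
      by (intro measurable_sat borel_measurable_add e_adapted up[OF lb_adapted] up[OF ub_adapted] up[OF Lb_adapted] up[OF Ub_adapted] up[OF Xm])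
  qed
  have eM: "e (Suc k) \<in> borel_measurable M" for k by (rule measurable_filtration[OF e_adapted])
  have ei: "integrable M (e (Suc k))" for k
    by (rule square_integrable_imp_integrable[OF eM e_sq])
  have Ybound: "AE \<omega> in M. \<forall>x. \<bar>Y k x \<omega>\<bar> \<le> \<bar>x\<bar> + C k \<omega> + \<bar>e (Suc k) \<omega>\<bar>" for k
    using thresholds
  proof eventually_elim
    case (elim \<omega>)
    show ?case
    proof
      fix x
      have "\<bar>Y k x \<omega>\<bar> \<le> \<bar>x + e (Suc k) \<omega>\<bar> + C k \<omega>"
        unfolding Y_def C_def by (rule abs_sat_le) (use elim in blast)+
      then show "\<bar>Y k x \<omega>\<bar> \<le> \<bar>x\<bar> + C k \<omega> + \<bar>e (Suc k) \<omega>\<bar>" by linarith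
    qed
  qed
  have Ymono: "AE \<omega> in M. \<forall>x z. x \<le> z \<longrightarrow> Y k x \<omega> \<le> Y k z \<omega>" for k
    using thresholds
  proof eventually_elim
    case (elim \<omega>)
    have "Lb k \<omega> \<le> lb k \<omega>" "lb k \<omega> \<le> ub k \<omega>" "ub k \<omega> \<le> Ub k \<omega>" using elim by blast+
    then show ?case unfolding Y_def by (auto intro: sat_mono)
  qed
  have der: "AE \<omega> in M. \<forall>x. (G k \<omega> has_real_derivative G' k \<omega> x) (at x)" for k
    using G_deriv by eventually_elim blast
  have cont: "AE \<omega> in M. \<forall>x. isCont (G k \<omega>) x" for k
    using der[of k] by eventually_elim (blast intro: DERIV_isCont)
  \<comment> \<open>The conditional mean of the observation is the regression function at the true
    parameter. This makes \<open>w\<close> a centred noise and turns the regret into a squared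
    difference of values of \<open>G\<close>.\<close>
  have "AE \<omega> in M. real_cond_exp M (F k) (y k) \<omega> = G k \<omega> (X k \<omega>)" for k
    unfolding y_def[abs_def]
  proof (rule cond_exp_substitution[OF Xm Cm Ym _ Ymono Ybound ei _ cont])
    show "(\<lambda>\<omega>. Y k (X k \<omega>) \<omega>) \<in> borel_measurable M"
      using measurable_filtration[OF ym[of k]] unfolding y_def[abs_def] .
    show "AE \<omega> in M. G k \<omega> x = real_cond_exp M (F k) (Y k x) \<omega>" for x
      using G_def[of k x] unfolding Y_def[abs_def] .
  qed
  then have mean: "AE \<omega> in M. \<forall>k. real_cond_exp M (F k) (y k) \<omega> = G k \<omega> (X k \<omega>)"
    unfolding AE_all_countable by blast

  have qn1: "quasi_newton D (\<lambda>k. phi k \<omega>) (\<lambda>k. bb k \<omega>) (\<lambda>_. 1) (\<lambda>k. rb k \<omega>) (\<lambda>k. thb k \<omega>) (\<lambda>k. Pb k \<omega>) (\<lambda>k. sb k \<omega>) (\<lambda>k. ab k \<omega>)" for \<omega>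
    by (rule tsqn1_quasi_newton[OF D_convex D_compact thb0_D Pb0_pos thb_def Pb_def sb_def bb_def ab_def rb_def])
  have qn2: "AE \<omega> in M. quasi_newton D (\<lambda>k. phi k \<omega>) (\<lambda>k. b k \<omega>) (\<lambda>k. mu k \<omega>) (\<lambda>k. r k \<omega>) (\<lambda>k. th k \<omega>) (\<lambda>k. P k \<omega>) (\<lambda>k. s k \<omega>) (\<lambda>k. a k \<omega>)"
    using mu_pos
  proof eventually_elim
    case (elim \<omega>)
    then have "0 < mu k \<omega>" for k by blast
    then show ?case
      by (rule tsqn2_quasi_newton[OF D_convex D_compact th0_D P0_pos _ th_def P_def s_def b_def a_def r_def])
  qed

  \<comment> \<open>A supremum of reals bounds its terms only if the sequence is bounded above,
    hence the appeal to \<open>Mk_bounded\<close>.\<close>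
  have Mk_Mbig: "AE \<omega> in M. \<forall>k. Mk k \<omega> \<le> Mbig \<omega>"
    using Mk_bounded Mbig_gt
  proof eventually_elim
    case (elim \<omega>)
    have "bdd_above (range (\<lambda>k. Mk k \<omega>))"
    proof -
      obtain c where "\<And>k. \<bar>Mk k \<omega>\<bar> \<le> c" using elim(1) by (auto simp: bdd_above_def)
      then have "Mk k \<omega> \<le> c" for k using abs_le_D1 by blast
      then show ?thesis by (rule bdd_aboveI2)
    qed
    then have "Mk k \<omega> \<le> (SUP k. Mk k \<omega>)" for k by (rule cSUP_upper[OF UNIV_I])
    then show ?case using elim(2) by (meson less_imp_le order_trans)
  qed
  have Mk0: "AE \<omega> in M. \<forall>k. 0 \<le> Mk k \<omega>"
    using Mk_bound by eventually_elim (meson abs_ge_zero order_trans thetaD)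

  have Gm: "(\<lambda>\<omega>. G k \<omega> x) \<in> borel_measurable (Fc k)" for k x by (rule measurable_Fc[OF G_adapted])
  have GX: "(\<lambda>\<omega>. G k \<omega> (Z \<omega>)) \<in> borel_measurable (Fc k)" if "Z \<in> borel_measurable (Fc k)" for k Z
    by (rule measurable_Fc_caratheodory[OF Gm cont that])
  have G'X: "(\<lambda>\<omega>. G' k \<omega> (Z \<omega>)) \<in> borel_measurable (Fc k)" if "Z \<in> borel_measurable (Fc k)" for k Z
    by (rule measurable_Fc_derivative[OF Gm der that])
  have phim: "phi k \<in> borel_measurable (Fc k)" for k by (rule measurable_Fc[OF phi_adapted])
  have phix: "(\<lambda>\<omega>. phi k \<omega> \<bullet> Z \<omega>) \<in> borel_measurable (Fc k)" if "Z \<in> borel_measurable (Fc k)" for k Z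
    by (rule borel_measurable_inner[OF phim that])
  have mum: "mu k \<in> borel_measurable (Fc k)" for k by (rule measurable_Fc[OF mu_adapted])
  have Mkm: "Mk k \<in> borel_measurable (Fc k)" for k by (rule measurable_Fc[OF Mk_adapted])
  have yFc: "y k \<in> borel_measurable (Fc (Suc k))" for k by (rule measurable_Fc[OF ym])
  \<comment> \<open>Continuity of the derivative comes from the Lipschitz condition, which holds
    within \<open>Mbig\<close> only; it makes the extrema over the random intervals
    measurable.\<close>
  have G'cont: "AE \<omega> in M. 0 \<le> Mk k \<omega> \<and> continuous_on {- Mk k \<omega> .. Mk k \<omega>} (G' k \<omega>)" for k
    using Mk0 Mk_Mbig G'_lip rho_nonneg
  proof eventually_elim
    case (elim \<omega>)
    have "(rho \<omega>)-lipschitz_on {- Mk k \<omega> .. Mk k \<omega>} (G' k \<omega>)"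
    proof (rule lipschitz_onI)
      fix x z assume "x \<in> {- Mk k \<omega> .. Mk k \<omega>}" "z \<in> {- Mk k \<omega> .. Mk k \<omega>}"
      moreover have "Mk k \<omega> \<le> Mbig \<omega>" using elim(2) by blast
      ultimately have "\<bar>x\<bar> \<le> Mbig \<omega>" "\<bar>z\<bar> \<le> Mbig \<omega>" by auto
      then show "dist (G' k \<omega> x) (G' k \<omega> z) \<le> rho \<omega> * dist x z" using elim(3) by (simp add: dist_real_def)
    qed (rule elim(4))
    then show ?case using elim(1) lipschitz_on_continuous_on by blast
  qed
  have glm: "gl k \<in> borel_measurable (Fc k)" for k
    unfolding gl_def by (rule measurable_Fc_Inf[OF G'X Mkm G'cont])
  have gum: "gu k \<in> borel_measurable (Fc k)" for k
    unfolding gu_def by (rule measurable_Fc_Sup[OF G'X Mkm G'cont])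
  have up: "f \<in> borel_measurable (Fc (Suc k))" if "f \<in> borel_measurable (Fc k)" for f :: "'a \<Rightarrow> real" and k
    by (rule measurable_Fc_mono[OF _ that]) simp

  have m1: "thb k \<in> borel_measurable (Fc k)" "sb k \<in> borel_measurable (Fc k)" "ab k \<in> borel_measurable (Fc k)" "bb k \<in> borel_measurable (Fc k)" for k
  proof -
    have h1: "AE \<omega> in M. quasi_newton D (\<lambda>k. phi k \<omega>) (\<lambda>k. bb k \<omega>) (\<lambda>_. 1) (\<lambda>k. rb k \<omega>) (\<lambda>k. thb k \<omega>) (\<lambda>k. Pb k \<omega>) (\<lambda>k. sb k \<omega>) (\<lambda>k. ab k \<omega>)"
      using qn1 by simp
    have h2: "thb 0 \<omega> = thb0" "Pb 0 \<omega> = Pb0" for \<omega> by (simp_all add: thb_def Pb_def)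
    have h3: "bb k \<in> borel_measurable (Fc k)" if "Pb k \<in> borel_measurable (Fc k)" for k
    proof -
      have "sb k \<in> borel_measurable (Fc k)" unfolding sb_def
        by (rule phix[OF measurable_matrix_vector_mult[OF that phim]])
      then show ?thesis unfolding bb_def using glm[of k] gum[of k] by measurable
    qed
    have h4: "rb k \<in> borel_measurable (Fc (Suc k))" if "thb k \<in> borel_measurable (Fc k)" for k
      unfolding rb_def by (intro borel_measurable_diff yFc up[OF GX[OF phix[OF that]]])
    note meas1 = quasi_newton_measurable[OF D_convex D_compact Dne h1 h2 phim borel_measurable_const h3 h4]
    show "thb k \<in> borel_measurable (Fc k)" "sb k \<in> borel_measurable (Fc k)" "ab k \<in> borel_measurable (Fc k)" "bb k \<in> borel_measurable (Fc k)"
      by (rule meas1; assumption)+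
  qed
  have m2: "th k \<in> borel_measurable (Fc k)" "s k \<in> borel_measurable (Fc k)" "a k \<in> borel_measurable (Fc k)" "b k \<in> borel_measurable (Fc k)" for k
  proof -
    have h2: "th 0 \<omega> = th0" "P 0 \<omega> = P0" for \<omega> by (simp_all add: th_def P_def)
    have h3: "b k \<in> borel_measurable (Fc k)" if t: "th k \<in> borel_measurable (Fc k)" for k
    proof -
      note q = phix[OF t] phix[OF m1(1)[of k]]
      have c: "{\<omega> \<in> space (Fc k). phi k \<omega> \<bullet> th k \<omega> \<noteq> phi k \<omega> \<bullet> thb k \<omega>} \<in> sets (Fc k)"
        using q by measurable
      show ?thesis unfolding b_def
        by (rule measurable_If[OF _ G'X[OF q(1)] c])
           (intro borel_measurable_divide borel_measurable_diff GX q)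
    qed
    have h4: "r k \<in> borel_measurable (Fc (Suc k))" if "th k \<in> borel_measurable (Fc k)" for k
      unfolding r_def by (intro borel_measurable_diff yFc up[OF GX[OF phix[OF that]]])
    note meas2 = quasi_newton_measurable[OF D_convex D_compact Dne qn2 h2 phim mum h3 h4]
    show "th k \<in> borel_measurable (Fc k)" "s k \<in> borel_measurable (Fc k)" "a k \<in> borel_measurable (Fc k)" "b k \<in> borel_measurable (Fc k)"
      by (rule meas2; assumption)+
  qed
  have GXt: "(\<lambda>\<omega>. G k \<omega> (phi k \<omega> \<bullet> theta)) \<in> borel_measurable (Fc k)" for k
    by (rule GX[OF phix[OF borel_measurable_const]])
  have phid: "(\<lambda>\<omega>. phi k \<omega> \<bullet> (theta - Z \<omega>)) \<in> borel_measurable (Fc k)" if "Z \<in> borel_measurable (Fc k)" for k Z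
    by (rule phix[OF borel_measurable_diff[OF borel_measurable_const that]])
  have f1m: "f1 k \<in> borel_measurable (Fc k)" for k
    unfolding f1_def
    by (intro borel_measurable_times borel_measurable_diff borel_measurable_const borel_measurable_power
        m1 GXt GX[OF phix[OF m1(1)]] phid[OF m1(1)])
  have f2m: "f2 k \<in> borel_measurable (Fc k)" for k
    unfolding f2_def
    by (intro borel_measurable_times borel_measurable_divide borel_measurable_diff borel_measurable_const borel_measurable_power
        m2 mum GXt GX[OF phix[OF m2(1)]] phid[OF m2(1)])
  have h1m: "(\<lambda>\<omega>. ab k \<omega> * (bb k \<omega>)\<^sup>2 * sb k \<omega>) \<in> borel_measurable (Fc k)" for k
    by (intro borel_measurable_times borel_measurable_power m1)
  have h2m: "(\<lambda>\<omega>. a k \<omega> * (b k \<omega>)\<^sup>2 * s k \<omega>) \<in> borel_measurable (Fc k)" for k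
    by (intro borel_measurable_times borel_measurable_power m2)
  have h1b: "AE \<omega> in M. \<forall>k. 0 \<le> ab k \<omega> * (bb k \<omega>)\<^sup>2 * sb k \<omega> \<and> ab k \<omega> * (bb k \<omega>)\<^sup>2 * sb k \<omega> \<le> 1"
    using quasi_newton.gain_bounds[OF qn1] by simp
  have h2b: "AE \<omega> in M. \<forall>k. 0 \<le> a k \<omega> * (b k \<omega>)\<^sup>2 * s k \<omega> \<and> a k \<omega> * (b k \<omega>)\<^sup>2 * s k \<omega> \<le> 1"
    using qn2
  proof eventually_elim
    case (elim \<omega>)
    show ?case using quasi_newton.gain_bounds[OF elim] by blast
  qed

  have bdd: "AE \<omega> in M. \<exists>N. \<forall>k. \<bar>X k \<omega>\<bar> \<le> N \<and> C k \<omega> \<le> N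
      \<and> nn_cond_exp M (F k) (\<lambda>\<omega>. ennreal (\<bar>e (Suc k) \<omega>\<bar> powr (2 + eta))) \<omega> \<le> ennreal N"
    using phi_bounded thresholds l_bound u_bound e_mom_up
  proof eventually_elim
    case (elim \<omega>)
    obtain Bp where Bp: "\<And>k. norm (phi k \<omega>) \<le> Bp" using elim(1) by (auto simp: bdd_above_def)
    define S where "S = (SUP k. nn_cond_exp M (F k) (\<lambda>\<omega>'. ennreal (\<bar>e (Suc k) \<omega>'\<bar> powr (2 + eta))) \<omega>)"
    have S: "S < \<infinity>" using elim(5) by (simp only: S_def)
    \<comment> \<open>\<open>2 * c\<close> covers the two jumps at the thresholds, \<open>l\<close>
      and \<open>u\<close> their one-sided sizes. The supremum of the moments is finite, so
      \<open>enn2real\<close> loses nothing.\<close>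
    define N where "N = max (Bp * norm theta) (max (2 * c \<omega> + l \<omega> + u \<omega>) (enn2real S))"
    have "\<bar>X k \<omega>\<bar> \<le> N" for k
    proof -
      have "\<bar>X k \<omega>\<bar> \<le> norm (phi k \<omega>) * norm theta" unfolding X_def by (rule Cauchy_Schwarz_ineq2)
      also have "\<dots> \<le> Bp * norm theta" by (rule mult_right_mono[OF Bp]) simp
      finally show ?thesis by (simp add: N_def)
    qed
    moreover have "C k \<omega> \<le> N" for k
    proof -
      have "lb k \<omega> - c \<omega> \<le> Lb k \<omega>" "Ub k \<omega> \<le> ub k \<omega> + c \<omega>" "max (lb k \<omega>) 0 \<le> l \<omega>" "max (- ub k \<omega>) 0 \<le> u \<omega>"
        using elim(2,3,4) by blast+
      then have "C k \<omega> \<le> 2 * c \<omega> + l \<omega> + u \<omega>" unfolding C_def by linarith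
      then show ?thesis by (simp add: N_def)
    qed
    moreover have "nn_cond_exp M (F k) (\<lambda>\<omega>. ennreal (\<bar>e (Suc k) \<omega>\<bar> powr (2 + eta))) \<omega> \<le> ennreal N" for k
    proof -
      have "nn_cond_exp M (F k) (\<lambda>\<omega>. ennreal (\<bar>e (Suc k) \<omega>\<bar> powr (2 + eta))) \<omega> \<le> S"
        unfolding S_def by (rule SUP_upper) simp
      also have "S = ennreal (enn2real S)" using S by simp
      also have "\<dots> \<le> ennreal N" by (rule ennreal_leI) (simp add: N_def)
      finally show ?thesis .
    qed
    ultimately show ?case by blast
  qed
  have weq: "AE \<omega> in M. \<forall>k. w k \<omega> = y k \<omega> - real_cond_exp M (F k) (y k) \<omega>"
    using mean by eventually_elim (simp add: w_def X_def)
  have ybound: "AE \<omega> in M. \<bar>y k \<omega>\<bar> \<le> \<bar>X k \<omega>\<bar> + C k \<omega> + \<bar>e (Suc k) \<omega>\<bar>" for k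
    using Ybound[of k] unfolding y_def by eventually_elim blast
  have p2: "2 < 2 + eta" using eta_pos by simp
  note nb = noise_bounds[OF Xm Cm ym eM ybound p2 bdd weq]

  have g_bounds: "AE \<omega> in M. \<exists>g0>0. \<exists>g1. \<forall>k x. \<bar>x\<bar> \<le> Mbig \<omega> \<longrightarrow> g0 \<le> G' k \<omega> x \<and> G' k \<omega> x \<le> g1"
    using G'_bounds
  proof eventually_elim
    case (elim \<omega>)
    let ?I = "INF k. INF x\<in>{- Mbig \<omega> .. Mbig \<omega>}. ereal (G' k \<omega> x)"
    let ?S = "SUP k. SUP x\<in>{- Mbig \<omega> .. Mbig \<omega>}. ereal (G' k \<omega> x)"
    \<comment> \<open>Strict inequalities between extended reals leave room for real bounds.\<close>
    obtain g0 where g0: "0 < ereal g0" "ereal g0 < ?I" using elim ereal_dense2[of 0 ?I] by blast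
    obtain g1 where g1: "?S < ereal g1" using elim ereal_dense2[of ?S \<infinity>] by blast
    have "g0 \<le> G' k \<omega> x \<and> G' k \<omega> x \<le> g1" if "\<bar>x\<bar> \<le> Mbig \<omega>" for k x
    proof -
      have x: "x \<in> {- Mbig \<omega> .. Mbig \<omega>}" using that by auto
      have "?I \<le> (INF x\<in>{- Mbig \<omega> .. Mbig \<omega>}. ereal (G' k \<omega> x))" by (rule INF_lower) simp
      also have "\<dots> \<le> ereal (G' k \<omega> x)" by (rule INF_lower[OF x])
      finally have lo: "?I \<le> ereal (G' k \<omega> x)" .
      have "ereal (G' k \<omega> x) \<le> (SUP x\<in>{- Mbig \<omega> .. Mbig \<omega>}. ereal (G' k \<omega> x))" by (rule SUP_upper[OF x])
      also have "\<dots> \<le> ?S" by (rule SUP_upper) simp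
      finally have hi: "ereal (G' k \<omega> x) \<le> ?S" .
      have "ereal g0 < ereal (G' k \<omega> x)" by (rule less_le_trans[OF g0(2) lo])
      moreover have "ereal (G' k \<omega> x) < ereal g1" by (rule le_less_trans[OF hi g1])
      ultimately have "ereal g0 \<le> ereal (G' k \<omega> x)" "ereal (G' k \<omega> x) \<le> ereal g1" by (simp_all only: less_imp_le)
      then show ?thesis by simp
    qed
    then show ?case using g0(1) by (intro exI[of _ g0] exI[of _ g1] conjI) auto
  qed
  have mu_b: "AE \<omega> in M. \<exists>m0>0. \<exists>m1. \<forall>k. m0 \<le> mu k \<omega> \<and> mu k \<omega> \<le> m1"
    using mu_bounds
  proof eventually_elim
    case (elim \<omega>)
    let ?I = "INF k. ereal (mu k \<omega>)"
    let ?S = "SUP k. ereal (mu k \<omega>)"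
    obtain m0 where m0: "0 < ereal m0" "ereal m0 < ?I" using elim ereal_dense2[of 0 ?I] by blast
    obtain m1 where m1: "?S < ereal m1" using elim ereal_dense2[of ?S \<infinity>] by blast
    have "m0 \<le> mu k \<omega> \<and> mu k \<omega> \<le> m1" for k
    proof -
      have "?I \<le> ereal (mu k \<omega>)" by (rule INF_lower) simp
      then have "ereal m0 < ereal (mu k \<omega>)" by (rule less_le_trans[OF m0(2)])
      moreover have "ereal (mu k \<omega>) \<le> ?S" by (rule SUP_upper) simp
      then have "ereal (mu k \<omega>) < ereal m1" by (rule le_less_trans[OF _ m1])
      ultimately have "ereal m0 \<le> ereal (mu k \<omega>)" "ereal (mu k \<omega>) \<le> ereal m1" by (simp_all only: less_imp_le)
      then show ?thesis by simp
    qed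
    then show ?case using m0(1) by (intro exI[of _ m0] exI[of _ m1] conjI) auto
  qed

  have regret: "AE \<omega> in M. \<exists>K\<ge>0. \<forall>n. (\<Sum>k\<le>n. (G k \<omega> (phi k \<omega> \<bullet> theta) - G k \<omega> (phi k \<omega> \<bullet> th k \<omega>))\<^sup>2)
    \<le> K * max 1 (ln (max_eig ((\<Sum>i\<le>n. outer (phi i \<omega>) (phi i \<omega>)) + lambda0 *\<^sub>R mat 1)))"
    using nb(1)[OF f1m h1m h1b] nb(1)[OF f2m h2m h2b] nb(2)[OF f1m h1m h1b] nb(2)[OF f2m h2m h2b]
      qn2 phi_bounded Mk_bound Mk_Mbig G_deriv g_bounds mu_b rho_nonneg G'_lip
  proof eventually_elim
    case (elim \<omega>)
    note noise = elim(1-4) and q2 = elim(5) and mkb = elim(7)[rule_format] and mkM = elim(8)[rule_format]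
      and d = elim(9)[rule_format] and rho0 = elim(12) and lipG = elim(13)[rule_format]
    obtain Bp where Bp: "\<And>k. norm (phi k \<omega>) \<le> Bp" using elim(6) by (auto simp: bdd_above_def)
    obtain g0 g1 where g0: "0 < g0" and gb: "\<And>k x. \<bar>x\<bar> \<le> Mbig \<omega> \<Longrightarrow> g0 \<le> G' k \<omega> x \<and> G' k \<omega> x \<le> g1" using elim(10) by blast
    obtain m0 m1 where m0: "0 < m0" "\<And>k. m0 \<le> mu k \<omega>" "\<And>k. mu k \<omega> \<le> m1" using elim(11) by blast
    have gb': "g0 \<le> G' k \<omega> x \<and> G' k \<omega> x \<le> g1" if "\<bar>x\<bar> \<le> Mk k \<omega>" for k x
      by (rule gb[OF order_trans[OF that mkM]])
    have lip': "\<bar>G' k \<omega> x - G' k \<omega> z\<bar> \<le> rho \<omega> * \<bar>x - z\<bar>" if "\<bar>x\<bar> \<le> Mk k \<omega>" "\<bar>z\<bar> \<le> Mk k \<omega>" for k x z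
      by (rule lipG[OF order_trans[OF that(1) mkM] order_trans[OF that(2) mkM]])
    show ?case
      by (rule tsqn_regret_pathwise[OF thetaD lam Bp mkb mkM d g0 gb' lip' rho0 m0 w_def qn1 rb_def
          bb_def[unfolded gl_def gu_def] q2 r_def b_def f1_def f2_def noise])
  qed
  have est: "tsqn_est (\<lambda>j. phi j \<omega>)
                (\<lambda>j. sat (Lb j \<omega>) (lb j \<omega>) (ub j \<omega>) (Ub j \<omega>) (phi j \<omega> \<bullet> theta + e (Suc j) \<omega>))
                (\<lambda>j. G j \<omega>) (\<lambda>j. G' j \<omega>) (\<lambda>j. Mk j \<omega>) (\<lambda>j. mu j \<omega>) D thb0 Pb0 th0 P0 i = th i \<omega>" for i \<omega>
    by (simp only: tsqn_est_def Let_def th_def thb_def gl_def gu_def y_def Y_def X_def)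
  have yabs: "(\<lambda>\<omega>'. sat (Lb i \<omega>') (lb i \<omega>') (ub i \<omega>') (Ub i \<omega>') (phi i \<omega>' \<bullet> theta + e (Suc i) \<omega>')) = y i" for i
    by (simp add: fun_eq_iff y_def Y_def X_def)
  show ?thesis
    unfolding est yabs
    using regret mean
  proof eventually_elim
    case (elim \<omega>)
    define z where "z k = (G k \<omega> (phi k \<omega> \<bullet> theta) - G k \<omega> (phi k \<omega> \<bullet> th k \<omega>))\<^sup>2" for k
    obtain K where K: "0 \<le> K" "\<And>n. (\<Sum>k\<le>n. z k)
      \<le> K * max 1 (ln (max_eig ((\<Sum>i\<le>n. outer (phi i \<omega>) (phi i \<omega>)) + lambda0 *\<^sub>R mat 1)))"
      using elim(1) unfolding z_def by blast
    \<comment> \<open>The regret is summed from index 1, the bound starts at 0; the additional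
      summand is a square.\<close>
    have le: "(\<Sum>i = 1..n. z i) \<le> (\<Sum>i\<le>n. z i)" for n
      by (rule sum_mono2) (auto simp: z_def)
    have nonneg: "0 \<le> (\<Sum>i = 1..n. z i)" for n by (rule sum_nonneg) (simp add: z_def)
    have "norm (\<Sum>i = 1..n. z i)
      \<le> K * norm (max 1 (ln (max_eig ((\<Sum>i\<le>n. outer (phi i \<omega>) (phi i \<omega>)) + lambda0 *\<^sub>R mat 1))))" for n
    proof -
      have "norm (max 1 t) = max 1 t" for t :: real by simp
      then show ?thesis using le[of n] nonneg[of n] K(2)[of n] by simp
    qed
    then have "(\<lambda>n. \<Sum>i = 1..n. z i) \<in> O(\<lambda>k. max 1 (ln (max_eig ((\<Sum>i\<le>k. outer (phi i \<omega>) (phi i \<omega>)) + lambda0 *\<^sub>R mat 1))))"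
      by (intro bigoI always_eventually allI)
    moreover have "(real_cond_exp M (F i) (y i) \<omega> - G i \<omega> (phi i \<omega> \<bullet> th i \<omega>))\<^sup>2 = z i" for i
      using elim(2) by (simp add: z_def X_def)
    ultimately show ?case by simp
  qed
qed

end
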